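(* Let $1<p<\infty$ and let $\Phi:\mathbb{B}\to\mathbb{B}$ be a slice regular map such that $\Phi(\mathbb{B}_i)\subset\mathbb{B}_i$ for some $i\in\mathbb{S}$; fix such an $i$. For $a\in\mathbb{B}_i$ let $\sigma_a(q)=(1-q\bar a)^{-\star}\star(a-q)$, $q\in\mathbb{B}$, be the slice regular Möbius transformation. Then the composition operator $C_\Phi$ is bounded on the Besov space $\mathfrak{B}_p$ if and only if $$\sup_{a\in\mathbb{B}_i}\|C_\Phi\sigma_a\|_{\mathfrak{B}_p}<\infty .$$
   Context: $\mathbb{H}$ is the skew field of quaternions with Euclidean norm $|\cdot|$, $\mathbb{S}=\{q\in\mathbb{H}: q^2=-1\}$ is the sphere of imaginary units, $\mathbb{B}=\{q\in\mathbb{H}:|q|<1\}$. For $i\in\mathbb{S}$, $\mathbb{C}(i)=\mathbb{R}+\mathbb{R}i$ and $\mathbb{B}_i=\mathbb{B}\cap\mathbb{C}(i)$, identified with the unit disk. A real differentiable function $f:\mathbb{B}\to\mathbb{H}$ is (left) slice regular (also called slice holomorphic or slice hyperholomorphic) if for every $i\in\mathbb{S}$ its restriction $f_i$ to $\mathbb{B}_i$ satisfies $\frac{\partial}{\partial x}f_i(x+iy)+i\frac{\partial}{\partial y}f_i(x+iy)=0$. $SR(\mathbb{B})$ denotes the set of such functions. $\frac{\partial f}{\partial x_0}$ is the derivative in the real direction. Besov space: for $p>1$, $\mathfrak{B}_p$ is the space of $f\in SR(\mathbb{B})$ with $\sup_{i\in\mathbb{S}}\int_{\mathbb{B}_i}\left|(1-|q|^2)\frac{\partial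 f}{\partial x_0}(q)\right|^p d\lambda_i(q)<\infty$, where $d\lambda_i(q)=\frac{dA_i(q)}{(1-|q|^2)^2}$ and $dA_i$ is normalized area measure on $\mathbb{B}_i$. It is normed by $$\|f\|_{\mathfrak{B}_p}=|f(0)|+\left(\sup_{i\in\mathbb{S}}\int_{\mathbb{B}_i}\left|(1-|q|^2)\frac{\partial f}{\partial x_0}(q)\right|^p d\lambda_i(q)\right)^{1/p}$$ (the norm is $\infty$ if $f\in SR(\mathbb{B})\setminus\mathfrak{B}_p$). Composition operator: if $\Phi:\mathbb{B}\to\mathbb{B}$ is slice regular with $\Phi(\mathbb{B}_i)\subset\mathbb{B}_i$, then $C_\Phi f=f\circ_i\Phi$ is the unique slice regular function on $\mathbb{B}$ whose restriction to $\mathbb{B}_i$ is $f|_{\mathbb{B}_i}\circ\Phi|_{\mathbb{B}_i}$. Explicitly, writing $g=f|_{\mathbb{B}_i}\circ\Phi|_{\mathbb{B}_i}$, for $q=x+I_qy$ with $I_q\in\mathbb{S}$, $(C_\Phi f)(q)=\frac12\left[(1-I_qi)g(x+iy)+(1+I_qi)g(x-iy)\right]$. Regular product: for $f(q)=\sum q^na_n$, $g(q)=\sum q^nb_n$, $f\star g(q)=\sum_n q^n\sum_{k=0}^n a_kb_{n-k}$, and $f^{-\star}$ is the inverse with respect to $\star$. For $a\in\mathbb{B}_i$, the restriction of $\sigma_a$ to $\mathbb{B}_i$ is $z\mapsto\frac{a-z}{1-\bar az}$. *)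

theory Defs
  imports "HOL-Analysis.Analysis"
begin

section \<open>The skew field of quaternions\<close>

datatype quat = Quat (qRe: real) (qI: real) (qJ: real) (qK: real)

lemma quat_eq_iff: "p = q \<longleftrightarrow> qRe p = qRe q \<and> qI p = qI q \<and> qJ p = qJ q \<and> qK p = qK q"
  by (cases p; cases q) simp

instantiation quat :: ab_group_add
begin

definition "0 = Quat 0 0 0 0"
definition "p + q = Quat (qRe p + qRe q) (qI p + qI q) (qJ p + qJ q) (qK p + qK q)"
definition "- q = Quat (- qRe q) (- qI q) (- qJ q) (- qK q)"
definition "p - q = Quat (qRe p - qRe q) (qI p - qI q) (qJ p - qJ q) (qK p - qK q)"

instance
  by standard (simp_all add: quat_eq_iff zero_quat_def plus_quat_def uminus_quat_def minus_quat_def)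

end

lemma quat_add_simps [simp]:
  "qRe 0 = 0" "qI 0 = 0" "qJ 0 = 0" "qK 0 = 0"
  "qRe (p + q) = qRe p + qRe q" "qI (p + q) = qI p + qI q"
  "qJ (p + q) = qJ p + qJ q" "qK (p + q) = qK p + qK q"
  "qRe (- q) = - qRe q" "qI (- q) = - qI q" "qJ (- q) = - qJ q" "qK (- q) = - qK q"
  "qRe (p - q) = qRe p - qRe q" "qI (p - q) = qI p - qI q"
  "qJ (p - q) = qJ p - qJ q" "qK (p - q) = qK p - qK q"
  by (simp_all add: zero_quat_def plus_quat_def uminus_quat_def minus_quat_def)

instantiation quat :: real_vector
begin

definition "r *\<^sub>R q = Quat (r * qRe q) (r * qI q) (r * qJ q) (r * qK q)"

instance
  by standard (simp_all add: quat_eq_iff scaleR_quat_def algebra_simps)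

end

lemma quat_scaleR_simps [simp]:
  "qRe (r *\<^sub>R q) = r * qRe q" "qI (r *\<^sub>R q) = r * qI q"
  "qJ (r *\<^sub>R q) = r * qJ q" "qK (r *\<^sub>R q) = r * qK q"
  by (simp_all add: scaleR_quat_def)

instantiation quat :: real_inner
begin

definition "inner p q = qRe p * qRe q + qI p * qI q + qJ p * qJ q + qK p * qK q"
definition norm_quat :: "quat \<Rightarrow> real"
  where "norm_quat q = sqrt (qRe q ^ 2 + qI q ^ 2 + qJ q ^ 2 + qK q ^ 2)"
definition "sgn (q::quat) = q /\<^sub>R norm q"
definition "dist (p::quat) q = norm (p - q)"
definition
  "(uniformity :: (quat \<times> quat) filter) = (INF e\<in>{0<..}. principal {(x, y). dist x y < e})"
definition
  "open (U :: quat set) \<longleftrightarrow> (\<forall>x\<in>U. eventually (\<lambda>(x', y). x' = x \<longrightarrow> y \<in> U) uniformity)"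

instance
proof
  fix p q r :: quat and c :: real
  show "inner p p = 0 \<longleftrightarrow> p = 0"
    unfolding inner_quat_def quat_eq_iff
    by (smt (verit) quat_add_simps(1-4) mult_eq_0_iff not_sum_squares_lt_zero zero_le_square)
qed (simp_all add: inner_quat_def norm_quat_def sgn_quat_def dist_quat_def uniformity_quat_def
      open_quat_def algebra_simps power2_eq_square)

end

instantiation quat :: euclidean_space
begin

definition "Basis = {Quat 1 0 0 0, Quat 0 1 0 0, Quat 0 0 1 0, Quat 0 0 0 1}"

instance
proof
  fix u v :: quat
  assume "u \<in> Basis" "v \<in> Basis"
  then show "inner u v = (if u = v then 1 else 0)"
    unfolding Basis_quat_def inner_quat_def by (elim insertE emptyE) simp_all
next
  fix x :: quat
  show "(\<forall>u\<in>Basis. inner x u = 0) \<longleftrightarrow> x = 0"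
    by (simp add: Basis_quat_def inner_quat_def) (simp add: quat_eq_iff)
qed (simp_all add: Basis_quat_def)

end

instantiation quat :: real_normed_div_algebra
begin

definition "1 = Quat 1 0 0 0"
definition "p * q = Quat
  (qRe p * qRe q - qI p * qI q - qJ p * qJ q - qK p * qK q)
  (qRe p * qI q + qI p * qRe q + qJ p * qK q - qK p * qJ q)
  (qRe p * qJ q - qI p * qK q + qJ p * qRe q + qK p * qI q)
  (qRe p * qK q + qI p * qJ q - qJ p * qI q + qK p * qRe q)"
definition "inverse (q::quat) = Quat (qRe q) (- qI q) (- qJ q) (- qK q) /\<^sub>R (norm q)\<^sup>2"
definition "p div (q::quat) = p * inverse q"

instance
proof
  fix p q :: quat
  have n: "(norm q)\<^sup>2 = qRe q ^ 2 + qI q ^ 2 + qJ q ^ 2 + qK q ^ 2" for q :: quat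
    by (simp add: norm_quat_def)
  show "norm (p * q) = norm p * norm q"
    unfolding norm_quat_def real_sqrt_mult[symmetric]
    by (rule arg_cong[of _ _ sqrt]) (simp add: times_quat_def power2_eq_square algebra_simps)
  assume "q \<noteq> 0"
  then have nz: "(norm q)\<^sup>2 \<noteq> 0" by simp
  let ?c = "Quat (qRe q) (- qI q) (- qJ q) (- qK q)"
  have "?c * q = (norm q)\<^sup>2 *\<^sub>R 1" "q * ?c = (norm q)\<^sup>2 *\<^sub>R 1"
    unfolding n by (auto simp: quat_eq_iff times_quat_def one_quat_def power2_eq_square algebra_simps)
  moreover have "(c *\<^sub>R x) * y = c *\<^sub>R (x * y)" "x * (c *\<^sub>R y) = c *\<^sub>R (x * y)" for c and x y :: quat
    by (simp_all add: quat_eq_iff times_quat_def algebra_simps)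
  ultimately show "inverse q * q = 1" "q * inverse q = 1"
    using nz by (simp_all add: inverse_quat_def)
qed (auto simp: quat_eq_iff times_quat_def one_quat_def inverse_quat_def divide_quat_def algebra_simps)

end

definition qcnj :: "quat \<Rightarrow> quat"
  where "qcnj q = Quat (qRe q) (- qI q) (- qJ q) (- qK q)"

definition qIm :: "quat \<Rightarrow> quat"
  where "qIm q = Quat 0 (qI q) (qJ q) (qK q)"


section \<open>Slices and slice regular functions\<close>

definition imag_units :: "quat set" (\<open>\<S>\<close>)
  where "\<S> = {q. q\<^sup>2 = -1}"

abbreviation quat_ball :: "quat set" (\<open>\<B>\<close>)
  where "\<B> \<equiv> ball 0 1"

definition slice_pt :: "quat \<Rightarrow> complex \<Rightarrow> quat"
  where "slice_pt i z = of_real (Re z) + i * of_real (Im z)"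

definition slice_ball :: "quat \<Rightarrow> quat set"
  where "slice_ball i = \<B> \<inter> range (slice_pt i)"

definition slice_regular :: "(quat \<Rightarrow> quat) \<Rightarrow> bool"
  where "slice_regular f \<longleftrightarrow> f differentiable_on \<B> \<and>
    (\<forall>i\<in>\<S>. \<forall>x y :: real. of_real x + i * of_real y \<in> \<B> \<longrightarrow>
      vector_derivative (\<lambda>s. f (of_real s + i * of_real y)) (at x)
      + i * vector_derivative (\<lambda>t. f (of_real x + i * of_real t)) (at y) = 0)"

definition real_dir_deriv :: "(quat \<Rightarrow> quat) \<Rightarrow> quat \<Rightarrow> quat"
  where "real_dir_deriv f q = vector_derivative (\<lambda>t. f (q + of_real t)) (at 0)"


section \<open>Regular product and regular Moebius transformations\<close>

text \<open>Functions are total on \<^typ>\<open>quat\<close>, but only their values on \<open>\<B>\<close> are meaningful.  The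
  coefficients are unique when they exist, and they exist for every slice regular function.\<close>

definition slice_coeffs :: "(quat \<Rightarrow> quat) \<Rightarrow> nat \<Rightarrow> quat"
  where "slice_coeffs f = (THE a. \<forall>q\<in>\<B>. (\<lambda>n. q ^ n * a n) sums f q)"

definition star_prod :: "(quat \<Rightarrow> quat) \<Rightarrow> (quat \<Rightarrow> quat) \<Rightarrow> quat \<Rightarrow> quat" (infixl \<open>\<star>\<close> 70)
  where "(f \<star> g) q = (\<Sum>n. q ^ n * (\<Sum>k\<le>n. slice_coeffs f k * slice_coeffs g (n - k)))"

text \<open>The inverse is unique only as a function on \<open>\<B>\<close>, hence \<open>SOME\<close> and not \<open>THE\<close>.\<close>

definition star_inv :: "(quat \<Rightarrow> quat) \<Rightarrow> quat \<Rightarrow> quat"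
  where "star_inv f = (SOME g. slice_regular g \<and> (\<forall>q\<in>\<B>. (f \<star> g) q = 1 \<and> (g \<star> f) q = 1))"

definition slice_moebius :: "quat \<Rightarrow> quat \<Rightarrow> quat"
  where "slice_moebius a = star_inv (\<lambda>q. 1 - q * qcnj a) \<star> (\<lambda>q. a - q)"


section \<open>Slice composition\<close>

text \<open>For \<open>q = x + I\<^sub>q y\<close> we take \<open>y = \<bar>qIm q\<bar>\<close> and \<open>I\<^sub>q = sgn (qIm q)\<close>.  For real \<open>q\<close> every unit
  \<open>I\<^sub>q\<close> yields the value \<open>g x\<close>, and so does the value \<open>sgn 0 = 0\<close> used here.\<close>

definition slice_comp :: "quat \<Rightarrow> (quat \<Rightarrow> quat) \<Rightarrow> (quat \<Rightarrow> quat) \<Rightarrow> quat \<Rightarrow> quat"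
  where "slice_comp i \<Phi> f q =
    (let x = of_real (qRe q); y = of_real (norm (qIm q)); I = sgn (qIm q); g = f \<circ> \<Phi>
     in (1 / 2) *\<^sub>R ((1 - I * i) * g (x + i * y) + (1 + I * i) * g (x - i * y)))"


section \<open>Besov spaces\<close>

text \<open>The slice \<open>slice_ball i\<close> is identified with the unit disk of \<^typ>\<open>complex\<close> via
  \<^term>\<open>slice_pt i\<close>, which is isometric for \<open>i \<in> \<S>\<close>; the measure \<open>\<lambda>\<^sub>i\<close> then does not depend on \<open>i\<close>.\<close>

definition disk_measure :: "complex measure"
  where "disk_measure = density (uniform_measure lborel (ball 0 1))
    (\<lambda>z. ennreal (1 / (1 - (norm z)\<^sup>2)\<^sup>2))"

definition besov_slice_integral :: "real \<Rightarrow> quat \<Rightarrow> (quat \<Rightarrow> quat) \<Rightarrow> ennreal"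
  where "besov_slice_integral p i f = (\<integral>\<^sup>+ z. (let q = slice_pt i z in
    ennreal (norm ((1 - (norm q)\<^sup>2) *\<^sub>R real_dir_deriv f q) powr p)) \<partial>disk_measure)"

definition besov_sup :: "real \<Rightarrow> (quat \<Rightarrow> quat) \<Rightarrow> ennreal"
  where "besov_sup p f = (SUP i\<in>\<S>. besov_slice_integral p i f)"

definition besov :: "real \<Rightarrow> (quat \<Rightarrow> quat) set"
  where "besov p = {f. slice_regular f \<and> besov_sup p f < \<infinity>}"

definition ennreal_root :: "real \<Rightarrow> ennreal \<Rightarrow> ennreal"
  where "ennreal_root p x = (if x = \<infinity> then \<infinity> else ennreal (enn2real x powr (1 / p)))"

definition besov_norm :: "real \<Rightarrow> (quat \<Rightarrow> quat) \<Rightarrow> ennreal"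
  where "besov_norm p f = ennreal (norm (f 0)) + ennreal_root p (besov_sup p f)"

definition bounded_on_besov :: "real \<Rightarrow> ((quat \<Rightarrow> quat) \<Rightarrow> (quat \<Rightarrow> quat)) \<Rightarrow> bool"
  where "bounded_on_besov p T \<longleftrightarrow>
    (\<exists>K::real. \<forall>f\<in>besov p. T f \<in> besov p \<and> besov_norm p (T f) \<le> ennreal K * besov_norm p f)"

end

theory Submission
  imports Defs "HOL-Complex_Analysis.Complex_Analysis"
begin

text \<open>
  On the slice of \<open>i\<close> write \<open>\<Phi>\<close> as a holomorphic self-map \<open>\<phi>\<close> of the unit disk, and split a slice
  regular function into two holomorphic functions.  Then the Besov seminorm of \<open>C\<^sub>\<Phi> f\<close> on this slice
  is the \<open>L\<^sup>p\<close>-norm of \<open>f'\<close> with respect to the push-forward \<open>\<mu>\<close> of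
  \<open>\<bar>\<phi>'\<bar>\<^sup>p (1 - \<bar>z\<bar>\<^sup>2)\<^sup>p\<^sup>-\<^sup>2 dA\<close> under \<open>\<phi>\<close>, and the condition on the maps \<open>\<sigma>\<^sub>a\<close> says that
  \<open>\<integral> \<bar>\<sigma>\<^sub>a'\<bar>\<^sup>p d\<mu>\<close> is bounded uniformly in \<open>a\<close>.  This is a Carleson condition: the mean value
  inequality on disks of radius \<open>(1 - \<bar>w\<bar>) / 2\<close> gives
  \<open>\<bar>g w\<bar>\<^sup>p \<le> C \<integral> \<bar>g \<zeta>\<bar>\<^sup>p (1 - \<bar>\<zeta>\<bar>\<^sup>2)\<^sup>p\<^sup>-\<^sup>2 \<bar>\<sigma>\<^sub>\<zeta>' w\<bar>\<^sup>p dA(\<zeta>)\<close> for holomorphic \<open>g\<close>, and integrating this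
  against \<open>\<mu>\<close> with Tonelli's theorem bounds \<open>C\<^sub>\<Phi>\<close>.  Conversely, the \<open>\<sigma>\<^sub>a\<close> are bounded in the Besov space
  by Moebius invariance of \<open>dA / (1 - \<bar>z\<bar>\<^sup>2)\<^sup>2\<close>.  The representation formula controls all slices by
  the slice of \<open>i\<close>.
\<close>

section \<open>Lebesgue measure on the complex plane\<close>

text \<open>The Moebius maps suffice as test functions because their kernel fits the mean value
  disk. With d = 1 - |w|, the weight at \<zeta>, the power |\<sigma>_\<zeta>' w|^p and the area of
  the disk around w have the orders d^(p-2), d^(-p) and d^2, whose product is of order 1. After
  Tonelli the integration variable \<zeta> has become the parameter of a test map, so the hypothesis
  bounds the inner integral directly, with no duality argument and no covering of the disk. The
  other obstacle is noncommutativity. Projection to C(i) is linear for multiplication by C(i) from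
  the left; hence the projections of f and of f j, with j orthogonal to i, are holomorphic on the
  slice, and composition with \<phi> acts on each of them separately. The maps \<sigma>_a with a in
  B_i send the slice to itself, so their first component determines them there. The term |f 0| of
  the norm needs its own estimate, since (C_\<Phi> f)(0) = f(\<Phi> 0). The push-forward \<mu> is
  never formed: all integrals stay on the source disk and carry the factor \<phi>'. They are
  \<open>ennreal\<close>-valued, so that Tonelli asks for measurability only.\<close>

definition complex_of_vec2 :: "real^2 \<Rightarrow> complex"
  where "complex_of_vec2 x = Complex (x$1) (x$2)"

definition vec2_of_complex :: "complex \<Rightarrow> real^2"
  where "vec2_of_complex z = vector [Re z, Im z]"

lemma complex_of_vec2_inverse [simp]: "vec2_of_complex (complex_of_vec2 x) = x"
  by (simp add: complex_of_vec2_def vec2_of_complex_def vec_eq_iff forall_2)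

lemma vec2_of_complex_inverse [simp]: "complex_of_vec2 (vec2_of_complex z) = z"
  by (simp add: complex_of_vec2_def vec2_of_complex_def)

lemma bounded_linear_complex_of_vec2: "bounded_linear complex_of_vec2"
proof -
  have "complex_of_vec2 = (\<lambda>x. of_real (x$1) + \<i> * of_real (x$2))"
    by (auto simp: complex_of_vec2_def complex_eq_iff)
  moreover have "bounded_linear (\<lambda>x::real^2. complex_of_real (x$1) + \<i> * of_real (x$2))"
    by (intro bounded_linear_add bounded_linear_compose[OF bounded_linear_of_real]
        bounded_linear_compose[OF bounded_linear_mult_right] bounded_linear_vec_nth)
  ultimately show ?thesis by simp
qed

lemma bounded_linear_vec2_of_complex: "bounded_linear vec2_of_complex"
proof -
  have "vec2_of_complex = (\<lambda>z. Re z *\<^sub>R axis 1 1 + Im z *\<^sub>R axis 2 1)"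
    by (auto simp: vec2_of_complex_def vec_eq_iff forall_2 axis_def)
  moreover have "bounded_linear (\<lambda>z. Re z *\<^sub>R (axis 1 1 :: real^2) + Im z *\<^sub>R axis 2 1)"
    by (intro bounded_linear_add bounded_linear_compose[OF bounded_linear_scaleR_left]
        bounded_linear_Re bounded_linear_Im)
  ultimately show ?thesis by simp
qed

lemma measurable_complex_of_vec2 [measurable]: "complex_of_vec2 \<in> borel_measurable borel"
  by (intro borel_measurable_continuous_onI
      linear_continuous_on bounded_linear_complex_of_vec2)

text \<open>Both measures give every box the product of its side lengths. This carries planar
  integrals to \<open>real^2\<close>, the setting of the change of variables theorem used
  below.\<close>

lemma distr_complex_of_vec2: "distr lborel borel complex_of_vec2 = lborel"
proof (rule lborel_eqI[symmetric])
  fix l u :: complex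
  assume le: "\<And>b. b \<in> Basis \<Longrightarrow> l \<bullet> b \<le> u \<bullet> b"
  have vimage: "complex_of_vec2 -` box l u = box (vec2_of_complex l) (vec2_of_complex u)"
    by (auto simp: box_def vec2_of_complex_def complex_of_vec2_def Basis_complex_def
        Basis_vec_def inner_axis UNIV_2 forall_2)
  have basis: "(Basis :: (real^2) set) = {axis 1 1, axis 2 1}"
    by (auto simp: Basis_vec_def UNIV_2)
  have neq: "axis (1::2) (1::real) \<noteq> axis 2 1"
    by (simp add: axis_eq_axis)
  have "emeasure (distr lborel borel complex_of_vec2) (box l u)
      = emeasure lborel (box (vec2_of_complex l) (vec2_of_complex u))"
    by (simp add: emeasure_distr vimage)
  also have "\<dots> = (\<Prod>b\<in>Basis. (vec2_of_complex u - vec2_of_complex l) \<bullet> b)"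
    using le[of 1] le[of \<i>]
    by (intro emeasure_lborel_box) (auto simp: basis Basis_complex_def vec2_of_complex_def inner_axis)
  also have "\<dots> = (\<Prod>b\<in>Basis. (u - l) \<bullet> b)"
    unfolding basis using neq
    by (simp add: Basis_complex_def inner_diff_left inner_axis vec2_of_complex_def)
  finally show "emeasure (distr lborel borel complex_of_vec2) (box l u) = (\<Prod>b\<in>Basis. (u - l) \<bullet> b)" .
qed simp

lemma nn_integral_complex_of_vec2:
  assumes [measurable]: "f \<in> borel_measurable borel"
  shows "(\<integral>\<^sup>+z. f z \<partial>lborel) = (\<integral>\<^sup>+x. f (complex_of_vec2 x) \<partial>lborel)"
  by (subst distr_complex_of_vec2[symmetric]) (simp add: nn_integral_distr)

text \<open>Conjugation scales the two coordinates by 1 and -1, so its Jacobian factor is 1. It is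
  needed because the representation formula for slice regular functions mixes the values at
  \<open>z\<close> and \<open>cnj z\<close>.\<close>

lemma nn_integral_lborel_cnj:
  assumes [measurable]: "f \<in> borel_measurable borel"
  shows "(\<integral>\<^sup>+z. f (cnj z) \<partial>lborel) = (\<integral>\<^sup>+z. f z \<partial>lborel)"
proof -
  have "lborel = density (distr lborel borel (\<lambda>z::complex. 0 + (\<Sum>j\<in>Basis. ((if j = \<i> then - 1 else 1) * (z \<bullet> j)) *\<^sub>R j)))
      (\<lambda>_. (\<Prod>j\<in>Basis. \<bar>if j = \<i> then - 1 else 1 :: real\<bar>))"
    by (rule lborel_affine_euclidean) auto
  moreover have "(\<lambda>z::complex. 0 + (\<Sum>j\<in>Basis. ((if j = \<i> then - 1 else 1) * (z \<bullet> j)) *\<^sub>R j)) = cnj"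
    by (auto simp: Basis_complex_def complex_eq_iff complex_i_not_one[symmetric] fun_eq_iff)
  moreover have "(\<Prod>j\<in>(Basis::complex set). \<bar>if j = \<i> then - 1 else 1 :: real\<bar>) = 1"
    by (rule prod.neutral) auto
  ultimately have eq: "lborel = distr lborel borel cnj" by (simp add: density_1)
  have [measurable]: "cnj \<in> borel_measurable borel"
    by (intro borel_measurable_continuous_onI continuous_intros)
  show ?thesis
    by (subst (2) eq) (simp add: nn_integral_distr)
qed

section \<open>Change of variables for injective holomorphic maps\<close>

lemma has_integral_mult_indicator:
  fixes f :: "'a::euclidean_space \<Rightarrow> real"
  shows "((\<lambda>x. f x * indicator S x) has_integral r) UNIV \<longleftrightarrow> (f has_integral r) S"
proof -
  have "(\<lambda>x. f x * indicator S x) = (\<lambda>x. if x \<in> S then f x else 0)" by auto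
  then show ?thesis by (simp add: has_integral_restrict_UNIV)
qed

text \<open>The real Jacobian determinant of a holomorphic map is \<open>\<bar>h'\<bar>\<^sup>2\<close>.\<close>

lemma nn_integral_holomorphic_substitution:
  fixes h h' :: "complex \<Rightarrow> complex"
  assumes S: "open S" and h: "\<And>z. z \<in> S \<Longrightarrow> (h has_field_derivative h' z) (at z)"
    and inj: "inj_on h S" and u[measurable]: "u \<in> borel_measurable borel" and u0: "\<And>w. 0 \<le> u w"
    and hS: "h ` S \<in> sets borel"
    and fin: "(\<integral>\<^sup>+w. ennreal (u w) * indicator (h ` S) w \<partial>lborel) < \<infinity>"
  shows "(\<integral>\<^sup>+z. ennreal ((norm (h' z))\<^sup>2 * u (h z)) * indicator S z \<partial>lborel)
    = (\<integral>\<^sup>+w. ennreal (u w) * indicator (h ` S) w \<partial>lborel)"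
proof -
  let ?T = "vec2_of_complex ` S"
  let ?g = "vec2_of_complex \<circ> h \<circ> complex_of_vec2"
  let ?g' = "\<lambda>x. vec2_of_complex \<circ> (\<lambda>k. h' (complex_of_vec2 x) * k) \<circ> complex_of_vec2"
  let ?J = "\<lambda>x. \<bar>det (matrix (?g' x))\<bar>"
  let ?f = "\<lambda>x. u (complex_of_vec2 x)"
  have T_eq: "?T = complex_of_vec2 -` S"
    by (auto simp: image_iff) (metis complex_of_vec2_inverse)
  have "open ?T"
    unfolding T_eq using S bounded_linear_complex_of_vec2
    by (intro open_vimage linear_continuous_on)
  then have T[measurable]: "?T \<in> sets borel" by simp
  have gT_eq: "?g ` ?T = complex_of_vec2 -` (h ` S)"
    by (auto simp: image_iff) (metis complex_of_vec2_inverse)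
  have gT[measurable]: "?g ` ?T \<in> sets borel"
    unfolding gT_eq using measurable_sets[OF measurable_complex_of_vec2 hS] by simp
  have der: "(?g has_derivative ?g' x) (at x within ?T)" if "x \<in> ?T" for x
  proof -
    have "(h has_derivative (\<lambda>k. h' (complex_of_vec2 x) * k)) (at (complex_of_vec2 x))"
      using h[of "complex_of_vec2 x"] that by (auto simp: has_field_derivative_def)
    then have "(?g has_derivative ?g' x) (at x)"
      by (intro diff_chain_at bounded_linear_imp_has_derivative
          bounded_linear_complex_of_vec2 bounded_linear_vec2_of_complex)
    then show ?thesis by (rule has_derivative_at_withinI)
  qed
  have inj': "inj_on ?g ?T"
    using inj by (auto simp: inj_on_def) (metis vec2_of_complex_inverse)
  have J: "?J x = (norm (h' (complex_of_vec2 x)))\<^sup>2" for x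
    unfolding cmod_power2
    by (simp add: det_2 matrix_def axis_def vec2_of_complex_def complex_of_vec2_def power2_eq_square)
  \<comment> \<open>Outside \<open>S\<close> nothing is known about \<open>h\<close> and
    \<open>h'\<close>, so only their cut-offs are shown measurable; for \<open>h'\<close> this rests
    on the continuity of the derivative of a holomorphic map.\<close>
  have h'_meas: "(\<lambda>z. indicator S z *\<^sub>R h' z) \<in> borel_measurable borel"
  proof (rule borel_measurable_continuous_on_indicator)
    have "h holomorphic_on S" using h S holomorphic_on_open by blast
    then have "continuous_on S (deriv h)"
      by (intro holomorphic_on_imp_continuous_on holomorphic_deriv S)
    then show "continuous_on S h'"
      by (rule continuous_on_eq) (use h DERIV_imp_deriv in blast)
  qed (use S in simp)
  have h_meas: "(\<lambda>z. indicator S z *\<^sub>R h z) \<in> borel_measurable borel"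
    using S h by (intro borel_measurable_continuous_on_indicator)
      (auto intro: continuous_at_imp_continuous_on DERIV_isCont)
  have fin': "(\<integral>\<^sup>+x. ennreal (?f x * indicator (?g ` ?T) x) \<partial>lborel)
      = (\<integral>\<^sup>+w. ennreal (u w) * indicator (h ` S) w \<partial>lborel)" (is "?F = ?I")
    using hS unfolding gT_eq by (subst nn_integral_complex_of_vec2)
      (auto intro!: nn_integral_cong split: split_indicator)
  \<comment> \<open>Finiteness lets the nonnegative integral be read as a gauge integral with real
    value \<open>r\<close>. The substitution is done for gauge integrals and translated back at the
    end.\<close>
  obtain r where r: "?I = ennreal r" "0 \<le> r" using fin by (cases ?I) auto
  have "(\<lambda>x. ?f x * indicator (?g ` ?T) x) \<in> borel_measurable borel"
    using u gT by (intro borel_measurable_times borel_measurable_indicator) (simp_all add: o_def)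
  then have f_int: "((\<lambda>x. ?f x * indicator (?g ` ?T) x) has_integral r) UNIV"
    by (rule nn_integral_has_integral) (use fin' r u0 in auto)
  then have f_int': "(?f has_integral r) (?g ` ?T)"
    by (simp only: has_integral_mult_indicator)
  have "?f absolutely_integrable_on (?g ` ?T)"
    by (rule nonnegative_absolutely_integrable_1) (use f_int' u0 in \<open>auto intro: has_integral_integrable\<close>)
  \<comment> \<open>The change of variables theorem takes vector-valued integrands, hence
    \<open>real^1\<close>.\<close>
  then have abs_int: "(\<lambda>x. vec (?f x) :: real^1) absolutely_integrable_on (?g ` ?T)"
    by (subst absolutely_integrable_on_1_iff) simp
  moreover have "integral (?g ` ?T) (\<lambda>x. vec (?f x) :: real^1) = vec r"
    using integral_unique[OF f_int'] by (simp add: integral_on_1_eq)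
  ultimately have *: "(\<lambda>x. ?J x *\<^sub>R (vec (?f (?g x)) :: real^1)) absolutely_integrable_on ?T"
      "integral ?T (\<lambda>x. ?J x *\<^sub>R (vec (?f (?g x)) :: real^1)) = vec r"
    using has_absolute_integral_change_of_variables[of ?T ?g ?g' "\<lambda>x. vec (?f x) :: real^1" "vec r", OF _ der inj']
    by auto
  have "(\<lambda>x. ?J x * ?f (?g x)) absolutely_integrable_on ?T"
    using *(1) by (simp only: absolutely_integrable_on_1_iff vector_scaleR_component vec_component
        real_scaleR_def)
  note set_lebesgue_integral_eq_integral(1)[OF this]
  moreover have "integral ?T (\<lambda>x. ?J x * ?f (?g x)) = r"
    using *(2) by (simp only: integral_on_1_eq vector_scaleR_component vec_component
        real_scaleR_def vec_eq_iff)
  ultimately have "((\<lambda>x. ?J x * ?f (?g x)) has_integral r) ?T"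
    using integrable_integral by fastforce
  then have "((\<lambda>x. (?J x * ?f (?g x)) * indicator ?T x) has_integral r) UNIV"
    by (simp only: has_integral_mult_indicator)
  then have I: "((\<lambda>x. ((norm (h' (complex_of_vec2 x)))\<^sup>2 * u (h (complex_of_vec2 x)))
      * indicator S (complex_of_vec2 x)) has_integral r) UNIV"
    by (simp only: J T_eq indicator_vimage o_apply vec2_of_complex_inverse)
  have [measurable]: "S \<in> sets borel" using S by simp
  have m: "(\<lambda>z. (norm (h' z))\<^sup>2 * u (h z) * indicator S z) \<in> borel_measurable borel"
  proof -
    have "(\<lambda>z. (norm (indicator S z *\<^sub>R h' z))\<^sup>2 * u (indicator S z *\<^sub>R h z) * indicator S z) \<in> borel_measurable borel"
      using h'_meas h_meas by measurable
    moreover have "(\<lambda>z. (norm (indicator S z *\<^sub>R h' z))\<^sup>2 * u (indicator S z *\<^sub>R h z) * indicator S z)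
        = (\<lambda>z. (norm (h' z))\<^sup>2 * u (h z) * indicator S z)"
      by (auto simp: fun_eq_iff split: split_indicator)
    ultimately show ?thesis by simp
  qed
  have "(\<integral>\<^sup>+z. ennreal ((norm (h' z))\<^sup>2 * u (h z)) * indicator S z \<partial>lborel)
    = (\<integral>\<^sup>+z. ennreal ((norm (h' z))\<^sup>2 * u (h z) * indicator S z) \<partial>lborel)"
    by (intro nn_integral_cong) (auto split: split_indicator)
  also have "\<dots> = (\<integral>\<^sup>+x. ennreal ((norm (h' (complex_of_vec2 x)))\<^sup>2 * u (h (complex_of_vec2 x)) * indicator S (complex_of_vec2 x)) \<partial>lborel)"
    by (rule nn_integral_complex_of_vec2[OF measurable_compose[OF m measurable_ennreal]])
  also have "\<dots> = ennreal r"
    by (rule nn_integral_has_integral_lborel[OF _ _ I])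
      (use measurable_compose[OF measurable_complex_of_vec2 m] u0 in auto)
  finally show ?thesis using r by simp
qed

section \<open>Mean value inequalities\<close>

text \<open>Cauchy's formula at the centre: along the circle dz / z equals the constant 2 pi i times
  dt, so the contour integral is an average over the parameter.\<close>

lemma has_integral_circle_mean:
  assumes "k holomorphic_on cball 0 1"
  shows "((\<lambda>t. k (exp (2 * of_real pi * \<i> * of_real t))) has_integral k 0) {0..1}"
proof -
  have "((\<lambda>u. k u / (u - 0)) has_contour_integral (2 * of_real pi * \<i> * k 0)) (circlepath 0 1)"
    by (rule Cauchy_integral_circlepath_simple) (use assms in auto)
  then have "((\<lambda>t. k (circlepath 0 1 t) / circlepath 0 1 t *
      vector_derivative (circlepath 0 1) (at t)) has_integral (2 * of_real pi * \<i> * k 0)) {0..1}"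
    by (simp add: has_contour_integral)
  then have "((\<lambda>t. (2 * of_real pi * \<i>) * k (exp (2 * of_real pi * \<i> * of_real t)))
      has_integral (2 * of_real pi * \<i> * k 0)) {0..1}"
    by (rule has_integral_eq[rotated]) (simp add: vector_derivative_circlepath, simp add: circlepath)
  then have "((\<lambda>t. (1 / (2 * of_real pi * \<i>)) * ((2 * of_real pi * \<i>) * k (exp (2 * of_real pi * \<i> * of_real t))))
      has_integral (1 / (2 * of_real pi * \<i>)) * (2 * of_real pi * \<i> * k 0)) {0..1}"
    by (rule has_integral_mult_right)
  then show ?thesis by simp
qed

text \<open>Integrating this inequality over a probability space, with \<open>m\<close> the mean of \<open>x\<close>, is Jensen's inequality.\<close>

lemma powr_tangent_le:
  fixes x m p :: real
  assumes "1 < p" "0 \<le> x" "0 < m"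
  shows "m powr p + p * m powr (p - 1) * (x - m) \<le> x powr p"
proof (cases "x = 0")
  case True
  have "m powr (p - 1) * m = m powr p"
    using assms powr_add[of m "p - 1" 1] by simp
  moreover have "m powr p \<le> p * m powr p" using assms by simp
  ultimately show ?thesis using True assms by (simp add: algebra_simps)
next
  case False
  have "p * m powr (p - 1) * (x - m) \<le> x powr p - m powr p"
  proof (rule convex_on_imp_above_tangent[where A = "{0<..}"])
    show "convex_on {0<..} (\<lambda>x. x powr p)"
      using assms by (intro powr_convex) auto
    show "((\<lambda>x. x powr p) has_real_derivative p * m powr (p - 1)) (at m within {0<..})"
      using assms by (auto intro!: derivative_eq_intros)
  qed (use assms False in \<open>auto simp: connected_Ioi interior_open\<close>)
  then show ?thesis by simp
qed

lemma circle_mean_powr_le: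
  assumes "1 < p" and k: "k holomorphic_on cball 0 1"
  shows "ennreal (norm (k 0) powr p) \<le>
    (\<integral>\<^sup>+t. ennreal (norm (k (exp (2 * of_real pi * \<i> * of_real t))) powr p) * indicator {0..1} t \<partial>lborel)"
    (is "_ \<le> ?R")
proof (cases "k 0 = 0")
  case False
  let ?e = "\<lambda>t::real. exp (2 * of_real pi * \<i> * of_real t)"
  let ?m = "norm (k 0)"
  have "continuous_on {0..1} (\<lambda>t. k (?e t))"
    by (rule continuous_on_compose2[OF holomorphic_on_imp_continuous_on[OF k]])
      (auto intro!: continuous_intros simp: norm_exp_eq_Re)
  then have c: "continuous_on {0..1} (\<lambda>t. norm (k (?e t)))" by (intro continuous_intros)
  then have cp: "continuous_on {0..1} (\<lambda>t. norm (k (?e t)) powr p)"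
    using assms by (intro continuous_on_powr') (auto intro: continuous_intros)
  have "?m \<le> integral {0..1} (\<lambda>t. norm (k (?e t)))"
    using integral_norm_bound_integral[of "\<lambda>t. k (?e t)" "{0..1}" "\<lambda>t. norm (k (?e t))"]
      has_integral_circle_mean[OF k] integrable_continuous_real[OF c]
    by (auto simp: has_integral_iff)
  then have "0 \<le> p * ?m powr (p - 1) * (integral {0..1} (\<lambda>t. norm (k (?e t))) - ?m)"
    using assms by auto
  then have "?m powr p \<le> ?m powr p + p * ?m powr (p - 1) * (integral {0..1} (\<lambda>t. norm (k (?e t))) - ?m)"
    by simp
  also have "\<dots> \<le> integral {0..1} (\<lambda>t. norm (k (?e t)) powr p)"
  proof (rule has_integral_le)
    have "((\<lambda>t. norm (k (?e t)) - ?m) has_integral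
        integral {0..1} (\<lambda>t. norm (k (?e t))) - ?m) {0..1}"
      using has_integral_diff[OF integrable_integral[OF integrable_continuous_real[OF c]]
          has_integral_const_real[of ?m 0 1]] by simp
    from has_integral_add[OF has_integral_const_real[of "?m powr p" 0 1]
        has_integral_mult_right[OF this, of "p * ?m powr (p - 1)"]]
    show "((\<lambda>t. ?m powr p + p * ?m powr (p - 1) * (norm (k (?e t)) - ?m)) has_integral
        ?m powr p + p * ?m powr (p - 1) * (integral {0..1} (\<lambda>t. norm (k (?e t))) - ?m)) {0..1}"
      by simp
    show "((\<lambda>t. norm (k (?e t)) powr p) has_integral
        integral {0..1} (\<lambda>t. norm (k (?e t)) powr p)) {0..1}"
      using integrable_continuous_real[OF cp] by (rule integrable_integral)
  qed (use False assms powr_tangent_le in auto)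
  finally have "ennreal (?m powr p) \<le> ennreal (integral {0..1} (\<lambda>t. norm (k (?e t)) powr p))"
    by (rule ennreal_leI)
  also have "\<dots> = (\<integral>\<^sup>+t. ennreal (norm (k (?e t)) powr p * indicator {0..1} t) \<partial>lborel)"
  proof (rule nn_integral_has_integral_lborel[symmetric])
    show "(\<lambda>t. norm (k (?e t)) powr p * indicator {0..1} t) \<in> borel_measurable borel"
      using borel_measurable_continuous_on_indicator[OF _ cp] by (simp add: mult.commute)
    show "((\<lambda>t. norm (k (?e t)) powr p * indicator {0..1} t) has_integral
        integral {0..1} (\<lambda>t. norm (k (?e t)) powr p)) UNIV"
      unfolding has_integral_mult_indicator
      using integrable_continuous_real[OF cp] by (rule integrable_integral)
  qed simp
  also have "\<dots> = ?R"
    by (intro nn_integral_cong) (auto split: split_indicator)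
  finally show ?thesis .
qed simp

text \<open>The circle means are averaged over the centered disk by rotating it, which replaces polar
  coordinates by the invariance of Lebesgue measure under rotations.\<close>

lemma area_mean_powr_le:
  assumes p: "1 < p" and g: "g holomorphic_on cball w r" and r: "0 < r"
  shows "ennreal (norm (g w) powr p) * emeasure lborel (ball (0::complex) r)
    \<le> (\<integral>\<^sup>+z. ennreal (norm (g z) powr p) * indicator (ball w r) z \<partial>lborel)"
    (is "_ \<le> ?R")
proof -
  let ?e = "\<lambda>t::real. exp (2 * of_real pi * \<i> * of_real t)"
  define u where "u z = norm (indicator (ball w r) z *\<^sub>R g z) powr p" for z
  have ne [simp]: "norm (?e t) = 1" for t
    by (simp add: norm_exp_eq_Re)
  have [measurable]: "(\<lambda>z. indicator (ball w r) z *\<^sub>R g z) \<in> borel_measurable borel"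
    by (intro borel_measurable_continuous_on_indicator
        continuous_on_subset[OF holomorphic_on_imp_continuous_on[OF g]]) auto
  have u_meas [measurable]: "u \<in> borel_measurable borel"
    unfolding u_def by measurable
  have u_eq: "ennreal (u z) = ennreal (norm (g z) powr p) * indicator (ball w r) z" for z
    using p by (auto simp: u_def split: split_indicator)
  have in_ball: "w + c * ?e t \<in> ball w r \<longleftrightarrow> c \<in> ball 0 r" for c t
    by (simp add: dist_norm norm_mult)
  \<comment> \<open>A bound for \<open>g\<close> on the closed disk makes \<open>?R\<close> finite,
    as the substitution rule requires.\<close>
  have "compact (g ` cball w r)"
    using holomorphic_on_imp_continuous_on[OF g] by (intro compact_continuous_image) auto
  then obtain B where B: "\<And>z. z \<in> cball w r \<Longrightarrow> norm (g z) \<le> B"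
    using compact_imp_bounded bounded_iff by (metis image_eqI)
  have "?R \<le> (\<integral>\<^sup>+z. ennreal (B powr p) * indicator (ball w r) z \<partial>lborel)"
    using B p by (intro nn_integral_mono) (auto split: split_indicator intro!: ennreal_leI powr_mono2)
  also have "\<dots> = ennreal (B powr p) * emeasure lborel (ball w r)"
    by (rule nn_integral_cmult_indicator) auto
  also have "\<dots> < \<infinity>"
    using emeasure_lborel_ball_finite[of w r] by (simp add: ennreal_mult_less_top)
  finally have R_fin: "?R < \<infinity>" .
  \<comment> \<open>A rotation about \<open>w\<close> has a derivative of modulus 1 and maps the
    disk onto itself, so the integral is the same for every angle.\<close>
  have rot: "(\<integral>\<^sup>+c. ennreal (u (w + c * ?e t)) \<partial>lborel) = ?R" for t
  proof -
    have img: "(\<lambda>c. w + c * ?e t) ` ball 0 r = ball w r"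
    proof safe
      fix z assume "z \<in> ball w r"
      then have "(z - w) / ?e t \<in> ball 0 r" "z = w + (z - w) / ?e t * ?e t"
        by (auto simp: norm_divide dist_norm norm_minus_commute)
      then show "z \<in> (\<lambda>c. w + c * ?e t) ` ball 0 r" by blast
    qed (simp add: dist_norm norm_mult)
    have "(\<integral>\<^sup>+c. ennreal ((norm (?e t))\<^sup>2 * u (w + c * ?e t)) * indicator (ball 0 r) c \<partial>lborel)
        = (\<integral>\<^sup>+z. ennreal (u z) * indicator ((\<lambda>c. w + c * ?e t) ` ball 0 r) z \<partial>lborel)"
    proof (rule nn_integral_holomorphic_substitution)
      show "((\<lambda>c. w + c * ?e t) has_field_derivative ?e t) (at z)" for z
        by (auto intro!: derivative_eq_intros)
      show "inj_on (\<lambda>c. w + c * ?e t) (ball 0 r)" by (auto simp: inj_on_def)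
      show "(\<integral>\<^sup>+z. ennreal (u z) * indicator ((\<lambda>c. w + c * ?e t) ` ball 0 r) z \<partial>lborel) < \<infinity>"
        using R_fin unfolding img u_eq
        by (simp add: mult.assoc flip: indicator_inter_arith)
      show "0 \<le> u z" for z by (simp add: u_def)
    qed (use img u_meas in auto)
    moreover have "ennreal ((norm (?e t))\<^sup>2 * u (w + c * ?e t)) * indicator (ball 0 r) c
        = ennreal (u (w + c * ?e t))" for c
      using in_ball[of c t] p by (auto simp: u_def split: split_indicator)
    ultimately show ?thesis
      unfolding img u_eq by (simp add: mult.assoc flip: indicator_inter_arith)
  qed
  have "ennreal (norm (g w) powr p) * emeasure lborel (ball (0::complex) r)
      = (\<integral>\<^sup>+c. ennreal (norm (g w) powr p) * indicator (ball (0::complex) r) c \<partial>lborel)"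
    by (simp add: nn_integral_cmult_indicator)
  also have "\<dots> \<le> (\<integral>\<^sup>+c. (\<integral>\<^sup>+t. ennreal (u (w + c * ?e t)) * indicator {0..1} t \<partial>lborel) \<partial>lborel)"
  proof (rule nn_integral_mono)
    fix c :: complex
    show "ennreal (norm (g w) powr p) * indicator (ball 0 r) c
        \<le> (\<integral>\<^sup>+t. ennreal (u (w + c * ?e t)) * indicator {0..1} t \<partial>lborel)"
    proof (cases "c \<in> ball 0 r")
      case True
      have "(g \<circ> (\<lambda>v. w + c * v)) holomorphic_on cball 0 1"
      proof (rule holomorphic_on_compose_gen[OF _ g])
        show "(\<lambda>v. w + c * v) holomorphic_on cball 0 1" by (intro holomorphic_intros)
        show "(\<lambda>v. w + c * v) ` cball 0 1 \<subseteq> cball w r"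
        proof (clarsimp simp: dist_norm norm_mult)
          fix v :: complex assume "norm v \<le> 1"
          then have "norm c * norm v \<le> norm c * 1" by (intro mult_left_mono) auto
          then show "norm c * norm v \<le> r" using True by simp
        qed
      qed
      from circle_mean_powr_le[OF p this]
      have "ennreal (norm (g w) powr p) \<le>
          (\<integral>\<^sup>+t. ennreal (norm (g (w + c * ?e t)) powr p) * indicator {0..1} t \<partial>lborel)"
        by simp
      also have "\<dots> = (\<integral>\<^sup>+t. ennreal (u (w + c * ?e t)) * indicator {0..1} t \<partial>lborel)"
        using in_ball[of c] True by (intro nn_integral_cong) (simp add: u_def)
      finally show ?thesis using True by simp
    qed simp
  qed
  \<comment> \<open>After the interchange the inner integral over \<open>c\<close> is
    \<open>?R\<close> for each \<open>t\<close>, and \<open>t\<close> runs over an interval of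
    length 1.\<close>
  also have "\<dots> = (\<integral>\<^sup>+t. (\<integral>\<^sup>+c. ennreal (u (w + c * ?e t)) * indicator {0..1} t \<partial>lborel) \<partial>lborel)"
  proof (rule lborel_pair.Fubini')
    define \<gamma> where "\<gamma> x = w + snd x * ?e (fst x)" for x :: "real \<times> complex"
    have [measurable]: "\<gamma> \<in> borel_measurable (borel \<Otimes>\<^sub>M borel)"
      unfolding borel_prod \<gamma>_def
      by (intro borel_measurable_continuous_onI continuous_intros)
    have "(\<lambda>x. ennreal (u (\<gamma> x)) * indicator {0..1} (fst x)) \<in> borel_measurable (borel \<Otimes>\<^sub>M borel)"
      by measurable
    then show "(\<lambda>(t, c). ennreal (u (w + c * ?e t)) * indicator {0..1} t)
        \<in> borel_measurable (lborel \<Otimes>\<^sub>M lborel)"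
      by (simp add: \<gamma>_def borel_prod lborel_prod case_prod_beta)
  qed
  also have "\<dots> = (\<integral>\<^sup>+t. ?R * indicator {0..1} (t::real) \<partial>lborel)"
  proof (intro nn_integral_cong)
    fix t :: real
    have [measurable]: "(\<lambda>c. w + c * ?e t) \<in> borel_measurable borel"
      by (intro borel_measurable_continuous_onI continuous_intros)
    have "(\<integral>\<^sup>+c. ennreal (u (w + c * ?e t)) * indicator {0..1} t \<partial>lborel)
        = (\<integral>\<^sup>+c. ennreal (u (w + c * ?e t)) \<partial>lborel) * indicator {0..1} t"
      by (rule nn_integral_multc) measurable
    then show "(\<integral>\<^sup>+c. ennreal (u (w + c * ?e t)) * indicator {0..1} t \<partial>lborel) = ?R * indicator {0..1} t"
      by (simp add: rot)
  qed
  also have "\<dots> = ?R"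
    by (subst nn_integral_cmult_indicator) auto
  finally show ?thesis .
qed

section \<open>Moebius transformations and the Besov weight\<close>

definition disk_moebius :: "complex \<Rightarrow> complex \<Rightarrow> complex"
  where "disk_moebius a z = (a - z) / (1 - cnj a * z)"

lemma disk_moebius_denominator_nonzero:
  assumes "norm a < 1" "norm z < 1"
  shows "1 - cnj a * z \<noteq> 0"
proof
  assume "1 - cnj a * z = 0"
  then have "norm a * norm z = 1"
    by (metis complex_mod_cnj eq_iff_diff_eq_0 norm_mult norm_one)
  moreover have "norm a * norm z < 1 * 1"
    using assms by (intro mult_strict_mono') auto
  ultimately show False by simp
qed

lemma has_field_derivative_disk_moebius:
  assumes "norm a < 1" "norm z < 1"
  shows "(disk_moebius a has_field_derivative - (1 - (norm a)\<^sup>2) / (1 - cnj a * z)\<^sup>2) (at z)"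
proof -
  have D: "((\<lambda>z. (a - z) / (1 - cnj a * z)) has_field_derivative
      (- 1 * (1 - cnj a * z) - (a - z) * (- cnj a)) / ((1 - cnj a * z) * (1 - cnj a * z))) (at z)"
    by (rule DERIV_divide)
      (use disk_moebius_denominator_nonzero[OF assms] in \<open>auto intro!: derivative_eq_intros\<close>)
  have num: "- 1 * (1 - cnj a * z) - (a - z) * (- cnj a) = - (1 - (norm a)\<^sup>2)"
    by (simp only: complex_norm_square of_real_minus of_real_diff of_real_1) (simp add: algebra_simps)
  show ?thesis using D[unfolded num] by (simp add: disk_moebius_def[abs_def] power2_eq_square)
qed

text \<open>The last factor is the modulus of the derivative of \<open>disk_moebius a\<close> at
  \<open>z\<close>, so this is the equality case of the Schwarz-Pick inequality. It is the source of
  the Moebius invariance used later.\<close>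

lemma one_minus_norm_disk_moebius:
  assumes "norm a < 1" "norm z < 1"
  shows "1 - (norm (disk_moebius a z))\<^sup>2
    = (1 - (norm z)\<^sup>2) * ((1 - (norm a)\<^sup>2) / (norm (1 - cnj a * z))\<^sup>2)"
proof -
  let ?d = "1 - cnj a * z"
  have nz: "norm ?d \<noteq> 0" using disk_moebius_denominator_nonzero[OF assms] by simp
  have "complex_of_real ((norm ?d)\<^sup>2 - (norm (a - z))\<^sup>2) = complex_of_real ((1 - (norm z)\<^sup>2) * (1 - (norm a)\<^sup>2))"
    unfolding of_real_diff of_real_mult complex_norm_square by (simp add: algebra_simps)
  then have "(norm ?d)\<^sup>2 - (norm (a - z))\<^sup>2 = (1 - (norm z)\<^sup>2) * (1 - (norm a)\<^sup>2)"
    by (simp only: of_real_eq_iff)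
  then show ?thesis
    using nz by (simp add: disk_moebius_def norm_divide power_divide field_simps)
qed

lemma norm_disk_moebius_less:
  assumes "norm a < 1" "norm z < 1"
  shows "norm (disk_moebius a z) < 1"
proof -
  have "0 < (1 - (norm z)\<^sup>2) * ((1 - (norm a)\<^sup>2) / (norm (1 - cnj a * z))\<^sup>2)"
    using assms disk_moebius_denominator_nonzero[OF assms]
    by (intro mult_pos_pos divide_pos_pos) (auto simp: abs_square_less_1)
  then show ?thesis
    unfolding one_minus_norm_disk_moebius[OF assms, symmetric] by (simp add: abs_square_less_1)
qed

text \<open>Being its own inverse makes the map a bijection of the disk, as the substitution rule
  needs it.\<close>

lemma disk_moebius_involution:
  assumes "norm a < 1" "norm z < 1"
  shows "disk_moebius a (disk_moebius a z) = z"
proof -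
  have 1: "1 - cnj a * z \<noteq> 0" and 2: "1 - cnj a * a \<noteq> 0"
    using assms disk_moebius_denominator_nonzero by auto
  have 3: "1 - cnj a * ((a - z) / (1 - cnj a * z)) = (1 - cnj a * a) / (1 - cnj a * z)"
    and 4: "a - (a - z) / (1 - cnj a * z) = z * (1 - cnj a * a) / (1 - cnj a * z)"
    using 1 by (simp_all add: field_simps)
  show ?thesis unfolding disk_moebius_def 3 4 using 1 2 by simp
qed

text \<open>The exponent joins the p-th power of 1 - |z|^2 in the seminorm to the hyperbolic density
  with exponent -2. With the indicator built in, integrals run over the whole plane.\<close>

definition besov_weight :: "real \<Rightarrow> complex \<Rightarrow> real"
  where "besov_weight p z = (1 - (norm z)\<^sup>2) powr (p - 2) * indicator (ball 0 1) z"

text \<open>Here \<open>g\<close> plays the role of a derivative: up to the normalization by pi this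
  is the p-th power of the Besov seminorm of a primitive of \<open>g\<close>.\<close>

definition besov_integral :: "real \<Rightarrow> (complex \<Rightarrow> complex) \<Rightarrow> ennreal"
  where "besov_integral p g = (\<integral>\<^sup>+z. ennreal (besov_weight p z * norm (g z) powr p) \<partial>lborel)"

lemma besov_weight_nonneg [simp]: "0 \<le> besov_weight p z"
  by (simp add: besov_weight_def)

lemma besov_weight_eq_0: "z \<notin> ball 0 1 \<Longrightarrow> besov_weight p z = 0"
  by (simp add: besov_weight_def)

lemma measurable_besov_weight [measurable]: "besov_weight p \<in> borel_measurable borel"
proof -
  have [measurable]: "ball (0::complex) 1 \<in> sets borel" by simp
  show ?thesis unfolding besov_weight_def[abs_def] by measurable
qed

lemma measurable_cnj [measurable]: "cnj \<in> borel_measurable borel"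
  by (intro borel_measurable_continuous_onI continuous_intros)

lemma besov_integral_cong:
  assumes "\<And>z. norm z < 1 \<Longrightarrow> norm (f z) = norm (g z)"
  shows "besov_integral p f = besov_integral p g"
  unfolding besov_integral_def
  using assms by (intro nn_integral_cong) (auto simp: besov_weight_def indicator_def)

lemma power2_powr_eq: "0 \<le> x \<Longrightarrow> (x\<^sup>2) powr p = x powr (2 * p)" for x :: real
  by (cases "x = 0") (simp_all add: powr_powr flip: powr_numeral)

text \<open>On the disk of radius \<open>(1 - \<bar>w\<bar>) / 2\<close> around \<open>w\<close>, the quantities \<open>1 - \<bar>\<zeta>\<bar>\<close> and
  \<open>\<bar>1 - cnj \<zeta> w\<bar>\<close> are comparable to \<open>1 - \<bar>w\<bar>\<close>.\<close>

lemma besov_weight_moebius_lower_bound: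
  fixes w \<zeta> :: complex
  assumes p: "1 < p" and w: "norm w < 1" and near: "norm (\<zeta> - w) < (1 - norm w) / 2"
  shows "4 / (1 - norm w)\<^sup>2
    \<le> 5 powr (2 * p) * (besov_weight p \<zeta> * ((1 - (norm \<zeta>)\<^sup>2) / (norm (1 - cnj \<zeta> * w))\<^sup>2) powr p)"
proof -
  define d where "d = 1 - norm w"
  have d: "0 < d" using w by (simp add: d_def)
  have "norm \<zeta> \<le> norm w + norm (\<zeta> - w)" by (metis add.commute diff_add_cancel norm_triangle_ineq)
  then have \<zeta>: "norm \<zeta> \<le> 1 - d / 2" using near by (simp add: d_def field_simps)
  then have \<zeta>1: "norm \<zeta> < 1" using d by simp
  have "(norm \<zeta>)\<^sup>2 \<le> norm \<zeta>" using \<zeta>1 by (simp add: power2_eq_square mult_left_le)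
  then have A: "d / 2 \<le> 1 - (norm \<zeta>)\<^sup>2" using \<zeta> by simp
  have nz: "1 - cnj \<zeta> * w \<noteq> 0" by (rule disk_moebius_denominator_nonzero[OF \<zeta>1 w])
  \<comment> \<open>The main term is at most 2 d and the error at most d / 2. Their sum 5 d / 2 is
    the origin of the 5 in all later constants.\<close>
  have "1 - cnj \<zeta> * w = (1 - (norm w)\<^sup>2) - cnj (\<zeta> - w) * w"
    by (simp only: complex_norm_square of_real_diff of_real_1) (simp add: algebra_simps)
  then have "norm (1 - cnj \<zeta> * w) \<le> norm (complex_of_real (1 - (norm w)\<^sup>2)) + norm (cnj (\<zeta> - w) * w)"
    by (metis norm_triangle_ineq4)
  also have "norm (complex_of_real (1 - (norm w)\<^sup>2)) = d * (1 + norm w)"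
    using w by (subst norm_of_real) (simp add: d_def abs_if abs_square_less_1 power2_eq_square algebra_simps,
        metis abs_norm_cancel abs_square_less_1 less_irrefl less_trans power2_eq_square)
  also have "\<dots> \<le> d * 2" using d w by (intro mult_left_mono) auto
  also have "norm (cnj (\<zeta> - w) * w) \<le> norm (\<zeta> - w) * 1"
    unfolding norm_mult complex_mod_cnj using w by (intro mult_left_mono) auto
  also have "\<dots> \<le> d / 2" using near by (simp add: d_def)
  finally have B: "norm (1 - cnj \<zeta> * w) \<le> 5 * d / 2" by simp
  have Apos: "0 < 1 - (norm \<zeta>)\<^sup>2" using A d by simp
  \<comment> \<open>Weight and kernel contribute the exponents p - 2 and p of 1 - |\<zeta>|^2. Their
    sum 2 p - 2 is positive, so the lower bound \<open>A\<close> may be inserted, and of the powers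
    of d / 2 only the exponent -2 remains.\<close>
  have "4 / d\<^sup>2 = 5 powr (2 * p) * ((d / 2) powr (2 * p - 2) / (5 * d / 2) powr (2 * p))"
  proof -
    have "(d / 2) powr (2 * p - 2) = (d / 2) powr (2 * p) / (d / 2)\<^sup>2"
      using d by (simp add: powr_diff powr_numeral)
    moreover have "(5 * d / 2) powr (2 * p) = 5 powr (2 * p) * (d / 2) powr (2 * p)"
      using d by (simp flip: powr_mult)
    ultimately show ?thesis using d by (simp add: field_simps)
  qed
  also have "\<dots> \<le> 5 powr (2 * p) * ((1 - (norm \<zeta>)\<^sup>2) powr (2 * p - 2) / norm (1 - cnj \<zeta> * w) powr (2 * p))"
    using A B d p nz by (intro mult_left_mono frac_le powr_mono2) auto
  also have "(1 - (norm \<zeta>)\<^sup>2) powr (2 * p - 2) / norm (1 - cnj \<zeta> * w) powr (2 * p)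
      = besov_weight p \<zeta> * ((1 - (norm \<zeta>)\<^sup>2) / (norm (1 - cnj \<zeta> * w))\<^sup>2) powr p"
  proof -
    have "(1 - (norm \<zeta>)\<^sup>2) powr (2 * p - 2) = (1 - (norm \<zeta>)\<^sup>2) powr (p - 2) * (1 - (norm \<zeta>)\<^sup>2) powr p"
      by (simp flip: powr_add)
    then show ?thesis
      using \<zeta>1 Apos by (simp add: besov_weight_def powr_divide power2_powr_eq)
  qed
  finally show ?thesis by (simp add: d_def)
qed

text \<open>The area pi r^2 of the mean value disk, with r = (1 - |w|) / 2, cancels the factor 1 /
  r^2 = 4 / (1 - |w|)^2 in the lower bound for weight times kernel. The kernel is |\<sigma>_\<zeta>'
  w|^p, so the inequality stands in for a reproducing formula.\<close>

lemma powr_le_besov_moebius_integral: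
  assumes p: "1 < p" and g: "g holomorphic_on ball 0 1" and w: "norm w < 1"
  shows "ennreal (norm (g w) powr p) \<le> ennreal (5 powr (2 * p) / pi) *
    (\<integral>\<^sup>+\<zeta>. ennreal (besov_weight p \<zeta> * norm (g \<zeta>) powr p *
      ((1 - (norm \<zeta>)\<^sup>2) / (norm (1 - cnj \<zeta> * w))\<^sup>2) powr p) \<partial>lborel)"
    (is "_ \<le> _ * ?I")
proof -
  define r where "r = (1 - norm w) / 2"
  have r: "0 < r" using w by (simp add: r_def)
  have sub: "cball w r \<subseteq> ball 0 1"
  proof
    fix z assume "z \<in> cball w r"
    then have "norm (z - w) \<le> r" by (simp add: dist_norm norm_minus_commute)
    moreover have "norm z \<le> norm w + norm (z - w)" by (metis add.commute diff_add_cancel norm_triangle_ineq)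
    ultimately show "z \<in> ball 0 1" using w by (simp add: r_def field_simps)
  qed
  have "DIM(complex) = 2" by simp
  then have area: "emeasure lborel (ball (0::complex) r) = ennreal (pi * r\<^sup>2)"
    using r by (simp add: emeasure_ball eval_unit_ball_vol del: DIM_complex)
  let ?K = "\<lambda>\<zeta>. besov_weight p \<zeta> * ((1 - (norm \<zeta>)\<^sup>2) / (norm (1 - cnj \<zeta> * w))\<^sup>2) powr p"
  have "ennreal (norm (g w) powr p) * ennreal (pi * r\<^sup>2)
      \<le> (\<integral>\<^sup>+z. ennreal (norm (g z) powr p) * indicator (ball w r) z \<partial>lborel)"
    using area_mean_powr_le[OF p holomorphic_on_subset[OF g sub] r] by (simp add: area)
  also have "\<dots> \<le> (\<integral>\<^sup>+\<zeta>. ennreal (r\<^sup>2 * 5 powr (2 * p)) *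
      ennreal (norm (g \<zeta>) powr p * ?K \<zeta>) \<partial>lborel)"
  proof (rule nn_integral_mono)
    fix \<zeta> :: complex
    show "ennreal (norm (g \<zeta>) powr p) * indicator (ball w r) \<zeta>
      \<le> ennreal (r\<^sup>2 * 5 powr (2 * p)) * ennreal (norm (g \<zeta>) powr p * ?K \<zeta>)"
    proof (cases "\<zeta> \<in> ball w r")
      case True
      then have "norm (\<zeta> - w) < (1 - norm w) / 2"
        by (simp add: dist_norm norm_minus_commute r_def)
      from besov_weight_moebius_lower_bound[OF p w this]
      have "1 / r\<^sup>2 \<le> 5 powr (2 * p) * ?K \<zeta>"
        by (simp add: r_def power_divide)
      then have "1 \<le> r\<^sup>2 * (5 powr (2 * p) * ?K \<zeta>)"
        using r by (simp add: field_simps)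
      then have "norm (g \<zeta>) powr p * 1 \<le> norm (g \<zeta>) powr p * (r\<^sup>2 * (5 powr (2 * p) * ?K \<zeta>))"
        by (rule mult_left_mono) simp
      then show ?thesis
        using True by (simp add: mult_ac flip: ennreal_mult)
    qed simp
  qed
  also have "\<dots> = (\<integral>\<^sup>+\<zeta>. ennreal (r\<^sup>2 * 5 powr (2 * p)) *
      ennreal (besov_weight p \<zeta> * norm (g \<zeta>) powr p *
      ((1 - (norm \<zeta>)\<^sup>2) / (norm (1 - cnj \<zeta> * w))\<^sup>2) powr p) \<partial>lborel)"
    by (simp add: mult_ac)
  also have "\<dots> = ennreal (r\<^sup>2 * 5 powr (2 * p)) * ?I"
  proof (rule nn_integral_cmult)
    let ?h = "\<lambda>\<zeta>. indicator (ball 0 1) \<zeta> *\<^sub>R g \<zeta>"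
    have [measurable]: "?h \<in> borel_measurable borel"
      using holomorphic_on_imp_continuous_on[OF g]
      by (intro borel_measurable_continuous_on_indicator) auto
    have eq: "besov_weight p \<zeta> * norm (g \<zeta>) powr p = besov_weight p \<zeta> * norm (?h \<zeta>) powr p" for \<zeta>
      by (simp add: besov_weight_def split: split_indicator)
    show "(\<lambda>\<zeta>. ennreal (besov_weight p \<zeta> * norm (g \<zeta>) powr p *
        ((1 - (norm \<zeta>)\<^sup>2) / (norm (1 - cnj \<zeta> * w))\<^sup>2) powr p)) \<in> borel_measurable lborel"
      unfolding eq by measurable
  qed
  finally have "ennreal (1 / (pi * r\<^sup>2)) * (ennreal (norm (g w) powr p) * ennreal (pi * r\<^sup>2))
      \<le> ennreal (1 / (pi * r\<^sup>2)) * (ennreal (r\<^sup>2 * 5 powr (2 * p)) * ?I)"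
    by (rule mult_left_mono) simp
  moreover have "ennreal (1 / (pi * r\<^sup>2)) * (ennreal (norm (g w) powr p) * ennreal (pi * r\<^sup>2))
      = ennreal (norm (g w) powr p)"
    using r by (simp flip: ennreal_mult)
  moreover have "ennreal (1 / (pi * r\<^sup>2)) * (ennreal (r\<^sup>2 * 5 powr (2 * p)) * ?I)
      = ennreal (5 powr (2 * p) / pi) * ?I"
    using r by (simp add: mult.assoc[symmetric] flip: ennreal_mult)
  ultimately show ?thesis by simp
qed

text \<open>The kernel of the previous inequality is at most (1 - |w|)^(-2 p) on the disk. The bound
  serves the estimate of f at \<Phi> 0.\<close>

lemma powr_le_besov_integral:
  assumes p: "1 < p" and g: "g holomorphic_on ball 0 1" and w: "norm w < 1"
  shows "ennreal (norm (g w) powr p)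
    \<le> ennreal (5 powr (2 * p) / pi / (1 - norm w) powr (2 * p)) * besov_integral p g"
proof -
  define C where "C = 1 / (1 - norm w) powr (2 * p)"
  have "(\<integral>\<^sup>+\<zeta>. ennreal (besov_weight p \<zeta> * norm (g \<zeta>) powr p *
        ((1 - (norm \<zeta>)\<^sup>2) / (norm (1 - cnj \<zeta> * w))\<^sup>2) powr p) \<partial>lborel)
      \<le> (\<integral>\<^sup>+\<zeta>. ennreal C * ennreal (besov_weight p \<zeta> * norm (g \<zeta>) powr p) \<partial>lborel)"
  proof (rule nn_integral_mono)
    fix \<zeta> :: complex
    show "ennreal (besov_weight p \<zeta> * norm (g \<zeta>) powr p *
        ((1 - (norm \<zeta>)\<^sup>2) / (norm (1 - cnj \<zeta> * w))\<^sup>2) powr p)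
      \<le> ennreal C * ennreal (besov_weight p \<zeta> * norm (g \<zeta>) powr p)"
    proof (cases "\<zeta> \<in> ball 0 1")
      case True
      then have \<zeta>: "norm \<zeta> < 1" by simp
      have "norm (cnj \<zeta> * w) \<le> 1 * norm w"
        unfolding norm_mult complex_mod_cnj using \<zeta> by (intro mult_right_mono) auto
      then have "1 - norm w \<le> norm (1 - cnj \<zeta> * w)"
        using norm_triangle_ineq2[of 1 "cnj \<zeta> * w"] by simp
      then have "(1 - (norm \<zeta>)\<^sup>2) / (norm (1 - cnj \<zeta> * w))\<^sup>2 \<le> 1 / (1 - norm w)\<^sup>2"
        using \<zeta> w by (intro frac_le power_mono) (auto simp: abs_square_le_1)
      moreover have "0 \<le> 1 - (norm \<zeta>)\<^sup>2" using \<zeta> by (simp add: abs_square_le_1)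
      ultimately have "((1 - (norm \<zeta>)\<^sup>2) / (norm (1 - cnj \<zeta> * w))\<^sup>2) powr p \<le> (1 / (1 - norm w)\<^sup>2) powr p"
        using p by (intro powr_mono2) auto
      also have "\<dots> = C"
        using w by (simp add: C_def powr_divide power2_powr_eq)
      finally have "besov_weight p \<zeta> * norm (g \<zeta>) powr p *
          ((1 - (norm \<zeta>)\<^sup>2) / (norm (1 - cnj \<zeta> * w))\<^sup>2) powr p
        \<le> besov_weight p \<zeta> * norm (g \<zeta>) powr p * C"
        by (intro mult_left_mono) auto
      then show ?thesis
        by (simp add: C_def mult.commute ennreal_leI flip: ennreal_mult)
    qed (simp add: besov_weight_eq_0)
  qed
  also have "\<dots> = ennreal C * besov_integral p g"
    unfolding besov_integral_def
  proof (rule nn_integral_cmult)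
    let ?h = "\<lambda>\<zeta>. indicator (ball 0 1) \<zeta> *\<^sub>R g \<zeta>"
    have [measurable]: "?h \<in> borel_measurable borel"
      using holomorphic_on_imp_continuous_on[OF g]
      by (intro borel_measurable_continuous_on_indicator) auto
    have eq: "besov_weight p \<zeta> * norm (g \<zeta>) powr p = besov_weight p \<zeta> * norm (?h \<zeta>) powr p" for \<zeta>
      by (simp add: besov_weight_def split: split_indicator)
    show "(\<lambda>\<zeta>. ennreal (besov_weight p \<zeta> * norm (g \<zeta>) powr p)) \<in> borel_measurable lborel"
      unfolding eq by measurable
  qed
  finally have "ennreal (norm (g w) powr p) \<le> ennreal (5 powr (2 * p) / pi) * (ennreal C * besov_integral p g)"
    using powr_le_besov_moebius_integral[OF assms] by (meson mult_left_mono order_trans zero_le)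
  then show ?thesis
    by (simp add: C_def mult.assoc[symmetric] flip: ennreal_mult)
qed

text \<open>This is the sufficiency half of the Carleson measure criterion for the push-forward under \<open>\<phi>\<close> of
  \<open>\<bar>\<psi>\<bar>\<^sup>p\<close> times the Besov weight.\<close>

lemma besov_integral_carleson:
  assumes p: "1 < p" and g: "g holomorphic_on ball 0 1"
    and \<phi> [measurable]: "\<phi> \<in> borel_measurable borel" and \<phi>_disk: "\<And>z. norm (\<phi> z) < 1"
    and \<psi> [measurable]: "\<psi> \<in> borel_measurable borel"
    and M: "\<And>a. norm a < 1 \<Longrightarrow>
      besov_integral p (\<lambda>z. deriv (disk_moebius a) (\<phi> z) * \<psi> z) \<le> M"
  shows "besov_integral p (\<lambda>z. g (\<phi> z) * \<psi> z) \<le> ennreal (5 powr (2 * p) / pi) * M * besov_integral p g"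
proof -
  let ?c = "ennreal (5 powr (2 * p) / pi)"
  define G where "G \<zeta> = besov_weight p \<zeta> * norm (indicator (ball 0 1) \<zeta> *\<^sub>R g \<zeta>) powr p" for \<zeta>
  have G_eq: "besov_weight p \<zeta> * norm (g \<zeta>) powr p = G \<zeta>" for \<zeta>
    by (simp add: G_def besov_weight_def split: split_indicator)
  have G0: "0 \<le> G \<zeta>" for \<zeta> by (simp add: G_def)
  have [measurable]: "(\<lambda>\<zeta>. indicator (ball 0 1) \<zeta> *\<^sub>R g \<zeta>) \<in> borel_measurable borel"
    using holomorphic_on_imp_continuous_on[OF g]
    by (intro borel_measurable_continuous_on_indicator) auto
  have [measurable]: "G \<in> borel_measurable borel"
    unfolding G_def by measurable
  \<comment> \<open>\<open>K \<zeta> z\<close> is the integrand of the hypothesis \<open>M\<close>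
    for a = \<zeta>, and also the kernel of the pointwise bound at \<open>\<phi> z\<close> times the
    weight and |\<psi>|^p.\<close>
  define K where "K \<zeta> z = besov_weight p z * norm (\<psi> z) powr p *
    ((1 - (norm \<zeta>)\<^sup>2) / (norm (1 - cnj \<zeta> * \<phi> z))\<^sup>2) powr p" for \<zeta> z
  have K_meas [measurable]: "(\<lambda>x. K (fst x) (snd x)) \<in> borel_measurable (borel \<Otimes>\<^sub>M borel)"
    "(\<lambda>x. K (snd x) (fst x)) \<in> borel_measurable (borel \<Otimes>\<^sub>M borel)"
    unfolding K_def by measurable
  have K_meas' [measurable]: "K \<zeta> \<in> borel_measurable borel" "(\<lambda>\<zeta>. K \<zeta> z) \<in> borel_measurable borel" for \<zeta> z
    unfolding K_def by measurable
  have K0: "0 \<le> K \<zeta> z" for \<zeta> z by (simp add: K_def)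
  have K_int: "(\<integral>\<^sup>+z. ennreal (K \<zeta> z) \<partial>lborel) \<le> M" if "norm \<zeta> < 1" for \<zeta>
  proof -
    have "norm (deriv (disk_moebius \<zeta>) (\<phi> z) * \<psi> z) powr p
        = norm (\<psi> z) powr p * ((1 - (norm \<zeta>)\<^sup>2) / (norm (1 - cnj \<zeta> * \<phi> z))\<^sup>2) powr p" for z
    proof -
      have "deriv (disk_moebius \<zeta>) (\<phi> z) = - (1 - (norm \<zeta>)\<^sup>2) / (1 - cnj \<zeta> * \<phi> z)\<^sup>2"
        by (rule DERIV_imp_deriv[OF has_field_derivative_disk_moebius[OF that \<phi>_disk]])
      moreover have "0 \<le> 1 - (norm \<zeta>)\<^sup>2" using that by (simp add: abs_square_le_1)
      ultimately have "norm (deriv (disk_moebius \<zeta>) (\<phi> z)) = (1 - (norm \<zeta>)\<^sup>2) / (norm (1 - cnj \<zeta> * \<phi> z))\<^sup>2"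
        by (simp only: norm_divide norm_minus_cancel norm_power norm_of_real abs_minus_cancel abs_of_nonneg)
      moreover note \<open>0 \<le> 1 - (norm \<zeta>)\<^sup>2\<close>
      ultimately show ?thesis by (simp only: norm_mult) (subst powr_mult, auto)
    qed
    then show ?thesis using M[OF that] by (simp add: besov_integral_def K_def mult.assoc)
  qed
  have "besov_integral p (\<lambda>z. g (\<phi> z) * \<psi> z)
      \<le> (\<integral>\<^sup>+z. ?c * (\<integral>\<^sup>+\<zeta>. ennreal (G \<zeta> * K \<zeta> z) \<partial>lborel) \<partial>lborel)"
    unfolding besov_integral_def
  proof (rule nn_integral_mono)
    fix z
    let ?w = "besov_weight p z * norm (\<psi> z) powr p"
    have m: "(\<lambda>\<zeta>. ennreal (G \<zeta> * ((1 - (norm \<zeta>)\<^sup>2) / (norm (1 - cnj \<zeta> * \<phi> z))\<^sup>2) powr p))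
        \<in> borel_measurable lborel"
      by measurable
    have "ennreal (besov_weight p z * norm (g (\<phi> z) * \<psi> z) powr p) = ennreal ?w * ennreal (norm (g (\<phi> z)) powr p)"
      by (simp add: norm_mult powr_mult mult_ac flip: ennreal_mult)
    also have "\<dots> \<le> ennreal ?w * (?c * (\<integral>\<^sup>+\<zeta>. ennreal (G \<zeta> *
        ((1 - (norm \<zeta>)\<^sup>2) / (norm (1 - cnj \<zeta> * \<phi> z))\<^sup>2) powr p) \<partial>lborel))"
      using powr_le_besov_moebius_integral[OF p g \<phi>_disk[of z]]
      by (intro mult_left_mono) (simp_all only: G_eq zero_le)
    also have "\<dots> = ?c * (\<integral>\<^sup>+\<zeta>. ennreal ?w * ennreal (G \<zeta> *
        ((1 - (norm \<zeta>)\<^sup>2) / (norm (1 - cnj \<zeta> * \<phi> z))\<^sup>2) powr p) \<partial>lborel)"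
      by (subst nn_integral_cmult[OF m]) (simp only: mult_ac)
    also have "\<dots> = ?c * (\<integral>\<^sup>+\<zeta>. ennreal (G \<zeta> * K \<zeta> z) \<partial>lborel)"
      using G0 by (simp add: K_def mult_ac flip: ennreal_mult)
    finally show "ennreal (besov_weight p z * norm (g (\<phi> z) * \<psi> z) powr p)
      \<le> ?c * (\<integral>\<^sup>+\<zeta>. ennreal (G \<zeta> * K \<zeta> z) \<partial>lborel)" .
  qed
  also have "\<dots> = ?c * (\<integral>\<^sup>+z. (\<integral>\<^sup>+\<zeta>. ennreal (G \<zeta> * K \<zeta> z) \<partial>lborel) \<partial>lborel)"
    by (rule nn_integral_cmult) measurable
  finally have le: "besov_integral p (\<lambda>z. g (\<phi> z) * \<psi> z) \<le> \<dots>" .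
  \<comment> \<open>Tonelli turns \<zeta> from an integration variable into a Moebius parameter, so
    that the integral over \<open>z\<close> is bounded by \<open>M\<close>. For \<zeta> off the
    disk, where \<open>M\<close> says nothing, \<open>G\<close> vanishes.\<close>
  have "(\<integral>\<^sup>+z. (\<integral>\<^sup>+\<zeta>. ennreal (G \<zeta> * K \<zeta> z) \<partial>lborel) \<partial>lborel)
      = (\<integral>\<^sup>+\<zeta>. (\<integral>\<^sup>+z. ennreal (G \<zeta> * K \<zeta> z) \<partial>lborel) \<partial>lborel)"
  proof (rule lborel_pair.Fubini')
    have "(\<lambda>x. ennreal (G (fst x) * K (fst x) (snd x))) \<in> borel_measurable (borel \<Otimes>\<^sub>M borel)"
      by measurable
    then show "(\<lambda>(\<zeta>, z). ennreal (G \<zeta> * K \<zeta> z)) \<in> borel_measurable (lborel \<Otimes>\<^sub>M lborel)"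
      by (simp add: borel_prod lborel_prod case_prod_beta)
  qed
  also have "\<dots> \<le> (\<integral>\<^sup>+\<zeta>. ennreal (G \<zeta>) * M \<partial>lborel)"
  proof (rule nn_integral_mono)
    fix \<zeta>
    have "(\<integral>\<^sup>+z. ennreal (G \<zeta> * K \<zeta> z) \<partial>lborel) = ennreal (G \<zeta>) * (\<integral>\<^sup>+z. ennreal (K \<zeta> z) \<partial>lborel)"
      using G0 K0 by (simp add: ennreal_mult nn_integral_cmult)
    also have "\<dots> \<le> ennreal (G \<zeta>) * M"
    proof (cases "norm \<zeta> < 1")
      case True
      then show ?thesis by (intro mult_left_mono K_int) auto
    qed (simp add: G_def besov_weight_eq_0)
    finally show "(\<integral>\<^sup>+z. ennreal (G \<zeta> * K \<zeta> z) \<partial>lborel) \<le> ennreal (G \<zeta>) * M" .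
  qed
  also have "\<dots> = besov_integral p g * M"
    unfolding besov_integral_def G_eq by (rule nn_integral_multc) measurable
  finally have "?c * (\<integral>\<^sup>+z. (\<integral>\<^sup>+\<zeta>. ennreal (G \<zeta> * K \<zeta> z) \<partial>lborel) \<partial>lborel)
      \<le> ?c * (besov_integral p g * M)"
    by (rule mult_left_mono) simp
  with le have "besov_integral p (\<lambda>z. g (\<phi> z) * \<psi> z) \<le> ?c * (besov_integral p g * M)"
    by (rule order_trans)
  then show ?thesis by (simp only: mult_ac)
qed

text \<open>For \<open>p < 2\<close> the weight is singular at the boundary; it is summed over the annuli
  \<open>2\<^sup>-\<^sup>k\<^sup>-\<^sup>1 < 1 - \<bar>z\<bar>\<^sup>2 \<le> 2\<^sup>-\<^sup>k\<close>, whose area is at most \<open>2\<^sup>-\<^sup>k \<pi>\<close>.\<close>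

lemma dyadic_bracket:
  fixes x :: real
  assumes "0 < x" "x \<le> 1"
  obtains k :: nat where "(1/2) ^ Suc k < x" "x \<le> (1/2) ^ k"
proof -
  obtain n where "(1/2) ^ n < x" using real_arch_pow_inv[of x "1/2"] assms by auto
  define m where "m = (LEAST n. (1/2::real) ^ n < x)"
  have m: "(1/2) ^ m < x" unfolding m_def by (rule LeastI) fact
  with assms have "m \<noteq> 0" by (intro notI) auto
  then obtain k where k: "m = Suc k" using not0_implies_Suc by blast
  have "\<not> (1/2) ^ k < x" using not_less_Least[of k "\<lambda>n. (1/2::real) ^ n < x"] k by (simp add: m_def)
  then show ?thesis using that[of k] m k by simp
qed

lemma emeasure_annulus:
  assumes "0 \<le> t" "t \<le> 1"
  shows "emeasure lborel {z::complex. norm z < 1 \<and> 1 - (norm z)\<^sup>2 \<le> t} = ennreal (pi * t)"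
proof -
  have "{z::complex. norm z < 1 \<and> 1 - (norm z)\<^sup>2 \<le> t} = ball 0 1 - ball 0 (sqrt (1 - t))"
  proof -
    have "norm z < sqrt (1 - t) \<longleftrightarrow> (norm z)\<^sup>2 < 1 - t" for z :: complex
      using real_sqrt_less_iff[of "(norm z)\<^sup>2" "1 - t"] by simp
    then show ?thesis by (auto simp: not_less)
  qed
  moreover have "emeasure lborel (ball (0::complex) 1 - ball 0 (sqrt (1 - t)))
      = emeasure lborel (ball (0::complex) 1) - emeasure lborel (ball (0::complex) (sqrt (1 - t)))"
    using assms emeasure_lborel_ball_finite[of "0::complex" "sqrt (1 - t)"]
    by (intro emeasure_Diff) (auto intro!: subset_ball)
  moreover have "\<dots> = ennreal (pi * t)"
    using assms by (simp add: emeasure_ball eval_unit_ball_vol ennreal_minus algebra_simps)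
  ultimately show ?thesis by simp
qed

lemma besov_weight_integral_finite:
  assumes p: "1 < p"
  shows "(\<integral>\<^sup>+z. ennreal (besov_weight p z) \<partial>lborel) < \<infinity>"
proof (cases "2 \<le> p")
  case True
  have "(\<integral>\<^sup>+z. ennreal (besov_weight p z) \<partial>lborel) \<le> (\<integral>\<^sup>+z. indicator (ball (0::complex) 1) z \<partial>lborel)"
  proof (rule nn_integral_mono)
    fix z :: complex
    have "(1 - (norm z)\<^sup>2) powr (p - 2) \<le> 1 powr (p - 2)" if "norm z < 1"
      using True that by (intro powr_mono2) (auto simp: abs_square_le_1)
    then show "ennreal (besov_weight p z) \<le> indicator (ball 0 1) z"
      by (auto simp: besov_weight_def split: split_indicator)
  qed
  also have "\<dots> < \<infinity>" using emeasure_lborel_ball_finite[of "0::complex" 1] by simp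
  finally show ?thesis .
next
  case False
  \<comment> \<open>\<open>A k\<close> is the whole collar next to the circle and not only the k-th
    annulus. The overlaps just enlarge the bound, and its area is exactly pi / 2^k.\<close>
  define A where "A k = {z::complex. norm z < 1 \<and> 1 - (norm z)\<^sup>2 \<le> (1/2) ^ k}" for k :: nat
  define c where "c k = ((1/2::real) ^ Suc k) powr (p - 2)" for k :: nat
  have [measurable]: "A k \<in> sets borel" for k unfolding A_def by measurable
  have "(\<integral>\<^sup>+z. ennreal (besov_weight p z) \<partial>lborel) \<le> (\<integral>\<^sup>+z. (\<Sum>k. ennreal (c k) * indicator (A k) z) \<partial>lborel)"
  proof (rule nn_integral_mono)
    fix z :: complex
    show "ennreal (besov_weight p z) \<le> (\<Sum>k. ennreal (c k) * indicator (A k) z)"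
    proof (cases "norm z < 1")
      case True
      obtain k where k: "(1/2) ^ Suc k < 1 - (norm z)\<^sup>2" "1 - (norm z)\<^sup>2 \<le> (1/2) ^ k"
        using dyadic_bracket[of "1 - (norm z)\<^sup>2"] True by (auto simp: abs_square_less_1)
      have "(1 - (norm z)\<^sup>2) powr (p - 2) \<le> c k"
        unfolding c_def using k(1) False by (intro powr_mono2') auto
      then have "ennreal (besov_weight p z) \<le> ennreal (c k) * indicator (A k) z"
        using True k(2) by (simp add: A_def besov_weight_def ennreal_leI)
      also have "\<dots> \<le> (\<Sum>k. ennreal (c k) * indicator (A k) z)"
        using sum_le_suminf[OF summableI, of "{k}" "\<lambda>k. ennreal (c k) * indicator (A k) z"]
        by (simp only: sum.insert sum.empty finite.intros empty_iff not_False_eq_True add_0_right zero_le)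
      finally show ?thesis .
    qed (simp add: besov_weight_eq_0)
  qed
  also have "\<dots> = (\<Sum>k. ennreal (c k) * emeasure lborel (A k))"
    by (simp add: nn_integral_suminf nn_integral_cmult_indicator)
  also have "\<dots> = (\<Sum>k. ennreal (c k * (pi * (1/2) ^ k)))"
    by (intro suminf_cong) (simp add: A_def emeasure_annulus power_le_one c_def flip: ennreal_mult)
  \<comment> \<open>Height 2^(-(k+1)(p-2)) times area pi 2^(-k) gives a geometric series with ratio
    2^(-(p-1)), which is below 1 because p > 1.\<close>
  also have "\<dots> = (\<Sum>k. ennreal (pi * (1/2) powr (p - 2) * ((1/2) powr (p - 1)) ^ k))"
  proof (intro suminf_cong arg_cong[where f = ennreal])
    fix k :: nat
    have "c k = (1/2) powr (real (Suc k) * (p - 2))"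
      unfolding c_def by (subst powr_realpow[symmetric]) (simp_all add: powr_powr)
    moreover have "(1/2::real) ^ k = (1/2) powr real k" by (simp add: powr_realpow)
    moreover have "((1/2::real) powr (p - 1)) ^ k = (1/2) powr (real k * (p - 1))"
      by (simp add: powr_power mult.commute)
    moreover have "(1/2::real) powr (real (Suc k) * (p - 2)) * (1/2) powr real k
        = (1/2) powr (p - 2) * (1/2) powr (real k * (p - 1))"
      unfolding powr_add[symmetric] by (simp add: algebra_simps)
    ultimately show "c k * (pi * (1/2) ^ k) = pi * (1/2) powr (p - 2) * ((1/2) powr (p - 1)) ^ k"
      by (simp add: mult_ac)
  qed
  also have "\<dots> < \<infinity>"
  proof -
    have "(1/2::real) powr (p - 1) < (1/2) powr 0" using p by (intro powr_less_mono') auto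
    then have "summable (\<lambda>k. pi * (1/2) powr (p - 2) * ((1/2::real) powr (p - 1)) ^ k)"
      by (intro summable_mult summable_geometric) simp
    then have "(\<Sum>k. ennreal (pi * (1/2) powr (p - 2) * ((1/2) powr (p - 1)) ^ k)) \<noteq> top"
      by (intro ennreal_suminf_neq_top) auto
    then show ?thesis by (simp add: less_top)
  qed
  finally show ?thesis .
qed

lemma mult_left_commute_subst: "b = u * v \<Longrightarrow> c * v = w \<Longrightarrow> c * b = u * w" for b :: real
  by (metis mult.left_commute)

text \<open>By the Schwarz-Pick equality, (1 - |z|^2)^(p-2) |\<sigma>_a' z|^p is |\<sigma>_a' z|^2
  times the weight at \<sigma>_a z, and |\<sigma>_a'|^2 is the Jacobian of an automorphism of the
  disk. Hence the value does not depend on \<open>a\<close>.\<close>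

lemma besov_integral_disk_moebius:
  assumes p: "1 < p" and a: "norm a < 1"
  shows "besov_integral p (deriv (disk_moebius a)) = (\<integral>\<^sup>+z. ennreal (besov_weight p z) \<partial>lborel)"
proof -
  let ?d = "\<lambda>z. - (1 - (norm a)\<^sup>2) / (1 - cnj a * z)\<^sup>2"
  have img: "disk_moebius a ` ball 0 1 = ball 0 1"
  proof safe
    fix z :: complex assume "z \<in> ball 0 1"
    then show "z \<in> disk_moebius a ` ball 0 1"
      using disk_moebius_involution[OF a, of z] norm_disk_moebius_less[OF a, of z]
      by (metis imageI mem_ball_0)
  qed (use norm_disk_moebius_less[OF a] in auto)
  have ind: "ennreal (besov_weight p z) * indicator (ball 0 1) z = ennreal (besov_weight p z)" for z
    by (simp add: besov_weight_def split: split_indicator)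
  have "(\<integral>\<^sup>+z. ennreal ((norm (?d z))\<^sup>2 * besov_weight p (disk_moebius a z)) * indicator (ball 0 1) z \<partial>lborel)
    = (\<integral>\<^sup>+z. ennreal (besov_weight p z) * indicator (disk_moebius a ` ball 0 1) z \<partial>lborel)"
  proof (rule nn_integral_holomorphic_substitution)
    show "(disk_moebius a has_field_derivative ?d z) (at z)" if "z \<in> ball 0 1" for z
      using has_field_derivative_disk_moebius[OF a] that by simp
    show "inj_on (disk_moebius a) (ball 0 1)"
      by (rule inj_on_inverseI[where g = "disk_moebius a"]) (use disk_moebius_involution[OF a] in auto)
  qed (use besov_weight_integral_finite[OF p] in \<open>simp_all add: img ind\<close>)
  also have "\<dots> = (\<integral>\<^sup>+z. ennreal (besov_weight p z) \<partial>lborel)"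
    by (simp add: img ind)
  also have "(\<integral>\<^sup>+z. ennreal ((norm (?d z))\<^sup>2 * besov_weight p (disk_moebius a z)) * indicator (ball 0 1) z \<partial>lborel)
      = besov_integral p (deriv (disk_moebius a))"
    unfolding besov_integral_def
  proof (rule nn_integral_cong)
    fix z
    show "ennreal ((norm (?d z))\<^sup>2 * besov_weight p (disk_moebius a z)) * indicator (ball 0 1) z
        = ennreal (besov_weight p z * norm (deriv (disk_moebius a) z) powr p)"
    proof (cases "norm z < 1")
      case True
      let ?D = "(1 - (norm a)\<^sup>2) / (norm (1 - cnj a * z))\<^sup>2"
      have a0: "0 < 1 - (norm a)\<^sup>2" and z0: "0 < 1 - (norm z)\<^sup>2"
        using a True by (auto simp: abs_square_less_1)
      have d: "norm (?d z) = ?D"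
        using a0 by (simp only: norm_divide norm_minus_cancel norm_power norm_of_real abs_minus_cancel abs_of_pos)
      have D: "0 < ?D"
        using a0 disk_moebius_denominator_nonzero[OF a True] by simp
      have "besov_weight p (disk_moebius a z) = (1 - (norm z)\<^sup>2) powr (p - 2) * ?D powr (p - 2)"
        using norm_disk_moebius_less[OF a True] D z0
        by (simp add: besov_weight_def one_minus_norm_disk_moebius[OF a True] powr_mult del: times_divide_eq_right)
      moreover have "?D\<^sup>2 * ?D powr (p - 2) = ?D powr p"
        using D by (simp add: powr_diff powr_numeral del: divide_eq_0_iff)
      ultimately have "(norm (?d z))\<^sup>2 * besov_weight p (disk_moebius a z) = (1 - (norm z)\<^sup>2) powr (p - 2) * ?D powr p"
        unfolding d by (rule mult_left_commute_subst)
      then show ?thesis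
        using True by (simp only: DERIV_imp_deriv[OF has_field_derivative_disk_moebius[OF a True]] d)
          (simp add: besov_weight_def)
    qed (simp add: besov_weight_eq_0)
  qed
  finally show ?thesis .
qed

section \<open>Slices of the quaternions\<close>

lemma quat_of_real: "of_real r = Quat r 0 0 0"
  by (simp add: of_real_def quat_eq_iff one_quat_def)

lemma norm_quat_sq: "(norm q)\<^sup>2 = (qRe q)\<^sup>2 + (qI q)\<^sup>2 + (qJ q)\<^sup>2 + (qK q)\<^sup>2"
  by (simp add: norm_quat_def)

lemma imag_units_iff: "i \<in> \<S> \<longleftrightarrow> qRe i = 0 \<and> (qI i)\<^sup>2 + (qJ i)\<^sup>2 + (qK i)\<^sup>2 = 1"
proof
  assume "i \<in> \<S>"
  then have *: "qRe i * qRe i - qI i * qI i - qJ i * qJ i - qK i * qK i = - 1"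
      "qRe i * qI i = 0" "qRe i * qJ i = 0" "qRe i * qK i = 0"
    by (auto simp: imag_units_def power2_eq_square times_quat_def quat_eq_iff one_quat_def)
  have "qRe i = 0"
  proof (rule ccontr)
    assume "qRe i \<noteq> 0"
    with * have "qRe i * qRe i = - 1" by auto
    then show False using zero_le_square[of "qRe i"] by linarith
  qed
  then show "qRe i = 0 \<and> (qI i)\<^sup>2 + (qJ i)\<^sup>2 + (qK i)\<^sup>2 = 1"
    using * by (simp add: power2_eq_square)
qed (simp add: imag_units_def power2_eq_square times_quat_def quat_eq_iff one_quat_def)

lemma imag_unit_square: "i \<in> \<S> \<Longrightarrow> i * i = - 1"
  by (simp add: imag_units_def power2_eq_square)

lemma norm_imag_unit: "i \<in> \<S> \<Longrightarrow> norm i = 1"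
  by (simp add: imag_units_iff norm_quat_def)

lemma imag_unit_nonzero: "i \<in> \<S> \<Longrightarrow> i \<noteq> 0"
  by (auto simp: imag_units_iff)

lemma slice_pt_add: "slice_pt i (z + w) = slice_pt i z + slice_pt i w"
  and slice_pt_diff: "slice_pt i (z - w) = slice_pt i z - slice_pt i w"
  by (simp_all add: slice_pt_def algebra_simps)

lemma slice_pt_of_real [simp]: "slice_pt i (of_real r) = of_real r"
  by (simp add: slice_pt_def)

lemma slice_pt_0 [simp]: "slice_pt i 0 = 0" and slice_pt_1 [simp]: "slice_pt i 1 = 1"
  by (simp_all add: slice_pt_def)

lemma slice_pt_Complex: "slice_pt i (Complex x y) = of_real x + i * of_real y"
  by (simp add: slice_pt_def)

lemma slice_pt_alt: "slice_pt i z = Re z *\<^sub>R 1 + Im z *\<^sub>R i"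
  by (simp add: slice_pt_def of_real_def)

lemma slice_pt_mult: "i \<in> \<S> \<Longrightarrow> slice_pt i (z * w) = slice_pt i z * slice_pt i w"
  by (simp add: slice_pt_alt imag_unit_square algebra_simps)

lemma slice_pt_power: "i \<in> \<S> \<Longrightarrow> slice_pt i (z ^ n) = slice_pt i z ^ n"
  by (induction n) (simp_all add: slice_pt_mult)

lemma slice_pt_commute: "i \<in> \<S> \<Longrightarrow> slice_pt i z * slice_pt i w = slice_pt i w * slice_pt i z"
  by (metis mult.commute slice_pt_mult)

lemma slice_pt_ii [simp]: "slice_pt i \<i> = i"
  by (simp add: slice_pt_def)

lemma norm_slice_pt: "i \<in> \<S> \<Longrightarrow> norm (slice_pt i z) = norm z"
proof -
  assume i: "i \<in> \<S>"
  have "(norm (slice_pt i z))\<^sup>2 = (norm z)\<^sup>2"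
    using i unfolding norm_quat_sq cmod_power2 imag_units_iff
    by (simp add: slice_pt_def quat_of_real times_quat_def) algebra
  then show ?thesis by simp
qed

lemma slice_pt_scaleR: "slice_pt i (r *\<^sub>R z) = r *\<^sub>R slice_pt i z"
  by (simp add: slice_pt_def scaleR_conv_of_real[symmetric] scaleR_right_distrib of_real_def)

lemma bounded_linear_slice_pt: "i \<in> \<S> \<Longrightarrow> bounded_linear (slice_pt i)"
  by (rule bounded_linear_intro[where K = 1])
    (simp_all add: slice_pt_add slice_pt_scaleR norm_slice_pt)

lemma slice_ball_eq: "i \<in> \<S> \<Longrightarrow> slice_ball i = slice_pt i ` ball 0 1"
  by (auto simp: slice_ball_def norm_slice_pt)

text \<open>Orthogonal projection to C(i), read as a complex number. It inverts
  \<open>slice_pt i\<close> on the slice and is defined on all quaternions.\<close>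

definition slice_proj :: "quat \<Rightarrow> quat \<Rightarrow> complex"
  where "slice_proj i q = Complex (q \<bullet> 1) (q \<bullet> i)"

lemma slice_proj_add: "slice_proj i (p + q) = slice_proj i p + slice_proj i q"
  and slice_proj_diff: "slice_proj i (p - q) = slice_proj i p - slice_proj i q"
  and slice_proj_scaleR: "slice_proj i (r *\<^sub>R q) = r *\<^sub>R slice_proj i q"
  by (simp_all add: slice_proj_def complex_eq_iff inner_add_left inner_diff_left)

lemma slice_proj_unit_mult: "i \<in> \<S> \<Longrightarrow> slice_proj i (i * q) = \<i> * slice_proj i q"
  by (auto simp: slice_proj_def complex_eq_iff inner_quat_def times_quat_def one_quat_def
      imag_units_iff power2_eq_square; algebra)

text \<open>Left multiplication by i preserves C(i) and its orthogonal complement, so the projection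
  is linear over C(i) acting from the left. This is what turns left slice regularity into holomorphy
  of the components.\<close>

lemma slice_proj_mult: "i \<in> \<S> \<Longrightarrow> slice_proj i (slice_pt i z * q) = z * slice_proj i q"
proof -
  assume i: "i \<in> \<S>"
  have "slice_pt i z * q = Re z *\<^sub>R q + Im z *\<^sub>R (i * q)"
    by (simp add: slice_pt_def of_real_def distrib_right)
  then have "slice_proj i (slice_pt i z * q) = Re z *\<^sub>R slice_proj i q + Im z *\<^sub>R (\<i> * slice_proj i q)"
    by (simp only: slice_proj_add slice_proj_scaleR slice_proj_unit_mult[OF i])
  also have "\<dots> = (Re z + \<i> * Im z) * slice_proj i q"
    by (simp add: scaleR_conv_of_real algebra_simps)
  finally show ?thesis by (metis complex_eq mult.commute)
qed

lemma slice_proj_slice_pt [simp]: "i \<in> \<S> \<Longrightarrow> slice_proj i (slice_pt i z) = z"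
proof -
  assume i: "i \<in> \<S>"
  have "slice_proj i 1 = 1"
    using i by (simp add: slice_proj_def complex_eq_iff inner_quat_def one_quat_def imag_units_iff)
  then show ?thesis using slice_proj_mult[OF i, of z 1] by simp
qed

lemma norm_slice_proj_le: "i \<in> \<S> \<Longrightarrow> norm (slice_proj i q) \<le> norm q"
proof -
  assume i: "i \<in> \<S>"
  define r where "r = q - slice_pt i (slice_proj i q)"
  have "r \<bullet> 1 = 0" "r \<bullet> i = 0"
    using slice_proj_slice_pt[OF i, of "slice_proj i q"]
    by (simp_all add: r_def inner_diff_left slice_proj_def complex_eq_iff)
  then have "r \<bullet> slice_pt i z = 0" for z
    by (simp add: slice_pt_def inner_add_right of_real_def)
  then have "(norm q)\<^sup>2 = (norm r)\<^sup>2 + (norm (slice_pt i (slice_proj i q)))\<^sup>2"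
    using norm_add_Pythagorean[of r "slice_pt i (slice_proj i q)"]
    by (simp add: r_def orthogonal_def)
  then have "(norm (slice_proj i q))\<^sup>2 \<le> (norm q)\<^sup>2"
    by (simp add: norm_slice_pt[OF i])
  then show ?thesis by (rule power2_le_imp_le) simp
qed

lemma bounded_linear_slice_proj: "i \<in> \<S> \<Longrightarrow> bounded_linear (slice_proj i)"
  by (rule bounded_linear_intro[where K = 1])
    (simp_all add: slice_proj_add slice_proj_scaleR norm_slice_proj_le)

text \<open>For imaginary quaternions the product is the cross product minus the inner product; here
  only the antisymmetric part survives.\<close>

lemma orthogonal_imag_anticommute:
  "qRe p = 0 \<Longrightarrow> qRe q = 0 \<Longrightarrow> p \<bullet> q = 0 \<Longrightarrow> p * q = - (q * p)"
  by (simp add: quat_eq_iff times_quat_def inner_quat_def)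

lemma slice_remainder_anticommute:
  assumes i: "i \<in> \<S>"
  shows "i * (q - slice_pt i (slice_proj i q)) = - ((q - slice_pt i (slice_proj i q)) * i)"
proof -
  let ?r = "q - slice_pt i (slice_proj i q)"
  have "slice_proj i ?r = 0" by (simp add: slice_proj_diff i)
  then have "?r \<bullet> 1 = 0" "?r \<bullet> i = 0" by (simp_all add: slice_proj_def complex_eq_iff)
  then show ?thesis
    using i by (intro orthogonal_imag_anticommute)
      (simp_all add: inner_commute imag_units_iff, simp add: inner_quat_def one_quat_def)
qed

text \<open>The part of q orthogonal to C(i) anticommutes with i. If it also commutes with i, it is
  zero.\<close>

lemma commute_imp_slice:
  assumes i: "i \<in> \<S>" and q: "i * q = q * i"
  shows "q = slice_pt i (slice_proj i q)"
proof -
  let ?r = "q - slice_pt i (slice_proj i q)"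
  have "i * ?r = ?r * i"
    using q slice_pt_commute[OF i, of \<i> "slice_proj i q"] by (simp add: algebra_simps)
  with slice_remainder_anticommute[OF i, of q] have "i * ?r = - (i * ?r)" by simp
  then have "2 *\<^sub>R (i * ?r) = 0"
    by (simp only: scaleR_2) (metis add.right_inverse)
  then show ?thesis using imag_unit_nonzero[OF i] by simp
qed

text \<open>For \<open>j\<close> orthogonal to \<open>i\<close> every quaternion lies in \<open>C(i) + C(i) j\<close>.  The coefficient of \<open>j\<close> is
  the negative of the \<open>C(i)\<close>-part of \<open>q j\<close>, because \<open>j\<^sup>2 = -1\<close>.\<close>

lemma slice_splitting:
  assumes i: "i \<in> \<S>"
  obtains j where "j \<in> \<S>" "\<And>q. q = slice_pt i (slice_proj i q) - slice_pt i (slice_proj i (q * j)) * j"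
proof -
  \<comment> \<open>If i lies on the last axis, the first imaginary unit is orthogonal to it.
    Otherwise a quarter turn of the \<open>qI\<close> and \<open>qJ\<close> coordinates, normalized
    by \<open>s\<close>, gives a unit orthogonal to i.\<close>
  obtain j where j: "j \<in> \<S>" "i \<bullet> j = 0"
  proof (cases "qI i = 0 \<and> qJ i = 0")
    case True
    then show ?thesis
      by (intro that[of "Quat 0 1 0 0"]) (auto simp: imag_units_iff inner_quat_def)
  next
    case False
    define s where "s = sqrt ((qI i)\<^sup>2 + (qJ i)\<^sup>2)"
    have "s\<^sup>2 = (qI i)\<^sup>2 + (qJ i)\<^sup>2" "s \<noteq> 0"
      using False by (auto simp: s_def sum_power2_eq_zero_iff)
    then show ?thesis
      by (intro that[of "Quat 0 (qJ i / s) (- qI i / s) 0"])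
        (auto simp: imag_units_iff inner_quat_def power_divide add_divide_distrib[symmetric] add.commute)
  qed
  have anti: "j * i = - (i * j)"
    using orthogonal_imag_anticommute[of i j] i j by (simp add: imag_units_iff)
  have "q = slice_pt i (slice_proj i q) - slice_pt i (slice_proj i (q * j)) * j" for q
  proof -
    define u where "u = q - slice_pt i (slice_proj i q)"
    \<comment> \<open>Both \<open>u\<close> and \<open>j\<close> anticommute with i, so their
      product commutes with it and lies in C(i).\<close>
    have "i * (u * j) = - (u * i) * j"
      unfolding u_def mult.assoc[symmetric] slice_remainder_anticommute[OF i] ..
    also have "\<dots> = u * j * i"
      by (simp add: mult.assoc anti)
    finally have "u * j = slice_pt i (slice_proj i (u * j))"
      by (rule commute_imp_slice[OF i])
    also have "slice_proj i (u * j) = slice_proj i (q * j)"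
    proof -
      have "slice_proj i j = 0"
        using j by (simp add: slice_proj_def complex_eq_iff inner_commute)
          (simp add: inner_quat_def one_quat_def imag_units_iff)
      then show ?thesis
        by (simp add: u_def left_diff_distrib slice_proj_diff slice_proj_mult[OF i])
    qed
    finally have "u * j * j = slice_pt i (slice_proj i (q * j)) * j" by simp
    then have "- u = slice_pt i (slice_proj i (q * j)) * j"
      by (simp add: mult.assoc imag_unit_square[OF j(1)])
    then show ?thesis unfolding u_def by (metis diff_diff_eq2 add_diff_cancel_left' minus_diff_eq)
  qed
  with j show ?thesis by (intro that) auto
qed

lemma sgn_qIm_imag_unit: "qIm q \<noteq> 0 \<Longrightarrow> sgn (qIm q) \<in> \<S>"
proof -
  assume "qIm q \<noteq> 0"
  then have "norm (sgn (qIm q)) = 1" by (simp add: norm_sgn)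
  then have "(norm (sgn (qIm q)))\<^sup>2 = 1" by simp
  then show ?thesis unfolding norm_quat_sq by (simp add: imag_units_iff sgn_quat_def qIm_def)
qed

lemma slice_pt_sgn_qIm: "slice_pt (sgn (qIm q)) (Complex (qRe q) (norm (qIm q))) = q"
proof -
  have "slice_pt (sgn (qIm q)) (Complex (qRe q) (norm (qIm q))) = qRe q *\<^sub>R 1 + qIm q"
    by (cases "qIm q = 0") (simp_all add: slice_pt_alt sgn_quat_def)
  also have "\<dots> = q" by (simp add: quat_eq_iff qIm_def one_quat_def)
  finally show ?thesis .
qed

lemma quat_in_slice: obtains i z where "i \<in> \<S>" "q = slice_pt i z"
proof (cases "qIm q = 0")
  case True
  then have "q = slice_pt (Quat 0 1 0 0) (of_real (qRe q))"
    by (simp add: quat_of_real quat_eq_iff qIm_def)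
  moreover have "Quat 0 1 0 0 \<in> \<S>" by (simp add: imag_units_iff)
  ultimately show ?thesis using that by blast
next
  case False
  from sgn_qIm_imag_unit[OF this] slice_pt_sgn_qIm[symmetric] show ?thesis by (rule that)
qed

section \<open>Power series of slice regular functions\<close>

text \<open>Slice regularity is phrased with \<open>vector_derivative\<close>, a choice operator.
  The chain rule identifies its values with the Frechet derivative applied to 1 and to i.\<close>

lemma has_vector_derivative_slice_lines:
  fixes f :: "quat \<Rightarrow> quat"
  assumes "(f has_derivative D) (at (of_real x + i * of_real y))"
  shows "((\<lambda>s. f (of_real s + i * of_real y)) has_vector_derivative D 1) (at x)"
    and "((\<lambda>t. f (of_real x + i * of_real t)) has_vector_derivative D i) (at y)"
proof -
  have lin: "linear D" using assms has_derivative_linear by blast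
  have "((\<lambda>s. of_real s + i * of_real y) has_derivative (\<lambda>h. h *\<^sub>R 1)) (at x)"
    by (auto intro!: derivative_eq_intros simp: of_real_def)
  from diff_chain_at[OF this assms]
  show "((\<lambda>s. f (of_real s + i * of_real y)) has_vector_derivative D 1) (at x)"
    by (simp add: has_vector_derivative_def o_def linear_scale[OF lin] of_real_def)
  have "((\<lambda>t. of_real x + i * of_real t) has_derivative (\<lambda>h. h *\<^sub>R i)) (at y)"
    by (auto intro!: derivative_eq_intros simp: of_real_def)
  from diff_chain_at[OF this assms]
  show "((\<lambda>t. f (of_real x + i * of_real t)) has_vector_derivative D i) (at y)"
    by (simp add: has_vector_derivative_def o_def linear_scale[OF lin])
qed

lemma real_dir_deriv_eq:
  assumes "(f has_derivative D) (at q)"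
  shows "real_dir_deriv f q = D 1"
proof -
  have lin: "linear D" using assms has_derivative_linear by blast
  have "((\<lambda>t::real. q + of_real t) has_derivative (\<lambda>h. h *\<^sub>R 1)) (at 0)"
    by (auto intro!: derivative_eq_intros simp: of_real_def)
  from diff_chain_at[OF this, of f D] assms
  have "((\<lambda>t. f (q + of_real t)) has_vector_derivative D 1) (at 0)"
    by (simp add: has_vector_derivative_def o_def linear_scale[OF lin] of_real_def)
  then show ?thesis unfolding real_dir_deriv_def by (rule vector_derivative_at)
qed

text \<open>Multiplying the equation D 1 + i D i = 0 from the left by i gives D i = i D 1. A real
  point lies in all slices, and the same D serves every unit i there.\<close>

lemma slice_regular_has_derivative:
  assumes f: "slice_regular f" and q: "q \<in> \<B>"
  obtains D where "(f has_derivative D) (at q)" "D 1 = real_dir_deriv f q"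
    "\<And>i z. i \<in> \<S> \<Longrightarrow> q = slice_pt i z \<Longrightarrow> D i = i * real_dir_deriv f q"
proof -
  have "f differentiable_on \<B>" using f by (simp add: slice_regular_def)
  then have "f differentiable (at q)" using q by (simp add: differentiable_on_eq_differentiable_at)
  then obtain D where D: "(f has_derivative D) (at q)" unfolding differentiable_def by blast
  have D1: "D 1 = real_dir_deriv f q" using real_dir_deriv_eq[OF D] by simp
  have "D i = i * real_dir_deriv f q" if i: "i \<in> \<S>" and z: "q = slice_pt i z" for i z
  proof -
    have q': "q = of_real (Re z) + i * of_real (Im z)" using z by (simp add: slice_pt_def)
    have "vector_derivative (\<lambda>s. f (of_real s + i * of_real (Im z))) (at (Re z))
      + i * vector_derivative (\<lambda>t. f (of_real (Re z) + i * of_real t)) (at (Im z)) = 0"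
      using f[unfolded slice_regular_def, THEN conjunct2, THEN bspec, OF i, THEN spec, THEN spec,
          THEN mp, of "Re z" "Im z"] q unfolding q' by simp
    then have "D 1 + i * D i = 0"
      using has_vector_derivative_slice_lines[OF D[unfolded q'], THEN vector_derivative_at] by simp
    then have "i * (D 1 + i * D i) = 0" by simp
    then show ?thesis
      by (simp add: distrib_left mult.assoc[symmetric] imag_unit_square[OF i] D1)
  qed
  with D D1 show ?thesis by (rule that)
qed

lemma slice_regularI:
  assumes "\<And>q. q \<in> \<B> \<Longrightarrow> \<exists>D. (f has_derivative D) (at q) \<and>
    (\<forall>i\<in>\<S>. \<forall>z. q = slice_pt i z \<longrightarrow> D i = i * D 1)"
  shows "slice_regular f"
  unfolding slice_regular_def
proof (intro conjI ballI allI impI)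
  show "f differentiable_on \<B>"
    using assms by (meson differentiable_at_imp_differentiable_on differentiable_def)
  fix i x y assume i: "i \<in> \<S>" and q: "of_real x + i * of_real y \<in> \<B>"
  obtain D where D: "(f has_derivative D) (at (of_real x + i * of_real y))" and "D i = i * D 1"
    using assms[OF q] i slice_pt_Complex by metis
  then show "vector_derivative (\<lambda>s. f (of_real s + i * of_real y)) (at x)
      + i * vector_derivative (\<lambda>t. f (of_real x + i * of_real t)) (at y) = 0"
    using has_vector_derivative_slice_lines[OF D, THEN vector_derivative_at]
    by (simp add: mult.assoc[symmetric] imag_unit_square[OF i])
qed

text \<open>Along the slice, D multiplies the real derivative from the left by the increment, and
  \<open>slice_proj\<close> respects this. The right factor \<open>c\<close> is carried along so
  that c = 1 and c = j give the two components of the splitting.\<close>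

lemma slice_regular_component_derivative:
  assumes f: "slice_regular f" and i: "i \<in> \<S>" and z: "norm z < 1"
  shows "((\<lambda>z. slice_proj i (f (slice_pt i z) * c)) has_field_derivative
    slice_proj i (real_dir_deriv f (slice_pt i z) * c)) (at z)"
proof -
  have q: "slice_pt i z \<in> \<B>" using i z by (simp add: norm_slice_pt)
  obtain D where D: "(f has_derivative D) (at (slice_pt i z))"
    and D1: "D 1 = real_dir_deriv f (slice_pt i z)" and Di: "D i = i * real_dir_deriv f (slice_pt i z)"
    using slice_regular_has_derivative[OF f q] i by metis
  have lin: "linear D" using D has_derivative_linear by blast
  have "bounded_linear (\<lambda>q. slice_proj i (q * c))"
    using bounded_linear_compose[OF bounded_linear_slice_proj[OF i] bounded_linear_mult_left] .
  then have "((\<lambda>q. slice_proj i (q * c)) has_derivative (\<lambda>q. slice_proj i (q * c))) (at p)" for p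
    by (rule bounded_linear_imp_has_derivative)
  from diff_chain_at[OF diff_chain_at[OF bounded_linear_imp_has_derivative[OF bounded_linear_slice_pt[OF i]] D] this]
  have "((\<lambda>z. slice_proj i (f (slice_pt i z) * c)) has_derivative (\<lambda>h. slice_proj i (D (slice_pt i h) * c))) (at z)"
    by (simp add: o_def)
  moreover have "slice_proj i (D (slice_pt i h) * c) = slice_proj i (real_dir_deriv f (slice_pt i z) * c) * h" for h
  proof -
    have "D (slice_pt i h) = Re h *\<^sub>R D 1 + Im h *\<^sub>R D i"
      by (simp add: slice_pt_alt linear_add[OF lin] linear_scale[OF lin])
    also have "\<dots> = slice_pt i h * real_dir_deriv f (slice_pt i z)"
      by (simp add: D1 Di slice_pt_alt distrib_right)
    finally show ?thesis by (simp add: mult.assoc slice_proj_mult[OF i] mult.commute)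
  qed
  ultimately show ?thesis by (simp add: has_field_derivative_def)
qed

lemma slice_regular_component_holomorphic:
  assumes f: "slice_regular f" and i: "i \<in> \<S>"
  shows "(\<lambda>z. slice_proj i (f (slice_pt i z) * c)) holomorphic_on ball 0 1"
  unfolding holomorphic_on_open[OF open_ball]
  using slice_regular_component_derivative[OF assms, of _ c] by fastforce

definition slice_component_deriv :: "quat \<Rightarrow> (quat \<Rightarrow> quat) \<Rightarrow> quat \<Rightarrow> complex \<Rightarrow> complex"
  where "slice_component_deriv i f c z = slice_proj i (real_dir_deriv f (slice_pt i z) * c)"

lemma slice_component_deriv_holomorphic:
  assumes f: "slice_regular f" and i: "i \<in> \<S>"
  shows "slice_component_deriv i f c holomorphic_on ball 0 1"
proof -
  have "deriv (\<lambda>z. slice_proj i (f (slice_pt i z) * c)) holomorphic_on ball 0 1"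
    by (intro holomorphic_deriv slice_regular_component_holomorphic[OF f i]) simp
  then show ?thesis
    by (rule holomorphic_transform)
      (simp add: slice_component_deriv_def DERIV_imp_deriv[OF slice_regular_component_derivative[OF f i]])
qed

text \<open>The n-th Taylor coefficients of A and B merge into one quaternion. Powers of z commute
  with C(i) and can be moved to the left, while j stays on the right.\<close>

lemma slice_sums_of_holomorphic:
  assumes i: "i \<in> \<S>" and A: "A holomorphic_on ball 0 1" and B: "B holomorphic_on ball 0 1"
  obtains a where "\<And>z. norm z < 1 \<Longrightarrow>
    (\<lambda>n. slice_pt i z ^ n * a n) sums (slice_pt i (A z) - slice_pt i (B z) * j)"
proof
  let ?cA = "\<lambda>n. (deriv ^^ n) A 0 / fact n" and ?cB = "\<lambda>n. (deriv ^^ n) B 0 / fact n"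
  fix z :: complex assume "norm z < 1"
  then have z: "z \<in> ball 0 1" by simp
  have "(\<lambda>n. slice_pt i (?cA n * (z - 0) ^ n)) sums slice_pt i (A z)"
    "(\<lambda>n. slice_pt i (?cB n * (z - 0) ^ n)) sums slice_pt i (B z)"
    by (intro bounded_linear.sums[OF bounded_linear_slice_pt[OF i]] holomorphic_power_series[OF A z]
        holomorphic_power_series[OF B z])+
  from sums_diff[OF this(1) sums_mult2[OF this(2)]]
  have "(\<lambda>n. slice_pt i (?cA n * z ^ n) - slice_pt i (?cB n * z ^ n) * j)
      sums (slice_pt i (A z) - slice_pt i (B z) * j)" by simp
  moreover have "slice_pt i (?cA n * z ^ n) - slice_pt i (?cB n * z ^ n) * j
      = slice_pt i z ^ n * (slice_pt i (?cA n) - slice_pt i (?cB n) * j)" for n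
  proof -
    have "slice_pt i (c * z ^ n) = slice_pt i z ^ n * slice_pt i c" for c
      by (metis i mult.commute slice_pt_mult slice_pt_power)
    then show ?thesis by (simp only: right_diff_distrib mult.assoc)
  qed
  ultimately show "(\<lambda>n. slice_pt i z ^ n * (slice_pt i (?cA n) - slice_pt i (?cB n) * j))
      sums (slice_pt i (A z) - slice_pt i (B z) * j)" by simp
qed

text \<open>A nonzero coefficient would make the sum nonzero in a punctured neighbourhood of
  0.\<close>

lemma real_power_series_zero:
  fixes a :: "nat \<Rightarrow> real"
  assumes "\<And>x. \<bar>x\<bar> < 1 \<Longrightarrow> (\<lambda>n. a n * x ^ n) sums 0"
  shows "a n = 0"
proof (rule ccontr)
  assume nz: "a n \<noteq> 0"
  have "a 0 = 0" using assms[of 0] by simp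
  with nz have n: "0 < n" by (cases n) auto
  show False
  proof (rule powser_0_nonzero[of 1 0 a "\<lambda>_. 0" n])
    fix s :: real
    assume "0 < s" and "\<And>z::real. z \<in> cball 0 s - {0} \<Longrightarrow> (0::real) \<noteq> 0"
    from this(2)[of s] \<open>0 < s\<close> show False by simp
  qed (use assms nz n in auto)
qed

text \<open>Real arguments suffice: their powers are central, so pairing the difference with a fixed
  quaternion gives a real power series with sum 0.\<close>

lemma slice_series_unique:
  assumes "\<And>x. \<bar>x\<bar> < 1 \<Longrightarrow> (\<lambda>n. of_real x ^ n * a n) sums f x"
    and "\<And>x. \<bar>x\<bar> < 1 \<Longrightarrow> (\<lambda>n. of_real x ^ n * b n) sums f x"
  shows "a = (b :: nat \<Rightarrow> quat)"
proof
  fix n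
  have *: "(\<lambda>n. x ^ n *\<^sub>R (a n - b n)) sums 0" if "\<bar>x\<bar> < 1" for x :: real
    using sums_diff[OF assms(1)[OF that] assms(2)[OF that]]
    by (simp add: scaleR_conv_of_real right_diff_distrib)
  have "(a n - b n) \<bullet> e = 0" for e
  proof (rule real_power_series_zero)
    fix x :: real assume "\<bar>x\<bar> < 1"
    from bounded_linear.sums[OF bounded_linear_inner_left *[OF this], of e]
    show "(\<lambda>n. ((a n - b n) \<bullet> e) * x ^ n) sums 0" by (simp add: mult.commute)
  qed
  from this[of "a n - b n"] show "a n = b n" by simp
qed

text \<open>The Taylor coefficients on the various slices agree because all slices share the real
  diameter.\<close>

lemma slice_sums_glue:
  fixes F :: "quat \<Rightarrow> quat"
  assumes "\<And>i. i \<in> \<S> \<Longrightarrow> \<exists>a. \<forall>z. norm z < 1 \<longrightarrow> (\<lambda>n. slice_pt i z ^ n * a n) sums F (slice_pt i z)"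
  obtains a where "\<And>q. q \<in> \<B> \<Longrightarrow> (\<lambda>n. q ^ n * a n) sums F q"
proof -
  obtain c where c: "\<And>i z. i \<in> \<S> \<Longrightarrow> norm z < 1 \<Longrightarrow> (\<lambda>n. slice_pt i z ^ n * c i n) sums F (slice_pt i z)"
    using assms by metis
  let ?k = "Quat 0 1 0 0"
  have k: "?k \<in> \<S>" by (simp add: imag_units_iff)
  have eq: "c i = c ?k" if i: "i \<in> \<S>" for i
  proof (rule slice_series_unique[where f = "\<lambda>x. F (of_real x)"])
    fix x :: real assume "\<bar>x\<bar> < 1"
    then show "(\<lambda>n. of_real x ^ n * c i n) sums F (of_real x)" "(\<lambda>n. of_real x ^ n * c ?k n) sums F (of_real x)"
      using c[OF i, of "of_real x"] c[OF k, of "of_real x"] by simp_all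
  qed
  have "(\<lambda>n. q ^ n * c ?k n) sums F q" if "q \<in> \<B>" for q
  proof -
    obtain i z where i: "i \<in> \<S>" and z: "q = slice_pt i z" by (rule quat_in_slice)
    then show ?thesis using c[OF i, of z] eq[OF i] that by (simp add: norm_slice_pt)
  qed
  then show ?thesis by (rule that)
qed

lemma slice_regular_sums:
  assumes f: "slice_regular f"
  obtains a where "\<And>q. q \<in> \<B> \<Longrightarrow> (\<lambda>n. q ^ n * a n) sums f q"
proof (rule slice_sums_glue)
  fix i assume i: "i \<in> \<S>"
  obtain j where j: "\<And>q. q = slice_pt i (slice_proj i q) - slice_pt i (slice_proj i (q * j)) * j"
    using slice_splitting[OF i] by metis
  have "(\<lambda>z. slice_proj i (f (slice_pt i z))) holomorphic_on ball 0 1"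
    "(\<lambda>z. slice_proj i (f (slice_pt i z) * j)) holomorphic_on ball 0 1"
    using slice_regular_component_holomorphic[OF f i, of 1] slice_regular_component_holomorphic[OF f i, of j] by simp_all
  from slice_sums_of_holomorphic[OF i this, of j] j
  show "\<exists>a. \<forall>z. norm z < 1 \<longrightarrow> (\<lambda>n. slice_pt i z ^ n * a n) sums f (slice_pt i z)" by metis
qed (use that in blast)

text \<open>The derivative gets its own series by splitting and gluing, because the representation
  formula is later applied to it to compare slices.\<close>

lemma real_dir_deriv_sums:
  assumes f: "slice_regular f"
  obtains a where "\<And>q. q \<in> \<B> \<Longrightarrow> (\<lambda>n. q ^ n * a n) sums real_dir_deriv f q"
proof (rule slice_sums_glue)
  fix i assume i: "i \<in> \<S>"
  obtain j where j: "\<And>q. q = slice_pt i (slice_proj i q) - slice_pt i (slice_proj i (q * j)) * j"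
    using slice_splitting[OF i] by metis
  note hol = slice_component_deriv_holomorphic[OF f i]
  from slice_sums_of_holomorphic[OF i hol[of 1] hol[of j], of j] j
  show "\<exists>a. \<forall>z. norm z < 1 \<longrightarrow> (\<lambda>n. slice_pt i z ^ n * a n) sums real_dir_deriv f (slice_pt i z)"
    by (simp add: slice_component_deriv_def) metis
qed (use that in blast)

lemma slice_coeffs_eqI:
  assumes "\<And>q. q \<in> \<B> \<Longrightarrow> (\<lambda>n. q ^ n * a n) sums f q"
  shows "slice_coeffs f = a"
  unfolding slice_coeffs_def
proof (rule the_equality)
  show "\<forall>q\<in>\<B>. (\<lambda>n. q ^ n * a n) sums f q" using assms by blast
  fix b assume "\<forall>q\<in>\<B>. (\<lambda>n. q ^ n * b n) sums f q"
  then show "b = a"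
    by (intro slice_series_unique[where f = "\<lambda>x. f (of_real x)"] assms) auto
qed

section \<open>Termwise differentiation of quaternionic power series\<close>

primrec quat_power_deriv :: "nat \<Rightarrow> quat \<Rightarrow> quat \<Rightarrow> quat"
  where "quat_power_deriv 0 q h = 0"
  | "quat_power_deriv (Suc n) q h = q * quat_power_deriv n q h + h * q ^ n"

text \<open>Since q and the increment h need not commute, the derivative is the sum of the products
  q^k h q^(n-1-k), which the recursion produces through the product rule.\<close>

lemma has_derivative_quat_power: "((\<lambda>q. q ^ n) has_derivative quat_power_deriv n q) (at q within S)"
proof (induction n)
  case (Suc n)
  from has_derivative_mult[OF has_derivative_ident Suc.IH]
  show ?case by simp
qed simp

lemma quat_power_deriv_commute:
  "q * h = h * q \<Longrightarrow> quat_power_deriv n q h = of_nat n * q ^ (n - 1) * h"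
proof (induction n)
  case (Suc n)
  have "h * q ^ n = q ^ n * h" using Suc.prems by (metis power_commuting_commutes)
  moreover have "q * (of_nat n * q ^ (n - 1) * h) = of_nat n * q ^ n * h"
  proof -
    have "q * (of_nat n * q ^ (n - 1) * h) = of_nat n * (q * q ^ (n - 1)) * h"
      by (metis mult.assoc mult_of_nat_commute)
    also have "of_nat n * (q * q ^ (n - 1)) = of_nat n * q ^ n" by (cases n) simp_all
    finally show ?thesis .
  qed
  ultimately show ?case using Suc by (simp add: distrib_right add.commute)
qed simp

lemma norm_quat_power_deriv_le: "norm (quat_power_deriv n q h) \<le> of_nat n * norm q ^ (n - 1) * norm h"
proof (induction n)
  case (Suc n)
  have "norm (quat_power_deriv (Suc n) q h) \<le> norm q * norm (quat_power_deriv n q h) + norm h * norm q ^ n"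
    by (simp, rule norm_triangle_le) (simp add: norm_mult norm_power)
  also have "\<dots> \<le> norm q * (of_nat n * norm q ^ (n - 1) * norm h) + norm h * norm q ^ n"
    using Suc by (intro add_right_mono mult_left_mono) auto
  also have "\<dots> = of_nat (Suc n) * norm q ^ (Suc n - 1) * norm h"
    by (cases n) (simp_all add: algebra_simps)
  finally show ?case .
qed simp

lemma slice_series_summable_norm:
  fixes a :: "nat \<Rightarrow> quat"
  assumes "\<And>x. \<bar>x\<bar> < 1 \<Longrightarrow> summable (\<lambda>n. of_real x ^ n * a n)" and "\<bar>r\<bar> < 1"
  shows "summable (\<lambda>n. norm (a n) * r ^ n)"
proof -
  define s where "s = (1 + \<bar>r\<bar>) / 2"
  have s: "\<bar>s\<bar> < 1" "\<bar>r\<bar> < \<bar>s\<bar>" using assms(2) by (auto simp: s_def)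
  have "summable (\<lambda>n. a n * of_real s ^ n)"
    using assms(1)[OF s(1)] by (simp add: of_real_def)
  then have "summable (\<lambda>n. norm (a n * of_real r ^ n))"
    by (rule powser_insidea) (use s in simp)
  then show ?thesis
    by (rule summable_norm_cancel[OF summable_cong[THEN iffD1, rotated]])
      (simp add: norm_mult norm_power abs_mult power_abs)
qed

text \<open>The tails of the differentiated series are controlled uniformly on a ball around 0
  containing q, so that the series is differentiable as a real map. Star inverses, Moebius maps and
  C_\<Phi> f are all seen to be slice regular in this way.\<close>

lemma slice_regular_of_sums:
  fixes f :: "quat \<Rightarrow> quat"
  assumes f: "\<And>q. q \<in> \<B> \<Longrightarrow> (\<lambda>n. q ^ n * a n) sums f q"
  shows "slice_regular f"
proof (rule slice_regularI)
  fix q :: quat assume q: "q \<in> \<B>"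
  define r where "r = (1 + norm q) / 2"
  have r: "norm q < r" "r < 1" "0 < r" using q norm_ge_zero[of q] by (auto simp: r_def simp del: norm_ge_zero)
  \<comment> \<open>A majorant of the differentiated terms on the ball of radius \<open>r\<close>,
    which lies strictly between |q| and 1.\<close>
  define b where "b n = of_nat n * r ^ (n - 1) * norm (a n)" for n
  let ?D = "\<lambda>x h. \<Sum>n. quat_power_deriv n x h * a n"
  have "summable (\<lambda>n. of_real x ^ n * a n)" if "\<bar>x\<bar> < 1" for x
    using f[of "of_real x"] that by (auto simp: sums_iff)
  then have "summable (\<lambda>n. norm (a n) * x ^ n)" if "norm x < 1" for x :: real
    using slice_series_summable_norm that by auto
  then have "summable (\<lambda>n. diffs (\<lambda>n. norm (a n)) n * r ^ n)"
    using r by (intro termdiff_converges[where K = 1]) auto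
  then have "summable (\<lambda>n. b (Suc n))"
    by (simp add: b_def diffs_def mult_ac)
  then have b: "summable b" by (simp only: summable_Suc_iff)
  have term_le: "norm (quat_power_deriv n x h * a n) \<le> b n * norm h" if "x \<in> ball 0 r" for n x h
  proof -
    have "norm (quat_power_deriv n x h) \<le> of_nat n * norm x ^ (n - 1) * norm h"
      by (rule norm_quat_power_deriv_le)
    also have "\<dots> \<le> of_nat n * r ^ (n - 1) * norm h"
      using that by (intro mult_right_mono mult_left_mono power_mono) auto
    finally have "norm (quat_power_deriv n x h) * norm (a n) \<le> (of_nat n * r ^ (n - 1) * norm h) * norm (a n)"
      by (rule mult_right_mono) simp
    then show ?thesis by (simp only: norm_mult b_def mult_ac)
  qed
  have D_sum: "summable (\<lambda>n. quat_power_deriv n x h * a n)" if "x \<in> ball 0 r" for x h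
    by (rule summable_comparison_test'[OF summable_mult2[OF b, of "norm h"]]) (rule term_le[OF that])
  have "\<exists>g. \<forall>x\<in>ball 0 r. (\<lambda>n. x ^ n * a n) sums g x \<and> (g has_derivative ?D x) (at x within ball 0 r)"
  proof (rule has_derivative_series)
    show "convex (ball (0::quat) r)" by simp
    show "((\<lambda>q. q ^ n * a n) has_derivative (\<lambda>h. quat_power_deriv n x h * a n)) (at x within ball 0 r)" for n x
      by (rule has_derivative_mult_left[OF has_derivative_quat_power])
    show "\<forall>\<^sub>F n in sequentially. \<forall>x\<in>ball 0 r. \<forall>h.
        norm ((\<Sum>i<n. quat_power_deriv i x h * a i) - ?D x h) \<le> e * norm h" if "e > 0" for e
    proof -
      obtain N where N: "\<And>n. n \<ge> N \<Longrightarrow> norm (\<Sum>k. b (k + n)) < e"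
        using suminf_exist_split[OF \<open>e > 0\<close> b] by blast
      have "norm ((\<Sum>i<n. quat_power_deriv i x h * a i) - ?D x h) \<le> e * norm h"
        if n: "n \<ge> N" and x: "x \<in> ball 0 r" for n x h
      proof -
        have "(\<Sum>i<n. quat_power_deriv i x h * a i) - ?D x h
            = - (\<Sum>k. quat_power_deriv (k + n) x h * a (k + n))"
          using suminf_minus_initial_segment[OF D_sum[OF x], where k = n] by simp
        also have "norm \<dots> \<le> (\<Sum>k. b (k + n) * norm h)"
          unfolding norm_minus_cancel
          by (rule norm_suminf_le[OF term_le[OF x]])
            (intro summable_mult2 summable_ignore_initial_segment b)
        also have "\<dots> = (\<Sum>k. b (k + n)) * norm h"
          by (rule suminf_mult2[symmetric]) (intro summable_ignore_initial_segment b)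
        also have "\<dots> \<le> e * norm h"
          using N[OF n] by (intro mult_right_mono) auto
        finally show ?thesis .
      qed
      then show ?thesis unfolding eventually_sequentially by blast
    qed
    show "0 \<in> ball 0 r" "(\<lambda>n. 0 ^ n * a n) sums f 0" using r f[of 0] by auto
  qed
  then obtain g where g: "\<And>x. x \<in> ball 0 r \<Longrightarrow> (\<lambda>n. x ^ n * a n) sums g x"
    "\<And>x. x \<in> ball 0 r \<Longrightarrow> (g has_derivative ?D x) (at x within ball 0 r)" by blast
  have q_r: "q \<in> ball 0 r" using r by simp
  have "(g has_derivative ?D q) (at q)"
    using g(2)[OF q_r] at_within_open[OF q_r open_ball] by simp
  then have "(f has_derivative ?D q) (at q)"
  proof (rule has_derivative_transform_within_open)
    show "g x = f x" if "x \<in> ball 0 r" for x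
    proof (rule sums_unique2[OF g(1)[OF that] f])
      show "x \<in> \<B>" using that r by simp
    qed
    show "open (ball (0::quat) r)" by simp
  qed (rule q_r)
  \<comment> \<open>On its slice q commutes with i, so i comes out of each term to the left; the
    coefficients on the right do not interfere.\<close>
  moreover have "?D q i = i * ?D q 1" if i: "i \<in> \<S>" and z: "q = slice_pt i z" for i z
  proof -
    have comm: "q * i = i * q" using slice_pt_commute[OF i, of z \<i>] by (simp add: z)
    have "quat_power_deriv n q i = i * quat_power_deriv n q 1" for n
    proof -
      have "i * (of_nat n * q ^ (n - 1)) = of_nat n * q ^ (n - 1) * i"
        by (metis comm mult.assoc mult_of_nat_commute power_commuting_commutes)
      then show ?thesis
        by (simp add: quat_power_deriv_commute[OF comm] quat_power_deriv_commute[of q 1])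
    qed
    then show ?thesis
      by (simp add: mult.assoc suminf_mult[OF D_sum[OF q_r]])
  qed
  ultimately show "\<exists>D. (f has_derivative D) (at q) \<and> (\<forall>i\<in>\<S>. \<forall>z. q = slice_pt i z \<longrightarrow> D i = i * D 1)"
    by blast
qed

section \<open>Slice composition and regular Moebius transformations\<close>

text \<open>Both sides are affine in \<open>I\<close>, and only \<open>i\<close> has to be a unit.
  This covers the default \<open>sgn 0 = 0\<close>, which \<open>slice_comp\<close> uses at real
  points.\<close>

lemma slice_pt_representation:
  assumes i: "i \<in> \<S>"
  shows "slice_pt I w = (1/2) *\<^sub>R ((1 - I * i) * slice_pt i w + (1 + I * i) * slice_pt i (cnj w))"
proof -
  have "(1 - I * i) * slice_pt i w + (1 + I * i) * slice_pt i (cnj w) = 2 *\<^sub>R slice_pt I w"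
    by (simp add: slice_pt_alt algebra_simps imag_unit_square[OF i])
      (simp add: quat_eq_iff)
  then show ?thesis by simp
qed

text \<open>The formula for points is applied to \<open>z ^ n\<close>. Its factors with J i stand on
  the left and the coefficients on the right, so it passes through the series term by term.\<close>

lemma slice_series_representation:
  fixes F :: "quat \<Rightarrow> quat"
  assumes F: "\<And>q. q \<in> \<B> \<Longrightarrow> (\<lambda>n. q ^ n * a n) sums F q"
    and i: "i \<in> \<S>" and J: "J \<in> \<S>" and z: "norm z < 1"
  shows "F (slice_pt J z) = (1/2) *\<^sub>R ((1 - J * i) * F (slice_pt i z) + (1 + J * i) * F (slice_pt i (cnj z)))"
proof (rule sums_unique2)
  show "(\<lambda>n. slice_pt J z ^ n * a n) sums F (slice_pt J z)"
    using F[of "slice_pt J z"] J z by (simp add: norm_slice_pt)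
  have "(\<lambda>n. (1/2) *\<^sub>R ((1 - J * i) * (slice_pt i z ^ n * a n) + (1 + J * i) * (slice_pt i (cnj z) ^ n * a n)))
    sums ((1/2) *\<^sub>R ((1 - J * i) * F (slice_pt i z) + (1 + J * i) * F (slice_pt i (cnj z))))"
    using i z by (intro sums_scaleR_right sums_add sums_mult F) (auto simp: norm_slice_pt)
  moreover have "(1/2) *\<^sub>R ((1 - J * i) * (slice_pt i z ^ n * a n) + (1 + J * i) * (slice_pt i (cnj z) ^ n * a n))
      = slice_pt J z ^ n * a n" for n
    using slice_pt_representation[OF i, of J "z ^ n"]
    by (simp add: slice_pt_power i J distrib_right mult.assoc)
  ultimately show "(\<lambda>n. slice_pt J z ^ n * a n)
    sums ((1/2) *\<^sub>R ((1 - J * i) * F (slice_pt i z) + (1 + J * i) * F (slice_pt i (cnj z))))" by simp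
qed

lemma norm_slice_series_le:
  fixes F :: "quat \<Rightarrow> quat"
  assumes "\<And>q. q \<in> \<B> \<Longrightarrow> (\<lambda>n. q ^ n * a n) sums F q"
    and i: "i \<in> \<S>" and J: "J \<in> \<S>" and "norm z < 1"
  shows "norm (F (slice_pt J z)) \<le> norm (F (slice_pt i z)) + norm (F (slice_pt i (cnj z)))"
proof -
  have "norm (J * i) = 1" by (simp add: norm_mult norm_imag_unit i J)
  then have "norm (1 - J * i) \<le> 2" "norm (1 + J * i) \<le> 2"
    using norm_triangle_ineq4[of 1 "J * i"] norm_triangle_ineq[of 1 "J * i"] by simp_all
  from mult_right_mono[OF this(1) norm_ge_zero] mult_right_mono[OF this(2) norm_ge_zero]
  have "norm ((1 - J * i) * F (slice_pt i z)) \<le> 2 * norm (F (slice_pt i z))"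
    "norm ((1 + J * i) * F (slice_pt i (cnj z))) \<le> 2 * norm (F (slice_pt i (cnj z)))"
    by (simp_all only: norm_mult)
  from order_trans[OF norm_triangle_ineq add_mono[OF this]]
  have "norm ((1 - J * i) * F (slice_pt i z) + (1 + J * i) * F (slice_pt i (cnj z)))
      \<le> 2 * norm (F (slice_pt i z)) + 2 * norm (F (slice_pt i (cnj z)))" .
  moreover have "norm (F (slice_pt J z))
      = (1/2) * norm ((1 - J * i) * F (slice_pt i z) + (1 + J * i) * F (slice_pt i (cnj z)))"
    by (subst slice_series_representation[OF assms]) simp_all
  ultimately show ?thesis by simp
qed

text \<open>The extension formula reproduces q^n from the powers on the slice, so C_\<Phi> f has the
  coefficients of f after \<Phi> on that slice. Regularity and the values on the slice both
  follow.\<close>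

lemma slice_comp_sums:
  assumes i: "i \<in> \<S>"
    and a: "\<And>z. norm z < 1 \<Longrightarrow> (\<lambda>n. slice_pt i z ^ n * a n) sums f (\<Phi> (slice_pt i z))"
    and q: "q \<in> \<B>"
  shows "(\<lambda>n. q ^ n * a n) sums slice_comp i \<Phi> f q"
proof -
  let ?I = "sgn (qIm q)" and ?w = "Complex (qRe q) (norm (qIm q))"
  have "norm ?w = norm q"
  proof -
    have "(norm ?w)\<^sup>2 = (norm q)\<^sup>2"
      unfolding cmod_power2 by (simp add: norm_quat_sq qIm_def)
    then show ?thesis by simp
  qed
  then have w: "norm ?w < 1" "norm (cnj ?w) < 1" using q by (auto simp del: complex_mod_cnj simp: complex_mod_cnj)
  have comp: "slice_comp i \<Phi> f q = (1/2) *\<^sub>R ((1 - ?I * i) * f (\<Phi> (slice_pt i ?w))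
      + (1 + ?I * i) * f (\<Phi> (slice_pt i (cnj ?w))))"
    by (simp add: slice_comp_def Let_def slice_pt_def)
  have pow: "slice_pt ?I (?w ^ n) = q ^ n" for n
  proof (cases "qIm q = 0")
    case True
    then have "?w = of_real (qRe q)" by (simp add: complex_eq_iff)
    moreover have "q = of_real (qRe q)" using slice_pt_sgn_qIm[of q] True by (simp add: slice_pt_def)
    ultimately show ?thesis by (metis of_real_power slice_pt_of_real)
  next
    case False
    then show ?thesis by (simp add: slice_pt_power sgn_qIm_imag_unit slice_pt_sgn_qIm)
  qed
  have "(\<lambda>n. (1/2) *\<^sub>R ((1 - ?I * i) * (slice_pt i ?w ^ n * a n) + (1 + ?I * i) * (slice_pt i (cnj ?w) ^ n * a n)))
      sums slice_comp i \<Phi> f q"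
    unfolding comp by (intro sums_scaleR_right sums_add sums_mult a w)
  moreover have "(1/2) *\<^sub>R ((1 - ?I * i) * (slice_pt i ?w ^ n * a n) + (1 + ?I * i) * (slice_pt i (cnj ?w) ^ n * a n))
      = q ^ n * a n" for n
    using slice_pt_representation[OF i, of ?I "?w ^ n"] unfolding pow complex_cnj_power slice_pt_power[OF i]
    by (simp add: distrib_right mult.assoc)
  ultimately show ?thesis by simp
qed

text \<open>The sum in the definition of the star product is meaningful only if it converges. In
  norm it is dominated by the real Cauchy product of the two absolutely convergent series.\<close>

lemma star_prod_sums:
  assumes f: "\<And>q. q \<in> \<B> \<Longrightarrow> (\<lambda>n. q ^ n * a n) sums f q"
    and g: "\<And>q. q \<in> \<B> \<Longrightarrow> (\<lambda>n. q ^ n * b n) sums g q"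
    and q: "q \<in> \<B>"
  shows "(\<lambda>n. q ^ n * (\<Sum>k\<le>n. a k * b (n - k))) sums (f \<star> g) q"
proof -
  have r: "\<bar>norm q\<bar> < 1" using q by simp
  have "summable (\<lambda>n. of_real x ^ n * a n)" "summable (\<lambda>n. of_real x ^ n * b n)" if "\<bar>x\<bar> < 1" for x
    using f[of "of_real x"] g[of "of_real x"] that by (auto simp: sums_iff)
  from slice_series_summable_norm[OF this(1) r] slice_series_summable_norm[OF this(2) r]
  have "summable (\<lambda>n. \<Sum>k\<le>n. (norm (a k) * norm q ^ k) * (norm (b (n - k)) * norm q ^ (n - k)))"
    by (intro summable_Cauchy_product) simp_all
  then have "summable (\<lambda>n. q ^ n * (\<Sum>k\<le>n. a k * b (n - k)))"
  proof (rule summable_comparison_test')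
    fix n
    have "norm (q ^ n * (\<Sum>k\<le>n. a k * b (n - k))) = norm q ^ n * norm (\<Sum>k\<le>n. a k * b (n - k))"
      by (simp add: norm_mult norm_power)
    also have "\<dots> \<le> norm q ^ n * (\<Sum>k\<le>n. norm (a k * b (n - k)))"
      by (intro mult_left_mono norm_sum) simp
    also have "\<dots> = (\<Sum>k\<le>n. (norm (a k) * norm q ^ k) * (norm (b (n - k)) * norm q ^ (n - k)))"
      unfolding sum_distrib_left
    proof (rule sum.cong)
      fix k assume "k \<in> {..n}"
      then have "norm q ^ n = norm q ^ k * norm q ^ (n - k)" by (simp flip: power_add)
      then show "norm q ^ n * norm (a k * b (n - k)) = (norm (a k) * norm q ^ k) * (norm (b (n - k)) * norm q ^ (n - k))"
        by (simp add: norm_mult)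
    qed simp
    finally show "norm (q ^ n * (\<Sum>k\<le>n. a k * b (n - k)))
      \<le> (\<Sum>k\<le>n. (norm (a k) * norm q ^ k) * (norm (b (n - k)) * norm q ^ (n - k)))" .
  qed
  moreover have "slice_coeffs f = a" "slice_coeffs g = b"
    using slice_coeffs_eqI f g by blast+
  ultimately show ?thesis
    by (simp add: star_prod_def summable_sums)
qed

section \<open>Star inverse of a linear polynomial and the Moebius maps\<close>

definition linear_coeffs :: "quat \<Rightarrow> quat \<Rightarrow> nat \<Rightarrow> quat"
  where "linear_coeffs u v n = (if n = 0 then u else if n = 1 then v else 0)"

lemma linear_coeffs_sums: "(\<lambda>n. q ^ n * linear_coeffs u v n) sums (u + q * v)"
proof -
  have "(\<lambda>n. q ^ n * linear_coeffs u v n) sums (\<Sum>n\<in>{0, 1}. q ^ n * linear_coeffs u v n)"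
    by (rule sums_finite) (auto simp: linear_coeffs_def)
  then show ?thesis by (simp add: linear_coeffs_def)
qed

lemma linear_coeffs_convolution_left:
  "(\<Sum>k\<le>n. linear_coeffs u v k * b (n - k)) = u * b n + (if n = 0 then 0 else v * b (n - 1))"
proof (cases n)
  case (Suc m)
  have "(\<Sum>k\<le>m. linear_coeffs u v (Suc k) * b (m - k)) = (\<Sum>k\<le>m. if k = 0 then v * b m else 0)"
    by (rule sum.cong) (auto simp: linear_coeffs_def)
  then show ?thesis unfolding Suc sum.atMost_Suc_shift by (simp add: linear_coeffs_def)
qed (simp add: linear_coeffs_def)

lemma linear_coeffs_convolution_right:
  "(\<Sum>k\<le>n. b k * linear_coeffs u v (n - k)) = b n * u + (if n = 0 then 0 else b (n - 1) * v)"
proof (cases n)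
  case (Suc m)
  have "(\<Sum>k\<le>m. b k * linear_coeffs u v (Suc m - k)) = (\<Sum>k\<le>m. if k = m then b m * v else 0)"
    by (rule sum.cong) (auto simp: linear_coeffs_def)
  then show ?thesis unfolding Suc sum.atMost_Suc by (simp add: linear_coeffs_def add.commute)
qed (simp add: linear_coeffs_def)

text \<open>\<open>star_inv\<close> is a choice, so its values on the ball must be pinned down. The
  geometric series shows that an inverse exists, and every right inverse has coefficients with b_0 =
  1 and b_n = c b_(n-1).\<close>

lemma star_inv_linear_sums:
  assumes c: "norm c < 1" and q: "q \<in> \<B>"
  shows "(\<lambda>n. q ^ n * c ^ n) sums star_inv (\<lambda>q. 1 - q * c) q"
proof -
  let ?f = "\<lambda>q. 1 - q * c"
  have f: "(\<lambda>n. q ^ n * linear_coeffs 1 (- c) n) sums ?f q" for q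
    using linear_coeffs_sums[of q 1 "- c"] by simp
  define g where "g q = (\<Sum>n. q ^ n * c ^ n)" for q
  have g: "(\<lambda>n. q ^ n * c ^ n) sums g q" if "q \<in> \<B>" for q
  proof -
    have "summable (\<lambda>n. (norm q * norm c) ^ n)"
    proof (rule summable_geometric)
      have "norm q * norm c < 1 * 1" using that c by (intro mult_strict_mono') auto
      then show "norm (norm q * norm c) < 1" by (simp add: abs_mult)
    qed
    then have "summable (\<lambda>n. q ^ n * c ^ n)"
      by (rule summable_comparison_test') (simp add: norm_mult norm_power power_mult_distrib)
    then show ?thesis unfolding g_def by (rule summable_sums)
  qed
  have one: "(\<lambda>n. q ^ n * (if n = 0 then 1 else 0)) sums 1" for q :: quat
    using sums_finite[of "{0}" "\<lambda>n. q ^ n * (if n = 0 then 1 else 0)"] by auto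
  have geo1: "1 * c ^ n + (if n = 0 then 0 else - c * c ^ (n - 1)) = (if n = 0 then 1 else 0)" for n
    by (cases n) simp_all
  have geo2: "c ^ n * 1 + (if n = 0 then 0 else c ^ (n - 1) * - c) = (if n = 0 then 1 else 0)" for n
    by (cases n) (simp_all add: power_commutes)
  have "\<exists>g. slice_regular g \<and> (\<forall>q\<in>\<B>. (?f \<star> g) q = 1 \<and> (g \<star> ?f) q = 1)"
  proof (intro exI conjI ballI)
    show "slice_regular g" by (rule slice_regular_of_sums[OF g])
    fix q :: quat assume q: "q \<in> \<B>"
    show "(?f \<star> g) q = 1"
      using star_prod_sums[OF f g q] one[of q] unfolding linear_coeffs_convolution_left geo1
      by (rule sums_unique2)
    show "(g \<star> ?f) q = 1"
      using star_prod_sums[OF g f q] one[of q] unfolding linear_coeffs_convolution_right geo2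
      by (rule sums_unique2)
  qed
  from someI_ex[OF this, folded star_inv_def]
  have h: "slice_regular (star_inv ?f)" "\<And>q. q \<in> \<B> \<Longrightarrow> (?f \<star> star_inv ?f) q = 1"
    by simp_all
  obtain b where b: "\<And>q. q \<in> \<B> \<Longrightarrow> (\<lambda>n. q ^ n * b n) sums star_inv ?f q"
    using slice_regular_sums[OF h(1)] by blast
  have "(\<lambda>n. 1 * b n + (if n = 0 then 0 else - c * b (n - 1))) = (\<lambda>n. if n = 0 then 1 else 0)"
  proof (rule slice_series_unique[where f = "\<lambda>_. 1"])
    fix x :: real assume "\<bar>x\<bar> < 1"
    then have x: "of_real x \<in> \<B>" by simp
    show "(\<lambda>n. of_real x ^ n * (1 * b n + (if n = 0 then 0 else - c * b (n - 1)))) sums 1"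
      using star_prod_sums[OF f b x] unfolding linear_coeffs_convolution_left h(2)[OF x] .
    show "(\<lambda>n. of_real x ^ n * (if n = 0 then 1 else 0 :: quat)) sums 1" by (rule one)
  qed
  then have rec: "1 * b n + (if n = 0 then 0 else - c * b (n - 1)) = (if n = 0 then 1 else 0)" for n
    by (rule fun_cong)
  have "b n = c ^ n" for n
  proof (induction n)
    case 0
    then show ?case using rec[of 0] by simp
  next
    case (Suc n)
    then show ?case using rec[of "Suc n"] by simp
  qed
  then show ?thesis using b[OF q] by simp
qed

lemma qcnj_slice_pt: "i \<in> \<S> \<Longrightarrow> qcnj (slice_pt i \<alpha>) = slice_pt i (cnj \<alpha>)"
  by (simp add: qcnj_def slice_pt_alt quat_eq_iff one_quat_def imag_units_iff)

lemma slice_moebius_sums: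
  assumes i: "i \<in> \<S>" and \<alpha>: "norm \<alpha> < 1" and q: "q \<in> \<B>"
  defines "c \<equiv> slice_pt i (cnj \<alpha>)"
  shows "(\<lambda>n. q ^ n * (c ^ n * slice_pt i \<alpha> + (if n = 0 then 0 else c ^ (n - 1) * - 1)))
    sums slice_moebius (slice_pt i \<alpha>) q"
proof -
  have c: "norm c < 1" by (simp add: c_def norm_slice_pt i \<alpha>)
  have lin: "(\<lambda>n. q ^ n * linear_coeffs (slice_pt i \<alpha>) (- 1) n) sums (slice_pt i \<alpha> - q)" for q
    using linear_coeffs_sums[of q "slice_pt i \<alpha>" "- 1"] by simp
  show ?thesis
    using star_prod_sums[OF star_inv_linear_sums[OF c] lin q]
    unfolding linear_coeffs_convolution_right slice_moebius_def qcnj_slice_pt[OF i] c_def .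
qed

lemma slice_regular_slice_moebius:
  "i \<in> \<S> \<Longrightarrow> norm \<alpha> < 1 \<Longrightarrow> slice_regular (slice_moebius (slice_pt i \<alpha>))"
  by (rule slice_regular_of_sums[OF slice_moebius_sums])

text \<open>All coefficients of the star product lie in C(i). On the slice everything commutes, and
  the series is the geometric series for 1 / (1 - \<open>cnj \<alpha>\<close> z) times \<alpha> -
  z.\<close>

lemma slice_moebius_slice_pt:
  assumes i: "i \<in> \<S>" and \<alpha>: "norm \<alpha> < 1" and z: "norm z < 1"
  shows "slice_moebius (slice_pt i \<alpha>) (slice_pt i z) = slice_pt i (disk_moebius \<alpha> z)"
proof (rule sums_unique2)
  define G where "G = 1 / (1 - cnj \<alpha> * z)"
  show "(\<lambda>n. slice_pt i z ^ n * (slice_pt i (cnj \<alpha>) ^ n * slice_pt i \<alpha>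
      + (if n = 0 then 0 else slice_pt i (cnj \<alpha>) ^ (n - 1) * - 1))) sums slice_moebius (slice_pt i \<alpha>) (slice_pt i z)"
    using i z by (intro slice_moebius_sums[OF i \<alpha>]) (simp add: norm_slice_pt)
  have "norm (z * cnj \<alpha>) < 1 * 1"
    unfolding norm_mult complex_mod_cnj using \<alpha> z by (intro mult_strict_mono') auto
  then have geo: "(\<lambda>n. (z * cnj \<alpha>) ^ n) sums G"
    using geometric_sums[of "z * cnj \<alpha>"] by (simp add: G_def mult.commute)
  have 1: "(\<lambda>n. (z * cnj \<alpha>) ^ n * \<alpha>) sums (G * \<alpha>)" by (rule sums_mult2[OF geo])
  have "(\<lambda>n. z * (z * cnj \<alpha>) ^ n) sums (z * G)" by (rule sums_mult[OF geo])
  then have 2: "(\<lambda>n. if n = 0 then 0 else z * (z * cnj \<alpha>) ^ (n - 1)) sums (z * G)"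
    using sums_Suc[of "\<lambda>n. if n = 0 then 0 else z * (z * cnj \<alpha>) ^ (n - 1)" "z * G"] by simp
  have "(\<lambda>n. slice_pt i ((z * cnj \<alpha>) ^ n * \<alpha> - (if n = 0 then 0 else z * (z * cnj \<alpha>) ^ (n - 1))))
      sums slice_pt i (G * \<alpha> - z * G)"
    by (intro bounded_linear.sums[OF bounded_linear_slice_pt[OF i]] sums_diff 1 2)
  moreover have "G * \<alpha> - z * G = disk_moebius \<alpha> z"
    by (simp add: G_def disk_moebius_def diff_divide_distrib)
  moreover have "slice_pt i ((z * cnj \<alpha>) ^ n * \<alpha> - (if n = 0 then 0 else z * (z * cnj \<alpha>) ^ (n - 1)))
      = slice_pt i z ^ n * (slice_pt i (cnj \<alpha>) ^ n * slice_pt i \<alpha>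
        + (if n = 0 then 0 else slice_pt i (cnj \<alpha>) ^ (n - 1) * - 1))" for n
  proof -
    have "(z * cnj \<alpha>) ^ n * \<alpha> - (if n = 0 then 0 else z * (z * cnj \<alpha>) ^ (n - 1))
        = z ^ n * (cnj \<alpha> ^ n * \<alpha> - (if n = 0 then 0 else cnj \<alpha> ^ (n - 1)))"
      by (cases n) (simp_all add: power_mult_distrib algebra_simps)
    moreover have "slice_pt i (z ^ n * (cnj \<alpha> ^ n * \<alpha> - (if n = 0 then 0 else cnj \<alpha> ^ (n - 1))))
        = slice_pt i z ^ n * (slice_pt i (cnj \<alpha>) ^ n * slice_pt i \<alpha>
          - (if n = 0 then 0 else slice_pt i (cnj \<alpha>) ^ (n - 1)))"
      using i by (simp add: slice_pt_mult slice_pt_power slice_pt_diff)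
    ultimately show ?thesis by simp
  qed
  ultimately show "(\<lambda>n. slice_pt i z ^ n * (slice_pt i (cnj \<alpha>) ^ n * slice_pt i \<alpha>
      + (if n = 0 then 0 else slice_pt i (cnj \<alpha>) ^ (n - 1) * - 1))) sums slice_pt i (disk_moebius \<alpha> z)"
    by (simp only:)
qed

section \<open>Besov integrals on slices\<close>

lemma powr_add_le:
  fixes x y p :: real
  assumes "0 \<le> x" "0 \<le> y" "0 < p"
  shows "(x + y) powr p \<le> 2 powr p * (x powr p + y powr p)"
proof -
  have "(x + y) powr p \<le> (2 * max x y) powr p"
    using assms by (intro powr_mono2) auto
  also have "\<dots> = 2 powr p * max x y powr p"
    using assms by (simp add: powr_mult)
  also have "max x y powr p \<le> x powr p + y powr p"
    by (simp add: max_def)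
  finally show ?thesis by simp
qed

text \<open>Measurability is asked of the cut-off only: off the ball the values of a slice regular
  function are arbitrary, and \<open>disk_measure\<close> has no mass there.\<close>

lemma nn_integral_disk_measure:
  assumes h [measurable]: "(\<lambda>z. h z * indicator (ball 0 1) z) \<in> borel_measurable borel"
  shows "(\<integral>\<^sup>+z. h z \<partial>disk_measure) = ennreal (1 / pi) *
    (\<integral>\<^sup>+z. ennreal (1 / (1 - (norm z)\<^sup>2)\<^sup>2) * (h z * indicator (ball 0 1) z) \<partial>lborel)"
proof -
  let ?U = "uniform_measure lborel (ball (0::complex) 1)"
  let ?k = "\<lambda>z::complex. ennreal (1 / (1 - (norm z)\<^sup>2)\<^sup>2)"
  let ?h = "\<lambda>z. h z * indicator (ball 0 1) z"
  have area: "emeasure lborel (ball (0::complex) 1) = ennreal pi"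
    by (simp add: emeasure_ball eval_unit_ball_vol)
  have "AE z in ?U. z \<in> ball 0 1"
    by (rule AE_uniform_measureI) auto
  then have "AE z in disk_measure. h z = ?h z"
    unfolding disk_measure_def by (subst AE_density) (auto elim!: eventually_mono)
  then have "(\<integral>\<^sup>+z. h z \<partial>disk_measure) = (\<integral>\<^sup>+z. ?h z \<partial>disk_measure)"
    by (rule nn_integral_cong_AE)
  also have "\<dots> = (\<integral>\<^sup>+z. ?k z * ?h z \<partial>?U)"
    unfolding disk_measure_def by (rule nn_integral_density) simp_all
  also have "\<dots> = (\<integral>\<^sup>+z. (?k z * ?h z) * indicator (ball 0 1) z \<partial>lborel) / emeasure lborel (ball (0::complex) 1)"
    by (rule nn_integral_uniform_measure) simp_all
  also have "(\<lambda>z. (?k z * ?h z) * indicator (ball 0 1) z) = (\<lambda>z. ?k z * ?h z)"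
    by (auto simp: fun_eq_iff split: split_indicator)
  finally show ?thesis
    unfolding area by (simp add: divide_ennreal_def inverse_ennreal mult.commute inverse_eq_divide)
qed

text \<open>For slice regular f this is pi times the slice integral of the seminorm, written over
  Lebesgue measure so that the estimates on the disk apply to it.\<close>

definition slice_energy :: "real \<Rightarrow> quat \<Rightarrow> (quat \<Rightarrow> quat) \<Rightarrow> ennreal"
  where "slice_energy p i f =
    (\<integral>\<^sup>+z. ennreal (besov_weight p z * norm (real_dir_deriv f (slice_pt i z)) powr p) \<partial>lborel)"

lemma slice_component_deriv_eqI:
  assumes f: "slice_regular f" and i: "i \<in> \<S>" and z: "norm z < 1"
    and eq: "\<And>w. norm w < 1 \<Longrightarrow> slice_proj i (f (slice_pt i w) * c) = h w"
    and h: "(h has_field_derivative d) (at z)"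
  shows "slice_component_deriv i f c z = d"
proof (rule DERIV_unique[OF _ h])
  show "(h has_field_derivative slice_component_deriv i f c z) (at z)"
    unfolding slice_component_deriv_def
    by (rule has_field_derivative_transform_within_open[OF slice_regular_component_derivative[OF f i z], of "ball 0 1"])
      (use z eq in auto)
qed

lemma measurable_besov_integrand:
  assumes "g holomorphic_on ball 0 1"
  shows "(\<lambda>z. ennreal (besov_weight p z * norm (g z) powr p)) \<in> borel_measurable borel"
proof -
  have [measurable]: "(\<lambda>z. indicator (ball 0 1) z *\<^sub>R g z) \<in> borel_measurable borel"
    using holomorphic_on_imp_continuous_on[OF assms]
    by (intro borel_measurable_continuous_on_indicator) auto
  have "(\<lambda>z. ennreal (besov_weight p z * norm (indicator (ball 0 1) z *\<^sub>R g z) powr p)) \<in> borel_measurable borel"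
    by measurable
  moreover have "besov_weight p z * norm (indicator (ball 0 1) z *\<^sub>R g z) powr p
      = besov_weight p z * norm (g z) powr p" for z
    by (simp add: besov_weight_def split: split_indicator)
  ultimately show ?thesis by (simp only:)
qed

text \<open>Slice regularity demands differentiability but no continuous derivative. Continuity
  along the slice comes from holomorphy of the two components.\<close>

lemma measurable_real_dir_deriv_slice:
  assumes f: "slice_regular f" and i: "i \<in> \<S>"
  shows "(\<lambda>z. indicator (ball 0 1) z *\<^sub>R real_dir_deriv f (slice_pt i z)) \<in> borel_measurable borel"
proof (rule borel_measurable_continuous_on_indicator)
  obtain j where j: "\<And>q. q = slice_pt i (slice_proj i q) - slice_pt i (slice_proj i (q * j)) * j"
    using slice_splitting[OF i] by metis
  have cont: "continuous_on (ball 0 1) (\<lambda>z. slice_pt i (slice_component_deriv i f c z))" for c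
    by (rule bounded_linear.continuous_on[OF bounded_linear_slice_pt[OF i]])
      (rule holomorphic_on_imp_continuous_on[OF slice_component_deriv_holomorphic[OF f i]])
  have "continuous_on (ball 0 1) (\<lambda>z. slice_pt i (slice_component_deriv i f 1 z)
      - slice_pt i (slice_component_deriv i f j z) * j)"
    by (intro continuous_intros cont)
  moreover have "slice_pt i (slice_component_deriv i f 1 z) - slice_pt i (slice_component_deriv i f j z) * j
      = real_dir_deriv f (slice_pt i z)" for z
    using j[of "real_dir_deriv f (slice_pt i z)"] by (simp add: slice_component_deriv_def)
  ultimately show "continuous_on (ball 0 1) (\<lambda>z. real_dir_deriv f (slice_pt i z))" by simp
qed simp

lemma measurable_slice_energy:
  assumes f: "slice_regular f" and i: "i \<in> \<S>"
  shows "(\<lambda>z. ennreal (besov_weight p z * norm (real_dir_deriv f (slice_pt i z)) powr p)) \<in> borel_measurable borel"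
proof -
  note [measurable] = measurable_real_dir_deriv_slice[OF assms]
  have "(\<lambda>z. ennreal (besov_weight p z * norm (indicator (ball 0 1) z *\<^sub>R real_dir_deriv f (slice_pt i z)) powr p))
      \<in> borel_measurable borel"
    by measurable
  moreover have "besov_weight p z * norm (indicator (ball 0 1) z *\<^sub>R real_dir_deriv f (slice_pt i z)) powr p
      = besov_weight p z * norm (real_dir_deriv f (slice_pt i z)) powr p" for z
    by (simp add: besov_weight_def split: split_indicator)
  ultimately show ?thesis by (simp only:)
qed

lemma besov_slice_integral_eq:
  assumes f: "slice_regular f" and i: "i \<in> \<S>"
  shows "besov_slice_integral p i f = ennreal (1 / pi) * slice_energy p i f"
proof -
  let ?h = "\<lambda>z. ennreal (norm ((1 - (norm z)\<^sup>2) *\<^sub>R real_dir_deriv f (slice_pt i z)) powr p)"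
  have [measurable]: "ball (0::complex) 1 \<in> sets borel" by simp
  note [measurable] = measurable_real_dir_deriv_slice[OF assms]
  have "(\<lambda>z. ennreal (norm ((1 - (norm z)\<^sup>2) *\<^sub>R (indicator (ball 0 1) z *\<^sub>R real_dir_deriv f (slice_pt i z))) powr p)
      * indicator (ball 0 1) z) \<in> borel_measurable borel"
    by measurable
  moreover have "ennreal (norm ((1 - (norm z)\<^sup>2) *\<^sub>R (indicator (ball 0 1) z *\<^sub>R real_dir_deriv f (slice_pt i z))) powr p)
      * indicator (ball 0 1) z = ?h z * indicator (ball 0 1) z" for z
    by (simp split: split_indicator)
  ultimately have m: "(\<lambda>z. ?h z * indicator (ball 0 1) z) \<in> borel_measurable borel"
    by (simp only:)
  have "besov_slice_integral p i f = (\<integral>\<^sup>+z. ?h z \<partial>disk_measure)"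
    by (simp add: besov_slice_integral_def norm_slice_pt[OF i])
  also have "\<dots> = ennreal (1 / pi) *
    (\<integral>\<^sup>+z. ennreal (1 / (1 - (norm z)\<^sup>2)\<^sup>2) * (?h z * indicator (ball 0 1) z) \<partial>lborel)"
    by (rule nn_integral_disk_measure[OF m])
  also have "(\<lambda>z. ennreal (1 / (1 - (norm z)\<^sup>2)\<^sup>2) * (?h z * indicator (ball 0 1) z))
      = (\<lambda>z. ennreal (besov_weight p z * norm (real_dir_deriv f (slice_pt i z)) powr p))"
  proof
    fix z
    show "ennreal (1 / (1 - (norm z)\<^sup>2)\<^sup>2) * (?h z * indicator (ball 0 1) z)
        = ennreal (besov_weight p z * norm (real_dir_deriv f (slice_pt i z)) powr p)"
    proof (cases "norm z < 1")
      case True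
      let ?t = "1 - (norm z)\<^sup>2" and ?n = "norm (real_dir_deriv f (slice_pt i z))"
      have t: "0 < ?t" using True by (simp add: abs_square_less_1)
      have "(1 / ?t\<^sup>2) * norm (?t *\<^sub>R real_dir_deriv f (slice_pt i z)) powr p = ?t powr (p - 2) * ?n powr p"
        using t by (simp add: powr_mult powr_diff powr_numeral)
      then show ?thesis
        using True by (simp add: besov_weight_def flip: ennreal_mult)
    qed (simp add: besov_weight_eq_0)
  qed
  finally show ?thesis by (simp add: slice_energy_def)
qed

lemma slice_energy_eq:
  assumes "slice_regular f" "i \<in> \<S>"
  shows "slice_energy p i f = ennreal pi * besov_slice_integral p i f"
  unfolding besov_slice_integral_eq[OF assms]
  by (simp add: mult.assoc[symmetric] flip: ennreal_mult)

section \<open>Comparison of components, slices and the supremum over slices\<close>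

lemma besov_integral_component_le:
  assumes p: "0 < p" and i: "i \<in> \<S>" and c: "norm c \<le> 1"
  shows "besov_integral p (slice_component_deriv i f c) \<le> slice_energy p i f"
  unfolding besov_integral_def slice_energy_def
proof (intro nn_integral_mono ennreal_leI mult_left_mono powr_mono2)
  fix z
  have "norm (slice_component_deriv i f c z) \<le> norm (real_dir_deriv f (slice_pt i z) * c)"
    unfolding slice_component_deriv_def by (rule norm_slice_proj_le[OF i])
  also have "\<dots> \<le> norm (real_dir_deriv f (slice_pt i z))"
    unfolding norm_mult using c by (intro mult_left_le) auto
  finally show "norm (slice_component_deriv i f c z) \<le> norm (real_dir_deriv f (slice_pt i z))" .
qed (use p in auto)

lemma slice_energy_le_components:
  assumes p: "0 < p" and f: "slice_regular f" and i: "i \<in> \<S>" and j: "norm j = 1"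
    and split: "\<And>q. q = slice_pt i (slice_proj i q) - slice_pt i (slice_proj i (q * j)) * j"
  shows "slice_energy p i f \<le> ennreal (2 powr p) *
    (besov_integral p (slice_component_deriv i f 1) + besov_integral p (slice_component_deriv i f j))"
proof -
  let ?N = "\<lambda>c z. besov_weight p z * norm (slice_component_deriv i f c z) powr p"
  note [measurable] = measurable_besov_integrand[OF slice_component_deriv_holomorphic[OF f i]]
  have "slice_energy p i f \<le> (\<integral>\<^sup>+z. ennreal (2 powr p) * (ennreal (?N 1 z) + ennreal (?N j z)) \<partial>lborel)"
    unfolding slice_energy_def
  proof (rule nn_integral_mono)
    fix z
    let ?d = "real_dir_deriv f (slice_pt i z)"
    have "norm ?d \<le> norm (slice_pt i (slice_proj i ?d)) + norm (slice_pt i (slice_proj i (?d * j)) * j)"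
      by (subst split) (rule norm_triangle_ineq4)
    then have "norm ?d \<le> norm (slice_component_deriv i f 1 z) + norm (slice_component_deriv i f j z)"
      by (simp add: slice_component_deriv_def norm_mult norm_slice_pt[OF i] j)
    then have "norm ?d powr p \<le> (norm (slice_component_deriv i f 1 z) + norm (slice_component_deriv i f j z)) powr p"
      using p by (intro powr_mono2) auto
    also have "\<dots> \<le> 2 powr p * (norm (slice_component_deriv i f 1 z) powr p + norm (slice_component_deriv i f j z) powr p)"
      by (rule powr_add_le) (use p in auto)
    finally have "besov_weight p z * norm ?d powr p
        \<le> besov_weight p z * (2 powr p * (norm (slice_component_deriv i f 1 z) powr p + norm (slice_component_deriv i f j z) powr p))"
      by (rule mult_left_mono) simp
    also have "\<dots> = 2 powr p * (?N 1 z + ?N j z)" by (simp add: algebra_simps)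
    finally show "ennreal (besov_weight p z * norm ?d powr p) \<le> ennreal (2 powr p) * (ennreal (?N 1 z) + ennreal (?N j z))"
      by (simp add: ennreal_leI flip: ennreal_plus ennreal_mult)
  qed
  also have "\<dots> = ennreal (2 powr p) * (\<integral>\<^sup>+z. ennreal (?N 1 z) + ennreal (?N j z) \<partial>lborel)"
    by (rule nn_integral_cmult) measurable
  also have "(\<integral>\<^sup>+z. ennreal (?N 1 z) + ennreal (?N j z) \<partial>lborel)
      = besov_integral p (slice_component_deriv i f 1) + besov_integral p (slice_component_deriv i f j)"
    unfolding besov_integral_def by (rule nn_integral_add) measurable
  finally show ?thesis .
qed

text \<open>The representation formula bounds the derivative on J by its values at \<open>z\<close>
  and \<open>cnj z\<close> on i. Weight and measure are invariant under conjugation, so both terms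
  have the same integral, which gives the factor 2.\<close>

lemma slice_energy_le_other_slice:
  assumes p: "0 < p" and f: "slice_regular f" and i: "i \<in> \<S>" and J: "J \<in> \<S>"
  shows "slice_energy p J f \<le> ennreal (2 powr p * 2) * slice_energy p i f"
proof -
  let ?d = "\<lambda>z. real_dir_deriv f (slice_pt i z)"
  let ?u = "\<lambda>z. ennreal (besov_weight p z * norm (?d z) powr p)"
  have u [measurable]: "?u \<in> borel_measurable borel" by (rule measurable_slice_energy[OF f i])
  have u' [measurable]: "(\<lambda>z. ?u (cnj z)) \<in> borel_measurable borel"
    by (rule measurable_compose[OF measurable_cnj u])
  obtain a where a: "\<And>q. q \<in> \<B> \<Longrightarrow> (\<lambda>n. q ^ n * a n) sums real_dir_deriv f q"
    using real_dir_deriv_sums[OF f] by blast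
  have "slice_energy p J f \<le> (\<integral>\<^sup>+z. ennreal (2 powr p) * (?u z + ?u (cnj z)) \<partial>lborel)"
    unfolding slice_energy_def
  proof (rule nn_integral_mono)
    fix z
    show "ennreal (besov_weight p z * norm (real_dir_deriv f (slice_pt J z)) powr p)
        \<le> ennreal (2 powr p) * (?u z + ?u (cnj z))"
    proof (cases "norm z < 1")
      case True
      have "norm (real_dir_deriv f (slice_pt J z)) powr p \<le> (norm (?d z) + norm (?d (cnj z))) powr p"
        using norm_slice_series_le[OF a i J True] p by (intro powr_mono2) auto
      also have "\<dots> \<le> 2 powr p * (norm (?d z) powr p + norm (?d (cnj z)) powr p)"
        by (rule powr_add_le) (use p in auto)
      finally have "besov_weight p z * norm (real_dir_deriv f (slice_pt J z)) powr p
          \<le> besov_weight p z * (2 powr p * (norm (?d z) powr p + norm (?d (cnj z)) powr p))"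
        by (rule mult_left_mono) simp
      also have "\<dots> = 2 powr p * (besov_weight p z * norm (?d z) powr p + besov_weight p (cnj z) * norm (?d (cnj z)) powr p)"
        by (simp add: algebra_simps besov_weight_def indicator_def)
      finally show ?thesis by (simp add: ennreal_leI flip: ennreal_plus ennreal_mult)
    qed (simp add: besov_weight_eq_0)
  qed
  also have "\<dots> = ennreal (2 powr p) * (\<integral>\<^sup>+z. ?u z + ?u (cnj z) \<partial>lborel)"
    by (rule nn_integral_cmult) measurable
  also have "(\<integral>\<^sup>+z. ?u z + ?u (cnj z) \<partial>lborel) = (\<integral>\<^sup>+z. ?u z \<partial>lborel) + (\<integral>\<^sup>+z. ?u (cnj z) \<partial>lborel)"
    by (rule nn_integral_add) measurable
  also have "(\<integral>\<^sup>+z. ?u (cnj z) \<partial>lborel) = (\<integral>\<^sup>+z. ?u z \<partial>lborel)"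
    by (rule nn_integral_lborel_cnj[OF u])
  finally have "slice_energy p J f \<le> ennreal (2 powr p) * (slice_energy p i f + slice_energy p i f)"
    by (simp only: slice_energy_def)
  also have "slice_energy p i f + slice_energy p i f = ennreal 2 * slice_energy p i f"
    by (simp add: mult_2)
  finally show ?thesis by (simp add: mult.assoc ennreal_mult)
qed

lemma besov_sup_le:
  assumes p: "0 < p" and f: "slice_regular f" and i: "i \<in> \<S>"
  shows "besov_sup p f \<le> ennreal (2 powr p * 2 / pi) * slice_energy p i f"
  unfolding besov_sup_def
proof (rule SUP_least)
  fix J assume J: "J \<in> \<S>"
  have "besov_slice_integral p J f \<le> ennreal (1 / pi) * (ennreal (2 powr p * 2) * slice_energy p i f)"
    unfolding besov_slice_integral_eq[OF f J]
    by (intro mult_left_mono slice_energy_le_other_slice[OF p f i J]) simp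
  then show "besov_slice_integral p J f \<le> ennreal (2 powr p * 2 / pi) * slice_energy p i f"
    by (simp add: mult.assoc[symmetric] flip: ennreal_mult)
qed

lemma slice_energy_le_besov_sup:
  assumes "slice_regular f" "i \<in> \<S>"
  shows "slice_energy p i f \<le> ennreal pi * besov_sup p f"
  unfolding slice_energy_eq[OF assms] besov_sup_def
  by (intro mult_left_mono SUP_upper assms) simp

section \<open>Boundedness of composition operators\<close>

lemma ennreal_root_le_mult:
  assumes p: "0 < p" and c: "0 \<le> c" and le: "x \<le> ennreal c * y" and y: "y < \<infinity>"
  shows "ennreal_root p x \<le> ennreal (c powr (1 / p)) * ennreal_root p y"
proof -
  obtain r where r: "y = ennreal r" "0 \<le> r" using y by (cases y) auto
  have "x \<le> ennreal (c * r)" using le r c by (simp add: ennreal_mult)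
  moreover obtain s where s: "x = ennreal s" "0 \<le> s"
    using calculation by (cases x) (auto simp: top_unique)
  ultimately have "s \<le> c * r" using r c by (simp add: ennreal_le_iff)
  then have "s powr (1 / p) \<le> (c * r) powr (1 / p)" using p s by (intro powr_mono2) auto
  then have "ennreal (s powr (1 / p)) \<le> ennreal (c powr (1 / p)) * ennreal (r powr (1 / p))"
    using c r by (simp add: powr_mult ennreal_leI flip: ennreal_mult)
  then show ?thesis using r s by (simp add: ennreal_root_def)
qed

lemma le_powr_of_ennreal_root_le:
  assumes p: "0 < p" and s: "0 \<le> s" and le: "ennreal_root p x \<le> ennreal s"
  shows "x \<le> ennreal (s powr p)"
proof (cases x)
  case (real r)
  then have "r powr (1 / p) \<le> s" using le s by (simp add: ennreal_root_def ennreal_le_iff)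
  then have "(r powr (1 / p)) powr p \<le> s powr p" using p by (intro powr_mono2) auto
  then show ?thesis using real p by (simp add: powr_powr ennreal_leI)
next
  case top
  then show ?thesis using le by (simp add: ennreal_root_def top_unique)
qed

lemma norm_slice_splitting_le:
  assumes i: "i \<in> \<S>" and j: "norm j = 1"
    and split: "q = slice_pt i (slice_proj i q) - slice_pt i (slice_proj i (q * j)) * j"
  shows "norm q \<le> norm (slice_proj i q) + norm (slice_proj i (q * j))"
proof -
  have "norm q \<le> norm (slice_pt i (slice_proj i q)) + norm (slice_pt i (slice_proj i (q * j)) * j)"
    by (subst split) (rule norm_triangle_ineq4)
  then show ?thesis by (simp add: norm_mult norm_slice_pt[OF i] j)
qed

text \<open>The pointwise bound controls the component derivatives on the closed disk of radius |w|,
  and integrating from 0 to w bounds f(w) - f(0). The factor 2 counts the components, and the 1 / pi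
  of the pointwise bound cancels the pi of the area normalization.\<close>

lemma besov_point_evaluation:
  assumes p: "1 < p" and f: "f \<in> besov p" and i: "i \<in> \<S>" and w: "norm w < 1"
  shows "ennreal (norm (f (slice_pt i w))) \<le> ennreal (norm (f 0)) +
    ennreal (2 * (5 powr (2 * p) / (1 - norm w) powr (2 * p)) powr (1 / p)) * ennreal_root p (besov_sup p f)"
proof -
  have reg: "slice_regular f" and fin: "besov_sup p f < \<infinity>" using f by (auto simp: besov_def)
  obtain s where s: "besov_sup p f = ennreal s" "0 \<le> s" using fin by (cases "besov_sup p f") auto
  obtain j where j: "j \<in> \<S>" and split: "\<And>q. q = slice_pt i (slice_proj i q) - slice_pt i (slice_proj i (q * j)) * j"
    using slice_splitting[OF i] by metis
  define c0 where "c0 = 5 powr (2 * p) / (1 - norm w) powr (2 * p)"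
  define L where "L = (c0 * s) powr (1 / p)"
  have c0: "0 \<le> c0" by (simp add: c0_def)
  have deriv_le: "norm (slice_component_deriv i f c v) \<le> L" if c: "norm c \<le> 1" and v: "norm v \<le> norm w" for c v
  proof -
    have "ennreal (norm (slice_component_deriv i f c v) powr p)
        \<le> ennreal (5 powr (2 * p) / pi / (1 - norm v) powr (2 * p)) * besov_integral p (slice_component_deriv i f c)"
      using v w by (intro powr_le_besov_integral[OF p] slice_component_deriv_holomorphic[OF reg i]) simp
    also have "\<dots> \<le> ennreal (c0 / pi) * (ennreal pi * besov_sup p f)"
    proof (rule mult_mono)
      have "5 powr (2 * p) / (1 - norm v) powr (2 * p) \<le> c0"
        unfolding c0_def using v w p by (intro divide_left_mono powr_mono2 mult_pos_pos) auto
      then show "ennreal (5 powr (2 * p) / pi / (1 - norm v) powr (2 * p)) \<le> ennreal (c0 / pi)"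
        by (intro ennreal_leI) (simp add: field_simps)
      show "besov_integral p (slice_component_deriv i f c) \<le> ennreal pi * besov_sup p f"
        by (rule order_trans[OF besov_integral_component_le[OF _ i c] slice_energy_le_besov_sup[OF reg i]])
          (use p in simp)
    qed auto
    also have "\<dots> = ennreal (c0 * s)"
      using s c0 by (simp flip: ennreal_mult)
    finally have "norm (slice_component_deriv i f c v) powr p \<le> c0 * s"
      using c0 s by (simp add: ennreal_le_iff)
    then have "(norm (slice_component_deriv i f c v) powr p) powr (1 / p) \<le> L"
      unfolding L_def using p by (intro powr_mono2) auto
    then show ?thesis using p by (simp add: powr_powr)
  qed
  let ?d = "f (slice_pt i w) - f 0"
  have comp_le: "norm (slice_proj i (?d * c)) \<le> L" if c: "norm c \<le> 1" for c
  proof -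
    let ?A = "\<lambda>z. slice_proj i (f (slice_pt i z) * c)"
    have "norm (?A w - ?A 0) \<le> L * norm (w - 0)"
    proof (rule field_differentiable_bound[where f = ?A and S = "cball 0 (norm w)"])
      show "(?A has_field_derivative slice_component_deriv i f c v) (at v within cball 0 (norm w))"
        if "v \<in> cball 0 (norm w)" for v
        unfolding slice_component_deriv_def using that w
        by (intro has_field_derivative_at_within[OF slice_regular_component_derivative[OF reg i]]) simp
      show "norm (slice_component_deriv i f c v) \<le> L" if "v \<in> cball 0 (norm w)" for v
        using that by (intro deriv_le[OF c]) simp
    qed auto
    also have "\<dots> \<le> L" using w by (simp add: L_def mult_left_le)
    finally show ?thesis by (simp add: left_diff_distrib slice_proj_diff)
  qed
  have "norm (slice_proj i ?d) \<le> L" using comp_le[of 1] by simp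
  moreover have "norm (slice_proj i (?d * j)) \<le> L"
    by (rule comp_le) (simp add: norm_imag_unit[OF j])
  ultimately have "norm ?d \<le> 2 * L"
    using norm_slice_splitting_le[OF i norm_imag_unit[OF j] split, of ?d] by simp
  then have "norm (f (slice_pt i w)) \<le> norm (f 0) + 2 * L"
    using norm_triangle_ineq2[of "f (slice_pt i w)" "f 0"] by simp
  then have "ennreal (norm (f (slice_pt i w))) \<le> ennreal (norm (f 0) + 2 * L)"
    by (rule ennreal_leI)
  also have "\<dots> = ennreal (norm (f 0)) + ennreal (2 * c0 powr (1 / p)) * ennreal (s powr (1 / p))"
    using c0 s by (simp add: L_def powr_mult mult.assoc flip: ennreal_mult ennreal_plus)
  finally show ?thesis
    using s by (simp add: ennreal_root_def c0_def)
qed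

lemma slice_moebius_component_deriv:
  assumes i: "i \<in> \<S>" and \<alpha>: "norm \<alpha> < 1" and z: "norm z < 1"
  shows "slice_component_deriv i (slice_moebius (slice_pt i \<alpha>)) c z = deriv (disk_moebius \<alpha>) z * slice_proj i c"
proof (rule slice_component_deriv_eqI[OF slice_regular_slice_moebius[OF i \<alpha>] i z])
  show "slice_proj i (slice_moebius (slice_pt i \<alpha>) (slice_pt i w) * c) = disk_moebius \<alpha> w * slice_proj i c"
    if "norm w < 1" for w
    by (simp add: slice_moebius_slice_pt[OF i \<alpha> that] slice_proj_mult[OF i])
  have "(disk_moebius \<alpha> has_field_derivative deriv (disk_moebius \<alpha>) z) (at z)"
    using has_field_derivative_disk_moebius[OF \<alpha> z] DERIV_imp_deriv by metis
  then show "((\<lambda>w. disk_moebius \<alpha> w * slice_proj i c) has_field_derivative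
      deriv (disk_moebius \<alpha>) z * slice_proj i c) (at z)"
    by (rule DERIV_cmult_right)
qed

text \<open>By Moebius invariance the energy of each component is at most the total mass W of the
  weight, whatever a is; and |\<sigma>_a 0| = |a| < 1.\<close>

lemma slice_moebius_besov_bounded:
  assumes p: "1 < p" and i: "i \<in> \<S>"
  obtains V :: real where "\<And>a. a \<in> slice_ball i \<Longrightarrow> slice_moebius a \<in> besov p \<and> besov_norm p (slice_moebius a) \<le> ennreal V"
proof -
  obtain W where W: "(\<integral>\<^sup>+z. ennreal (besov_weight p z) \<partial>lborel) = ennreal W" "0 \<le> W"
    using besov_weight_integral_finite[OF p] by (cases "\<integral>\<^sup>+z. ennreal (besov_weight p z) \<partial>lborel") auto
  obtain j where j: "j \<in> \<S>" and split: "\<And>q. q = slice_pt i (slice_proj i q) - slice_pt i (slice_proj i (q * j)) * j"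
    using slice_splitting[OF i] by metis
  \<comment> \<open>The first factor passes from slice i to all slices, the second recombines the
    two components, each of energy at most W.\<close>
  define V where "V = (2 powr p * 2 / pi) * (2 powr p * (W + W))"
  have V0: "0 \<le> V" using W by (simp add: V_def)
  have "slice_moebius a \<in> besov p \<and> besov_norm p (slice_moebius a) \<le> ennreal (1 + V powr (1 / p))"
    if a: "a \<in> slice_ball i" for a
  proof -
    obtain \<alpha> where \<alpha>: "a = slice_pt i \<alpha>" "norm \<alpha> < 1"
      using a by (auto simp: slice_ball_eq[OF i])
    let ?\<sigma> = "slice_moebius a"
    have reg: "slice_regular ?\<sigma>" unfolding \<alpha>(1) by (rule slice_regular_slice_moebius[OF i \<alpha>(2)])
    have comp: "besov_integral p (slice_component_deriv i ?\<sigma> c) \<le> ennreal W" if c: "norm c \<le> 1" for c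
    proof -
      have "besov_integral p (slice_component_deriv i ?\<sigma> c) \<le> besov_integral p (deriv (disk_moebius \<alpha>))"
        unfolding besov_integral_def
      proof (intro nn_integral_mono ennreal_leI)
        fix z
        show "besov_weight p z * norm (slice_component_deriv i ?\<sigma> c z) powr p
            \<le> besov_weight p z * norm (deriv (disk_moebius \<alpha>) z) powr p"
        proof (cases "norm z < 1")
          case True
          have "norm (slice_proj i c) \<le> 1" using norm_slice_proj_le[OF i, of c] c by simp
          then have "norm (slice_component_deriv i ?\<sigma> c z) \<le> norm (deriv (disk_moebius \<alpha>) z)"
            unfolding \<alpha>(1) slice_moebius_component_deriv[OF i \<alpha>(2) True] norm_mult
            by (intro mult_left_le) auto
          then show ?thesis using p by (intro mult_left_mono powr_mono2) auto
        qed (simp add: besov_weight_eq_0)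
      qed
      also have "\<dots> = ennreal W" unfolding besov_integral_disk_moebius[OF p \<alpha>(2)] by (rule W)
      finally show ?thesis .
    qed
    have "besov_sup p ?\<sigma> \<le> ennreal (2 powr p * 2 / pi) * slice_energy p i ?\<sigma>"
      using p by (intro besov_sup_le[OF _ reg i]) simp
    also have "\<dots> \<le> ennreal (2 powr p * 2 / pi) * (ennreal (2 powr p) * (ennreal W + ennreal W))"
    proof (rule mult_left_mono)
      have "slice_energy p i ?\<sigma> \<le> ennreal (2 powr p) *
          (besov_integral p (slice_component_deriv i ?\<sigma> 1) + besov_integral p (slice_component_deriv i ?\<sigma> j))"
        using p by (intro slice_energy_le_components[OF _ reg i norm_imag_unit[OF j] split]) simp
      also have "\<dots> \<le> ennreal (2 powr p) * (ennreal W + ennreal W)"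
        by (intro mult_left_mono add_mono comp) (simp_all add: norm_imag_unit[OF j])
      finally show "slice_energy p i ?\<sigma> \<le> ennreal (2 powr p) * (ennreal W + ennreal W)" .
    qed simp
    also have "\<dots> = ennreal V * 1"
      using W by (simp add: V_def flip: ennreal_mult ennreal_plus)
    finally have sup: "besov_sup p ?\<sigma> \<le> ennreal V * 1" .
    then have "besov_sup p ?\<sigma> < \<infinity>" by (simp add: le_less_trans)
    then have mem: "?\<sigma> \<in> besov p" using reg by (simp add: besov_def)
    have "ennreal_root p (besov_sup p ?\<sigma>) \<le> ennreal (V powr (1 / p)) * ennreal_root p 1"
      using p by (intro ennreal_root_le_mult[OF _ V0 sup]) auto
    then have root: "ennreal_root p (besov_sup p ?\<sigma>) \<le> ennreal (V powr (1 / p))"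
      by (simp add: ennreal_root_def)
    have "?\<sigma> 0 = slice_pt i \<alpha>"
      using slice_moebius_slice_pt[OF i \<alpha>(2), of 0] by (simp add: \<alpha>(1) disk_moebius_def)
    then have "norm (?\<sigma> 0) \<le> 1" using \<alpha>(2) by (simp add: norm_slice_pt[OF i])
    then have "ennreal (norm (?\<sigma> 0)) \<le> ennreal 1" by (rule ennreal_leI)
    then have "besov_norm p ?\<sigma> \<le> ennreal 1 + ennreal (V powr (1 / p))"
      unfolding besov_norm_def using root by (rule add_mono)
    also have "\<dots> = ennreal (1 + V powr (1 / p))"
      by (rule ennreal_plus[symmetric]) auto
    finally show ?thesis using mem by simp
  qed
  then show ?thesis by (rule that)
qed

section \<open>Composition with a slice regular map preserving the slice\<close>

locale slice_self_map =
  fixes i :: quat and \<Phi> :: "quat \<Rightarrow> quat"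
  assumes unit: "i \<in> \<S>" and regular: "slice_regular \<Phi>"
    and maps: "\<Phi> ` slice_ball i \<subseteq> slice_ball i"
begin

text \<open>The map \<phi> of the overview. The value 0 off the disk makes it measurable on the
  whole plane with values in the unit disk, as the Carleson estimate demands.\<close>

definition trace :: "complex \<Rightarrow> complex"
  where "trace z = (if norm z < 1 then slice_proj i (\<Phi> (slice_pt i z)) else 0)"

lemma \<Phi>_slice_pt:
  assumes "norm z < 1"
  shows "\<Phi> (slice_pt i z) = slice_pt i (trace z)" "norm (trace z) < 1"
proof -
  have "slice_pt i z \<in> slice_ball i" using assms by (auto simp: slice_ball_eq[OF unit])
  then have "\<Phi> (slice_pt i z) \<in> slice_pt i ` ball 0 1"
    using maps unfolding slice_ball_eq[OF unit] by blast
  then obtain w where "\<Phi> (slice_pt i z) = slice_pt i w" "norm w < 1" by auto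
  then show "\<Phi> (slice_pt i z) = slice_pt i (trace z)" "norm (trace z) < 1"
    using assms unit by (auto simp: trace_def)
qed

lemma norm_trace: "norm (trace z) < 1"
  using \<Phi>_slice_pt(2)[of z] by (cases "norm z < 1") (auto simp: trace_def)

lemma trace_holomorphic: "trace holomorphic_on ball 0 1"
  using slice_regular_component_holomorphic[OF regular unit, of 1]
  by (rule holomorphic_transform) (simp add: trace_def)

lemma measurable_trace: "trace \<in> borel_measurable borel"
proof -
  have "(\<lambda>z. indicator (ball 0 1) z *\<^sub>R trace z) \<in> borel_measurable borel"
    using holomorphic_on_imp_continuous_on[OF trace_holomorphic]
    by (intro borel_measurable_continuous_on_indicator) auto
  moreover have "(\<lambda>z. indicator (ball 0 1) z *\<^sub>R trace z) = trace"
    by (auto simp: trace_def fun_eq_iff split: split_indicator)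
  ultimately show ?thesis by simp
qed

lemma comp_sums:
  assumes f: "slice_regular f"
  obtains a where "\<And>z. norm z < 1 \<Longrightarrow> (\<lambda>n. slice_pt i z ^ n * a n) sums f (\<Phi> (slice_pt i z))"
proof -
  obtain j where split: "\<And>q. q = slice_pt i (slice_proj i q) - slice_pt i (slice_proj i (q * j)) * j"
    using slice_splitting[OF unit] by metis
  have hol: "((\<lambda>z. slice_proj i (f (slice_pt i z) * c)) \<circ> trace) holomorphic_on ball 0 1" for c
    by (rule holomorphic_on_compose_gen[OF trace_holomorphic slice_regular_component_holomorphic[OF f unit]])
      (use norm_trace in auto)
  obtain a where a: "\<And>z. norm z < 1 \<Longrightarrow> (\<lambda>n. slice_pt i z ^ n * a n) sums
      (slice_pt i (((\<lambda>z. slice_proj i (f (slice_pt i z) * 1)) \<circ> trace) z)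
        - slice_pt i (((\<lambda>z. slice_proj i (f (slice_pt i z) * j)) \<circ> trace) z) * j)"
    using slice_sums_of_holomorphic[OF unit hol[of 1] hol[of j], of j] by blast
  have "(\<lambda>n. slice_pt i z ^ n * a n) sums f (\<Phi> (slice_pt i z))" if "norm z < 1" for z
    using a[OF that] split[of "f (slice_pt i (trace z))"] \<Phi>_slice_pt(1)[OF that] by simp
  then show ?thesis by (rule that)
qed

lemma
  assumes f: "slice_regular f"
  shows slice_regular_comp: "slice_regular (slice_comp i \<Phi> f)"
    and slice_comp_slice_pt: "\<And>z. norm z < 1 \<Longrightarrow> slice_comp i \<Phi> f (slice_pt i z) = f (slice_pt i (trace z))"
proof -
  obtain a where a: "\<And>z. norm z < 1 \<Longrightarrow> (\<lambda>n. slice_pt i z ^ n * a n) sums f (\<Phi> (slice_pt i z))"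
    using comp_sums[OF f] by blast
  note sums = slice_comp_sums[where \<Phi> = \<Phi> and f = f and a = a, OF unit a]
  show "slice_regular (slice_comp i \<Phi> f)" by (rule slice_regular_of_sums[OF sums])
  fix z :: complex assume z: "norm z < 1"
  have "(\<lambda>n. slice_pt i z ^ n * a n) sums slice_comp i \<Phi> f (slice_pt i z)"
    using z by (intro sums) (simp_all add: norm_slice_pt[OF unit])
  from sums_unique2[OF this a[OF z]]
  show "slice_comp i \<Phi> f (slice_pt i z) = f (slice_pt i (trace z))"
    by (simp add: \<Phi>_slice_pt(1)[OF z])
qed

lemma slice_comp_component_deriv:
  assumes f: "slice_regular f" and z: "norm z < 1"
  shows "slice_component_deriv i (slice_comp i \<Phi> f) c z = slice_component_deriv i f c (trace z) * deriv trace z"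
proof (rule slice_component_deriv_eqI[OF slice_regular_comp[OF f] unit z])
  show "slice_proj i (slice_comp i \<Phi> f (slice_pt i w) * c) = slice_proj i (f (slice_pt i (trace w)) * c)"
    if "norm w < 1" for w
    by (simp add: slice_comp_slice_pt[OF f that])
  have "(trace has_field_derivative deriv trace z) (at z)"
    using z by (intro holomorphic_derivI[OF trace_holomorphic]) auto
  from DERIV_chain2[OF slice_regular_component_derivative[OF f unit norm_trace, of c z] this]
  show "((\<lambda>w. slice_proj i (f (slice_pt i (trace w)) * c)) has_field_derivative
      slice_component_deriv i f c (trace z) * deriv trace z) (at z)"
    by (simp add: slice_component_deriv_def)
qed

text \<open>The Carleson estimate is applied to each component with \<psi> the derivative of
  \<open>trace\<close>. The constant collects the passage to all slices, the recombination of two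
  components, and 5^(2p) m pi from the Carleson estimate and the area normalizations.\<close>

lemma besov_sup_comp_le:
  assumes p: "1 < p" and f: "slice_regular f" and m: "0 \<le> m"
    and M: "\<And>a. a \<in> slice_ball i \<Longrightarrow> besov_sup p (slice_comp i \<Phi> (slice_moebius a)) \<le> ennreal m"
  shows "besov_sup p (slice_comp i \<Phi> f)
    \<le> ennreal ((2 powr p * 2 / pi) * (2 powr p * (2 * (5 powr (2 * p) * m * pi)))) * besov_sup p f"
proof -
  let ?T = "slice_comp i \<Phi>"
  let ?\<psi> = "\<lambda>z. indicator (ball 0 1) z *\<^sub>R deriv trace z"
  have reg: "slice_regular (?T f)" by (rule slice_regular_comp[OF f])
  have p0: "0 < p" using p by simp
  obtain j where j: "j \<in> \<S>" and split: "\<And>q. q = slice_pt i (slice_proj i q) - slice_pt i (slice_proj i (q * j)) * j"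
    using slice_splitting[OF unit] by metis
  have \<psi>_meas: "?\<psi> \<in> borel_measurable borel"
    by (intro borel_measurable_continuous_on_indicator holomorphic_on_imp_continuous_on
        holomorphic_deriv trace_holomorphic) auto
  \<comment> \<open>The component c = 1 of \<sigma>_a is \<open>disk_moebius \<alpha>\<close>
    itself, so by the chain rule the bound \<open>M\<close> becomes the Carleson hypothesis.\<close>
  have test: "besov_integral p (\<lambda>z. deriv (disk_moebius \<alpha>) (trace z) * ?\<psi> z) \<le> ennreal (pi * m)"
    if \<alpha>: "norm \<alpha> < 1" for \<alpha>
  proof -
    let ?\<sigma> = "slice_moebius (slice_pt i \<alpha>)"
    have \<sigma>: "slice_regular ?\<sigma>" by (rule slice_regular_slice_moebius[OF unit \<alpha>])
    have "besov_integral p (\<lambda>z. deriv (disk_moebius \<alpha>) (trace z) * ?\<psi> z)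
        = besov_integral p (slice_component_deriv i (?T ?\<sigma>) 1)"
    proof (rule besov_integral_cong)
      fix z :: complex assume z: "norm z < 1"
      have "slice_proj i 1 = 1" using slice_proj_slice_pt[OF unit, of 1] by simp
      then show "norm (deriv (disk_moebius \<alpha>) (trace z) * ?\<psi> z) = norm (slice_component_deriv i (?T ?\<sigma>) 1 z)"
        using z by (simp add: slice_comp_component_deriv[OF \<sigma> z] slice_moebius_component_deriv[OF unit \<alpha> norm_trace])
    qed
    also have "\<dots> \<le> slice_energy p i (?T ?\<sigma>)"
      by (rule besov_integral_component_le[OF p0 unit]) simp
    also have "\<dots> \<le> ennreal pi * besov_sup p (?T ?\<sigma>)"
      by (rule slice_energy_le_besov_sup[OF slice_regular_comp[OF \<sigma>] unit])
    also have "\<dots> \<le> ennreal pi * ennreal m"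
      using \<alpha> by (intro mult_left_mono M) (auto simp: slice_ball_eq[OF unit])
    finally show ?thesis using m by (simp add: ennreal_mult)
  qed
  have comp: "besov_integral p (slice_component_deriv i (?T f) c)
      \<le> ennreal (5 powr (2 * p) * m * pi) * besov_sup p f" if c: "norm c \<le> 1" for c
  proof -
    have "besov_integral p (slice_component_deriv i (?T f) c)
        = besov_integral p (\<lambda>z. slice_component_deriv i f c (trace z) * ?\<psi> z)"
      by (rule besov_integral_cong) (simp add: slice_comp_component_deriv[OF f])
    also have "\<dots> \<le> ennreal (5 powr (2 * p) / pi) * ennreal (pi * m) * besov_integral p (slice_component_deriv i f c)"
      by (rule besov_integral_carleson[OF p slice_component_deriv_holomorphic[OF f unit]
            measurable_trace norm_trace \<psi>_meas test])
    also have "\<dots> \<le> ennreal (5 powr (2 * p) / pi) * ennreal (pi * m) * (ennreal pi * besov_sup p f)"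
      by (intro mult_left_mono order_trans[OF besov_integral_component_le[OF p0 unit c]
            slice_energy_le_besov_sup[OF f unit]]) simp
    also have "\<dots> = ennreal (5 powr (2 * p) * m * pi) * besov_sup p f"
      using m by (simp add: mult.assoc[symmetric] flip: ennreal_mult)
    finally show ?thesis .
  qed
  have "slice_energy p i (?T f) \<le> ennreal (2 powr p) *
      (besov_integral p (slice_component_deriv i (?T f) 1) + besov_integral p (slice_component_deriv i (?T f) j))"
    by (rule slice_energy_le_components[OF p0 reg unit norm_imag_unit[OF j] split])
  also have "\<dots> \<le> ennreal (2 powr p) * (ennreal (5 powr (2 * p) * m * pi) * besov_sup p f
      + ennreal (5 powr (2 * p) * m * pi) * besov_sup p f)"
    by (intro mult_left_mono add_mono comp) (simp_all add: norm_imag_unit[OF j])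
  also have "\<dots> = ennreal (2 powr p * (2 * (5 powr (2 * p) * m * pi))) * besov_sup p f"
  proof -
    have "ennreal (2 * (5 powr (2 * p) * m * pi)) = ennreal (5 powr (2 * p) * m * pi) + ennreal (5 powr (2 * p) * m * pi)"
      using m by (simp flip: ennreal_plus)
    then show ?thesis using m by (subst ennreal_mult) (simp_all add: distrib_right mult.assoc)
  qed
  finally have energy: "slice_energy p i (?T f) \<le> ennreal (2 powr p * (2 * (5 powr (2 * p) * m * pi))) * besov_sup p f" .
  have "besov_sup p (?T f) \<le> ennreal (2 powr p * 2 / pi) * slice_energy p i (?T f)"
    by (rule besov_sup_le[OF p0 reg unit])
  also have "\<dots> \<le> ennreal (2 powr p * 2 / pi) * (ennreal (2 powr p * (2 * (5 powr (2 * p) * m * pi))) * besov_sup p f)"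
    by (intro mult_left_mono energy) simp
  also have "\<dots> = ennreal ((2 powr p * 2 / pi) * (2 powr p * (2 * (5 powr (2 * p) * m * pi)))) * besov_sup p f"
    using m by (subst ennreal_mult) (simp_all add: mult.assoc)
  finally show ?thesis .
qed

lemma bounded_on_besov_iff:
  assumes p: "1 < p"
  shows "bounded_on_besov p (slice_comp i \<Phi>) \<longleftrightarrow>
    (SUP a\<in>slice_ball i. besov_norm p (slice_comp i \<Phi> (slice_moebius a))) < \<infinity>" (is "?bdd \<longleftrightarrow> ?S < \<infinity>")
proof
  assume ?bdd
  then obtain K :: real where K: "\<And>f. f \<in> besov p \<Longrightarrow> besov_norm p (slice_comp i \<Phi> f) \<le> ennreal K * besov_norm p f"
    by (auto simp: bounded_on_besov_def)
  obtain V :: real where V: "\<And>a. a \<in> slice_ball i \<Longrightarrow> slice_moebius a \<in> besov p \<and> besov_norm p (slice_moebius a) \<le> ennreal V"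
    using slice_moebius_besov_bounded[OF p unit] by blast
  have "?S \<le> ennreal K * ennreal V"
  proof (rule SUP_least)
    fix a assume "a \<in> slice_ball i"
    then show "besov_norm p (slice_comp i \<Phi> (slice_moebius a)) \<le> ennreal K * ennreal V"
      using K V by (meson mult_left_mono order_trans zero_le)
  qed
  also have "\<dots> < \<infinity>" by (simp add: ennreal_mult_less_top)
  finally show "?S < \<infinity>" .
next
  assume "?S < \<infinity>"
  then obtain s where s: "?S = ennreal s" "0 \<le> s" by (cases ?S) auto
  let ?T = "slice_comp i \<Phi>"
  have p0: "0 < p" using p by simp
  \<comment> \<open>The norm dominates the p-th root of the seminorm integral even if that is
    infinite, so a finite supremum bounds all the integrals by s^p.\<close>
  have M: "besov_sup p (?T (slice_moebius a)) \<le> ennreal (s powr p)" if "a \<in> slice_ball i" for a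
  proof (rule le_powr_of_ennreal_root_le[OF p0 s(2)])
    have "ennreal_root p (besov_sup p (?T (slice_moebius a))) \<le> besov_norm p (?T (slice_moebius a))"
      by (simp add: besov_norm_def)
    also have "\<dots> \<le> ?S" using that by (rule SUP_upper)
    finally show "ennreal_root p (besov_sup p (?T (slice_moebius a))) \<le> ennreal s" by (simp add: s)
  qed
  define C where "C = (2 powr p * 2 / pi) * (2 powr p * (2 * (5 powr (2 * p) * s powr p * pi)))"
  have C0: "0 \<le> C" by (simp add: C_def)
  define w where "w = trace 0"
  define k where "k = 2 * (5 powr (2 * p) / (1 - norm w) powr (2 * p)) powr (1 / p)"
  \<comment> \<open>The summand 1 accounts for |f 0|, \<open>k\<close> for moving the evaluation
    from 0 to \<Phi> 0, and the last one for the seminorm.\<close>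
  define K where "K = 1 + k + C powr (1 / p)"
  have "?T f \<in> besov p \<and> besov_norm p (?T f) \<le> ennreal K * besov_norm p f" if f: "f \<in> besov p" for f
  proof
    have reg: "slice_regular f" and fin: "besov_sup p f < \<infinity>" using f by (auto simp: besov_def)
    have sup: "besov_sup p (?T f) \<le> ennreal C * besov_sup p f"
      unfolding C_def by (rule besov_sup_comp_le[OF p reg _ M]) simp
    also have "\<dots> < \<infinity>" using fin by (simp add: ennreal_mult_less_top)
    finally show "?T f \<in> besov p" using slice_regular_comp[OF reg] by (simp add: besov_def)
    let ?r = "ennreal_root p (besov_sup p f)" and ?n = "ennreal (norm (f 0))"
    have "?T f 0 = f (slice_pt i w)"
      using slice_comp_slice_pt[OF reg, of 0] by (simp add: w_def)
    then have "ennreal (norm (?T f 0)) \<le> ?n + ennreal k * ?r"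
      using besov_point_evaluation[OF p f unit, of w] norm_trace by (simp add: k_def w_def)
    moreover have "ennreal_root p (besov_sup p (?T f)) \<le> ennreal (C powr (1 / p)) * ?r"
      by (rule ennreal_root_le_mult[OF p0 C0 sup fin])
    ultimately have "besov_norm p (?T f) \<le> (?n + ennreal k * ?r) + ennreal (C powr (1 / p)) * ?r"
      unfolding besov_norm_def by (rule add_mono)
    also have "\<dots> \<le> ennreal K * ?n + ennreal K * ?r"
    proof -
      have k0: "0 \<le> k" by (simp add: k_def)
      have "ennreal 1 * ?n \<le> ennreal K * ?n"
        using k0 by (intro mult_right_mono ennreal_leI) (auto simp: K_def)
      moreover have "ennreal k * ?r + ennreal (C powr (1 / p)) * ?r \<le> ennreal K * ?r"
        unfolding distrib_right[symmetric] using k0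
        by (intro mult_right_mono) (auto simp: K_def ennreal_leI simp flip: ennreal_plus)
      ultimately show ?thesis by (simp add: add.assoc add_mono)
    qed
    also have "\<dots> = ennreal K * besov_norm p f"
      by (simp add: besov_norm_def distrib_left)
    finally show "besov_norm p (?T f) \<le> ennreal K * besov_norm p f" .
  qed
  then show ?bdd unfolding bounded_on_besov_def by blast
qed

end

theorem theorem3p2:
  fixes p :: real and \<Phi> :: "quat \<Rightarrow> quat" and i :: quat
  assumes "1 < p"
    and "slice_regular \<Phi>"
    and "\<Phi> ` \<B> \<subseteq> \<B>"
    and "i \<in> \<S>"
    and "\<Phi> ` slice_ball i \<subseteq> slice_ball i"
  shows "bounded_on_besov p (slice_comp i \<Phi>) \<longleftrightarrow>
    (SUP a\<in>slice_ball i. besov_norm p (slice_comp i \<Phi> (slice_moebius a))) < \<infinity>"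
proof -
  interpret slice_self_map i \<Phi> by unfold_locales (use assms in auto)
  show ?thesis by (rule bounded_on_besov_iff[OF assms(1)])
qed

end
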